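(* Fix $d>8$ and consider excited random walk on $\mathbb{Z}^d$ with excitement parameter $\beta\in[0,1]$. There exists $\beta_0=\beta_0(d)>0$ such that for all $\beta\le\beta_0$ there exist $\theta=(\theta_1(\beta,d),0,\dots,0)$ and a finite matrix $\Sigma=\Sigma(\beta,d)$ such that, as $n\to\infty$: (a) $\mathbb{E}_\beta[\omega_n]=\theta n\,[1+O(\tfrac1n)]$; (b) $\mathrm{Var}_\beta(\omega_n)=\Sigma n\,\Big[1+O\Big(\dfrac{\log n}{n^{1\wedge\frac{d-7}{2}}}\Big)\Big]$; (c) under $\mathbb{Q}_\beta$, $\dfrac{\omega_n-\theta n}{\sqrt n}$ converges in distribution to $\mathcal{N}(0,\Sigma)$.
   Context: Excited random walk (ERW) with parameter $\beta\in[0,1]$ is the nearest-neighbour walk on $\mathbb{Z}^d$ started at $\omega_0=0$ such that, given the history $\vec\omega_i=(x_0,\dots,x_i)$, the probability of stepping from $x_i$ to $x_{i+1}$ is $p_0(x_{i+1}-x_i)$ if $x_i=x_j$ for some $0\le j\le i-1$, and $p_\beta(x_{i+1}-x_i)$ otherwise (first visit to $x_i$, including the starting point at time $0$). Here $p_0(x)=\frac1{2d}I_{\{|x|=1\}}$, $p_\beta(x)=\frac{1+\beta e_1\cdot x}{2d}I_{\{|x|=1\}}$ and $e_1=(1,0,\dots,0)$. $\mathbb{Q}_\beta$ denotes its law, $\mathbb{E}_\beta$ its expectation, and $\mathrm{Var}_\beta(\omega_n)$ the covariance matrix of $\omega_n$ under $\mathbb{Q}_\beta$. $\mathcal{N}(0,\Sigma)$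 is the centred multivariate normal law with covariance matrix $\Sigma$, and $a\wedge b=\min(a,b)$. For a vector or matrix $v$, $v_n=vn[1+O(\epsilon_n)]$ means $|v_n-vn|=O(n\epsilon_n)$ as $n\to\infty$. *)

theory Defs
  imports "HOL-Probability.Probability" "HOL-Library.Landau_Symbols"
begin

section \<open>Excited random walk\<close>

definition real_vec :: "int ^ 'n \<Rightarrow> real ^ 'n" where
  "real_vec x = (\<chi> i. real_of_int (x $ i))"

text \<open>The lattice is \<open>int ^ 'n\<close> with \<open>d = CARD('n)\<close>. A bare finite index type has no first element,
  so the direction of the excitement is a parameter \<open>k :: 'n\<close> and \<open>e\<^sub>1\<close> is \<open>axis k 1\<close>.
  The weight \<open>p\<^sub>0\<close> is the case \<open>\<beta> = 0\<close>.\<close>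

definition step_prob :: "'n::finite \<Rightarrow> real \<Rightarrow> int ^ 'n \<Rightarrow> real" where
  "step_prob k \<beta> x =
     (1 + \<beta> * (axis k 1 \<bullet> real_vec x)) / (2 * real CARD('n)) * indicator {x. norm (real_vec x) = 1} x"

definition step_pmf :: "'n::finite \<Rightarrow> real \<Rightarrow> (int ^ 'n) pmf" where
  "step_pmf k \<beta> = embed_pmf (step_prob k \<beta>)"

lemma unit_steps:
  "{x :: int ^ 'n::finite. norm (real_vec x) = 1} = (\<lambda>(i, s). axis i s) ` (UNIV \<times> {1, -1})"
proof safe
  fix x :: "int ^ 'n"
  assume "norm (real_vec x) = 1"
  then have "(\<Sum>i\<in>UNIV. (real_of_int (x $ i))\<^sup>2) = 1"
    by (simp add: norm_vec_def L2_set_def real_vec_def)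
  then have "real_of_int (\<Sum>i\<in>UNIV. (x $ i)\<^sup>2) = real_of_int 1"
    by simp
  then have sq: "(\<Sum>i\<in>UNIV. (x $ i)\<^sup>2) = 1"
    by (simp only: of_int_eq_iff)
  then obtain i where i: "x $ i \<noteq> 0"
    by (metis (no_types, lifting) power_zero_numeral sum.neutral zero_neq_one)
  have split: "(x $ i)\<^sup>2 + (\<Sum>j\<in>UNIV - {i}. (x $ j)\<^sup>2) = 1"
    using sq by (simp add: sum.remove[of UNIV i])
  have ge1: "(x $ i)\<^sup>2 \<ge> 1"
    using i by (smt (verit) zero_less_power2)
  have ge0: "(\<Sum>j\<in>UNIV - {i}. (x $ j)\<^sup>2) \<ge> 0"
    by (simp add: sum_nonneg)
  have xi: "(x $ i)\<^sup>2 = 1" and rest: "(\<Sum>j\<in>UNIV - {i}. (x $ j)\<^sup>2) = 0"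
    using split ge1 ge0 by auto
  have "x $ j = 0" if "j \<noteq> i" for j
    using rest that by (subst (asm) sum_nonneg_eq_0_iff) auto
  moreover have "x $ i = 1 \<or> x $ i = -1"
    using xi by (simp add: power2_eq_1_iff)
  ultimately have "x = axis i 1 \<or> x = axis i (-1)"
    by (auto simp: vec_eq_iff axis_def)
  then show "x \<in> (\<lambda>(i, s). axis i s) ` (UNIV \<times> {1, -1})"
    by force
next
  fix i :: 'n
  have "norm (real_vec (axis i s :: int ^ 'n)) = real_of_int \<bar>s\<bar>" for s
  proof -
    have "real_vec (axis i s) = axis i (real_of_int s)"
      by (auto simp: real_vec_def vec_eq_iff axis_def)
    then show ?thesis
      by (simp add: norm_eq_sqrt_inner inner_axis_axis)
  qed
  then show "norm (real_vec (axis i 1 :: int ^ 'n)) = 1" "norm (real_vec (axis i (-1) :: int ^ 'n)) = 1"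
    by simp_all
qed

lemma step_prob_nonneg:
  assumes "0 \<le> \<beta>" "\<beta> \<le> 1"
  shows "0 \<le> step_prob k \<beta> x"
proof (cases "norm (real_vec x) = 1")
  case True
  have "\<bar>axis k 1 \<bullet> real_vec x\<bar> \<le> 1"
    using Cauchy_Schwarz_ineq2[of "axis k 1" "real_vec x"] True by (simp add: norm_axis_1)
  then have "\<bar>\<beta> * (axis k 1 \<bullet> real_vec x)\<bar> \<le> 1"
    using assms by (simp add: abs_mult mult_le_one)
  then show ?thesis
    by (simp add: step_prob_def)
qed (simp add: step_prob_def)

lemma step_prob_sum:
  fixes k :: "'n::finite"
  shows "(\<Sum>x | norm (real_vec x) = 1. step_prob k \<beta> x) = 1"
proof -
  have ip: "axis k 1 \<bullet> real_vec (axis i s) = (if i = k then real_of_int s else 0)" for i s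
    by (simp add: inner_axis' real_vec_def) (simp add: axis_def)
  have inj: "inj_on (\<lambda>(i::'n, s::int). axis i s) (UNIV \<times> {1, -1})"
    by (auto simp: inj_on_def axis_eq_axis)
  have "(\<Sum>x | norm (real_vec x) = 1. step_prob k \<beta> x)
      = (\<Sum>x | norm (real_vec x) = 1. (1 + \<beta> * (axis k 1 \<bullet> real_vec x)) / (2 * real CARD('n)))"
    by (rule sum.cong) (auto simp: step_prob_def)
  also have "\<dots> = (\<Sum>(i, s)\<in>UNIV \<times> {1, -1}.
      (1 + \<beta> * (if i = k then real_of_int s else 0)) / (2 * real CARD('n)))"
    unfolding unit_steps by (subst sum.reindex[OF inj]) (simp add: case_prod_unfold ip)
  also have "\<dots> = (\<Sum>i\<in>(UNIV::'n set). 1 / real CARD('n))"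
  proof (subst sum.cartesian_product[symmetric], rule sum.cong)
    fix i :: 'n
    show "(\<Sum>s\<in>{1, -1::int}. (1 + \<beta> * (if i = k then real_of_int s else 0)) / (2 * real CARD('n)))
        = 1 / real CARD('n)"
      by (cases "i = k") (simp_all add: field_simps)
  qed simp
  finally show ?thesis
    by simp
qed

lemma pmf_step_pmf:
  assumes "0 \<le> \<beta>" "\<beta> \<le> 1"
  shows "pmf (step_pmf k \<beta>) x = step_prob k \<beta> x"
  unfolding step_pmf_def
proof (rule pmf_embed_pmf)
  let ?U = "{x. norm (real_vec x) = 1}"
  have fin: "finite ?U"
    unfolding unit_steps by simp
  have "(\<integral>\<^sup>+x. ennreal (step_prob k \<beta> x) \<partial>count_space UNIV) = (\<Sum>x\<in>?U. ennreal (step_prob k \<beta> x))"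
    by (rule nn_integral_count_space') (auto simp: fin step_prob_def)
  also have "\<dots> = 1"
    using step_prob_sum[of k \<beta>] by (simp add: sum_ennreal step_prob_nonneg assms)
  finally show "(\<integral>\<^sup>+x. ennreal (step_prob k \<beta> x) \<partial>count_space UNIV) = 1" .
qed (rule step_prob_nonneg[OF assms])

text \<open>Conditional law of the position at time \<open>n\<close> given the history \<open>h 0, \<dots>, h (n - 1)\<close>.\<close>

fun erw_kernel :: "'n::finite \<Rightarrow> real \<Rightarrow> nat \<Rightarrow> (nat \<Rightarrow> int ^ 'n) \<Rightarrow> (int ^ 'n) pmf" where
  "erw_kernel k \<beta> 0 h = return_pmf 0"
| "erw_kernel k \<beta> (Suc i) h =
     map_pmf (\<lambda>s. h i + s) (step_pmf k (if \<exists>j<i. h j = h i then 0 else \<beta>))"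

interpretation erw: Ionescu_Tulcea
  "\<lambda>i h. measure_pmf (erw_kernel k \<beta> i h)" "\<lambda>_. count_space UNIV" for k :: "'n::finite" and \<beta>
proof
  show "(\<lambda>h. measure_pmf (erw_kernel k \<beta> i h))
      \<in> Pi\<^sub>M {0..<i} (\<lambda>_. count_space UNIV) \<rightarrow>\<^sub>M subprob_algebra (count_space UNIV)" for i
    by (subst count_space_PiM_finite) (auto simp: measure_pmf_in_subprob_algebra)
qed

text \<open>The law of the whole trajectory on \<open>(int ^ 'n)\<close>-valued sequences, obtained from the
  transition kernels by the Ionescu-Tulcea theorem; it is a probability measure with the cylinder
  probabilities given in \<open>measure_erw_cylinder\<close> below.\<close>

definition erw_law :: "'n::finite \<Rightarrow> real \<Rightarrow> (nat \<Rightarrow> int ^ 'n) measure" where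
  "erw_law k \<beta> = erw.PF.lim k \<beta>"

lemma sets_erw_law [measurable_cong]: "sets (erw_law k \<beta>) = sets (Pi\<^sub>M UNIV (\<lambda>_. count_space UNIV))"
  by (simp add: erw_law_def erw.PF.sets_lim)

lemma erw_kernel_cong:
  "(\<And>j. j < i \<Longrightarrow> h j = h' j) \<Longrightarrow> erw_kernel k \<beta> i h = erw_kernel k \<beta> i h'"
  by (cases i) auto

lemma emeasure_erw_C:
  "emeasure (erw.C k \<beta> 0 n (\<lambda>_. undefined)) {restrict x {0..<n}} = (\<Prod>i<n. ennreal (pmf (erw_kernel k \<beta> i x) (x i)))"
proof (induction n)
  case 0
  then show ?case
    by (simp add: space_PiM restrict_def PiE_empty_domain PiM_empty)
next
  case (Suc n)
  let ?M = "\<lambda>_::nat. count_space (UNIV :: (int ^ 'a) set)"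
  let ?u = "\<lambda>_::nat. undefined :: int ^ 'a"
  let ?C = "erw.C k \<beta> 0 n ?u"
  have u: "?u \<in> space (Pi\<^sub>M {0..<0} ?M)"
    by (simp add: space_PiM)
  have cs: "Pi\<^sub>M {0..<m} ?M = count_space (Pi\<^sub>E {0..<m} (\<lambda>_. UNIV))" for m :: nat
    by (rule count_space_PiM_finite) auto
  have spC: "space ?C = space (Pi\<^sub>M {0..<n} ?M)" and stC: "sets ?C = sets (Pi\<^sub>M {0..<n} ?M)"
    using erw.space_C[OF u, of k \<beta> n] erw.sets_C[OF u, of k \<beta> n] by auto
  have A: "{restrict x {0..<Suc n}} \<in> sets (Pi\<^sub>M {0..<Suc n} ?M)"
    by (subst cs) auto
  have B: "{restrict x {0..<n}} \<in> sets ?C"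
    by (subst stC, subst cs) auto
  have "emeasure (erw.C k \<beta> 0 (Suc n) ?u) {restrict x {0..<Suc n}}
      = (\<integral>\<^sup>+h. emeasure (erw.eP k \<beta> n h) {restrict x {0..<Suc n}} \<partial>?C)"
    using A erw.measurable_eP[of k \<beta> n] spC
    by (simp, intro emeasure_bind[where N = "Pi\<^sub>M {0..<Suc n} ?M"])
       (auto simp: space_PiM PiE_eq_empty_iff measurable_cong_sets[OF stC])
  also have "\<dots> = (\<integral>\<^sup>+h. ennreal (pmf (erw_kernel k \<beta> n x) (x n)) * indicator {restrict x {0..<n}} h \<partial>?C)"
  proof (rule nn_integral_cong)
    fix h assume "h \<in> space ?C"
    then have h: "h \<in> space (Pi\<^sub>M {0..<n} ?M)"
      by (simp add: spC)
    then have ext: "h j = undefined" if "j \<ge> n" for j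
      using that by (auto simp: space_PiM PiE_def extensional_def)
    have "fun_upd h n y = restrict x {0..<Suc n} \<longleftrightarrow> h = restrict x {0..<n} \<and> y = x n" for y
    proof
      assume *: "fun_upd h n y = restrict x {0..<Suc n}"
      have "h j = restrict x {0..<n} j" for j
        using fun_cong[OF *, of j] ext[of j] by (cases j n rule: linorder_cases) auto
      then show "h = restrict x {0..<n} \<and> y = x n"
        using fun_cong[OF *, of n] by auto
    qed (auto simp: fun_eq_iff)
    then have "fun_upd h n -` {restrict x {0..<Suc n}} = (if h = restrict x {0..<n} then {x n} else {})"
      by auto
    moreover have "erw_kernel k \<beta> n (restrict x {0..<n}) = erw_kernel k \<beta> n x"
      by (rule erw_kernel_cong) auto
    ultimately show "emeasure (erw.eP k \<beta> n h) {restrict x {0..<Suc n}}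
        = ennreal (pmf (erw_kernel k \<beta> n x) (x n)) * indicator {restrict x {0..<n}} h"
      by (auto simp: erw.emeasure_eP[OF h A] emeasure_pmf_single)
  qed
  also have "\<dots> = (\<Prod>i<Suc n. ennreal (pmf (erw_kernel k \<beta> i x) (x i)))"
    unfolding nn_integral_cmult_indicator[OF B] Suc.IH by (simp add: mult.commute)
  finally show ?case .
qed

lemma measure_erw_cylinder:
  fixes x :: "nat \<Rightarrow> int ^ 'n::finite"
  assumes "0 \<le> \<beta>" "\<beta> \<le> 1" "x 0 = 0"
  shows "measure (erw_law k \<beta>) {\<omega>. \<forall>i\<le>n. \<omega> i = x i} =
    (\<Prod>i<n. step_prob k (if \<exists>j<i. x j = x i then 0 else \<beta>) (x (Suc i) - x i))"
proof -
  let ?M = "\<lambda>_::nat. count_space (UNIV :: (int ^ 'n) set)"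
  let ?X = "{restrict x {0..<Suc n}}"
  have X: "?X \<in> sets (Pi\<^sub>M {0..<Suc n} ?M)"
    by (subst count_space_PiM_finite) auto
  have emb: "{\<omega>. \<forall>i\<le>n. \<omega> i = x i} = prod_emb UNIV ?M {0..<Suc n} ?X"
    by (auto simp: prod_emb_def fun_eq_iff less_Suc_eq_le restrict_def) metis
  have pe: "prod_emb {0..<Suc n} ?M {0..<Suc n} ?X = ?X"
    by (rule prod_emb_id) auto
  have "emeasure (erw_law k \<beta>) {\<omega>. \<forall>i\<le>n. \<omega> i = x i} = emeasure (erw.CI k \<beta> {0..<Suc n}) ?X"
    unfolding erw_law_def emb by (rule erw.lim[OF _ X]) simp
  also have "\<dots> = emeasure (erw.C k \<beta> 0 (Suc n) (\<lambda>_. undefined)) ?X"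
    using erw.emeasure_CI[OF order_refl X] pe by simp
  also have "\<dots> = (\<Prod>i<Suc n. ennreal (pmf (erw_kernel k \<beta> i x) (x i)))"
    by (rule emeasure_erw_C)
  also have "\<dots> = ennreal (\<Prod>i<Suc n. pmf (erw_kernel k \<beta> i x) (x i))"
    by (rule prod_ennreal) simp
  also have "(\<Prod>i<Suc n. pmf (erw_kernel k \<beta> i x) (x i))
      = (\<Prod>i<n. pmf (erw_kernel k \<beta> (Suc i) x) (x (Suc i)))"
    unfolding prod.lessThan_Suc_shift using assms(3) by simp
  also have "\<dots> = (\<Prod>i<n. step_prob k (if \<exists>j<i. x j = x i then 0 else \<beta>) (x (Suc i) - x i))"
  proof (rule prod.cong)
    fix i
    let ?p = "step_pmf k (if \<exists>j<i. x j = x i then 0 else \<beta>)"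
    have "pmf (map_pmf (\<lambda>s. x i + s) ?p) (x i + (x (Suc i) - x i)) = pmf ?p (x (Suc i) - x i)"
      by (rule pmf_map_inj') (simp add: inj_def)
    then show "pmf (erw_kernel k \<beta> (Suc i) x) (x (Suc i))
        = step_prob k (if \<exists>j<i. x j = x i then 0 else \<beta>) (x (Suc i) - x i)"
      using assms by (simp add: pmf_step_pmf)
  qed simp
  finally show ?thesis
    by (simp add: measure_def prod_nonneg step_prob_nonneg assms)
qed

lemma measurable_position [measurable]:
  "(\<lambda>\<omega>. real_vec (\<omega> n)) \<in> borel_measurable (erw_law k \<beta>)"
  by (rule measurable_compose[of _ _ "count_space UNIV"]) measurable

lemma prob_space_erw_law: "prob_space (erw_law k \<beta>)"
proof (rule prob_space_distrD)
  show "(\<lambda>\<omega>. restrict \<omega> {}) \<in> erw_law k \<beta> \<rightarrow>\<^sub>M Pi\<^sub>M {} (\<lambda>_. count_space UNIV)"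
    by (simp add: measurable_cong_sets[OF sets_erw_law refl] measurable_restrict)
  show "prob_space (distr (erw_law k \<beta>) (Pi\<^sub>M {} (\<lambda>_. count_space UNIV)) (\<lambda>\<omega>. restrict \<omega> {}))"
    unfolding erw_law_def by (subst erw.distr_lim) (simp_all add: erw.PF.prob_space_P)
qed

definition erw_mean :: "'n::finite \<Rightarrow> real \<Rightarrow> nat \<Rightarrow> real ^ 'n" where
  "erw_mean k \<beta> n = (\<integral>\<omega>. real_vec (\<omega> n) \<partial>erw_law k \<beta>)"

definition erw_var :: "'n::finite \<Rightarrow> real \<Rightarrow> nat \<Rightarrow> real ^ 'n ^ 'n" where
  "erw_var k \<beta> n = (\<chi> i j. \<integral>\<omega>. (real_vec (\<omega> n) $ i - erw_mean k \<beta> n $ i) *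
                              (real_vec (\<omega> n) $ j - erw_mean k \<beta> n $ j) \<partial>erw_law k \<beta>)"


section \<open>Asymptotics and weak convergence\<close>

text \<open>\<open>asymp_linear v\<^sub>n v \<epsilon>\<close> stands for \<open>v\<^sub>n = v n [1 + O(\<epsilon>\<^sub>n)]\<close>. The norm on matrices is the
  Euclidean norm of the entries.\<close>

definition asymp_linear :: "(nat \<Rightarrow> 'a::real_normed_vector) \<Rightarrow> 'a \<Rightarrow> (nat \<Rightarrow> real) \<Rightarrow> bool" where
  "asymp_linear vs v \<epsilon> \<longleftrightarrow> (\<lambda>n. norm (vs n - real n *\<^sub>R v)) \<in> O(\<lambda>n. real n * \<epsilon> n)"

text \<open>\<open>is_centred_normal \<Sigma> N\<close>: \<open>N\<close> is the centred normal law with covariance matrix \<open>\<Sigma>\<close>, i.e.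
  every linear functional \<open>t \<bullet> x\<close> is distributed like \<open>sqrt (t \<bullet> \<Sigma> t) * Z\<close> with \<open>Z\<close> standard normal.
  Singular \<open>\<Sigma>\<close> is allowed.\<close>

definition is_centred_normal :: "real ^ 'n ^ 'n \<Rightarrow> (real ^ 'n::finite) measure \<Rightarrow> bool" where
  "is_centred_normal \<Sigma> N \<longleftrightarrow>
     prob_space N \<and> sets N = sets borel \<and>
     transpose \<Sigma> = \<Sigma> \<and> (\<forall>t. 0 \<le> t \<bullet> (\<Sigma> *v t)) \<and>
     (\<forall>t. distr N borel (\<lambda>x. t \<bullet> x) =
          distr std_normal_distribution borel (\<lambda>z. sqrt (t \<bullet> (\<Sigma> *v t)) * z))"

definition converges_in_distribution ::
  "'a measure \<Rightarrow> (nat \<Rightarrow> 'a \<Rightarrow> 'b::topological_space) \<Rightarrow> 'b measure \<Rightarrow> bool" where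
  "converges_in_distribution Q X N \<longleftrightarrow>
     (\<forall>f :: 'b \<Rightarrow> real. continuous_on UNIV f \<longrightarrow> bounded (range f) \<longrightarrow>
        (\<lambda>n. \<integral>x. f x \<partial>distr Q borel (X n)) \<longlonglongrightarrow> (\<integral>x. f x \<partial>N))"

end

theory Submission
  imports Defs "HOL-Real_Asymp.Real_Asymp"
begin

text \<open>The walk depends on its past only through the set of sites it has visited, and it only matters
whether the present site belongs to that set. For a set \<open>S\<close> of sites visited earlier, the
walk that remembers \<open>S\<close> and the walk that does not differ only at the times when \<open>S\<close> is hit, and
there the two step laws differ by \<open>\<beta>\<close> times a discrete derivative in the direction \<open>k\<close>.
Telescoping over such times, and then treating the sites visited since the start as the new
memory, expresses the expectation from \<open>S\<close> by expectations of walks with no memory at all. For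
the walk from the origin this gives the linear renewal equation
\<open>expect (Suc n) f {} 0 = (\<Sum>l\<le>n. renewal l (expect (n - l) f {}))\<close> (lemma \<open>renewal_equation\<close>). It is a
lace expansion in which only the most recent stretch of the path is ever compared with the walk.

The expansion converges because of a return estimate that is uniform in the memory
(\<open>return_bound\<close>): the coordinates other than \<open>k\<close> perform an ordinary lazy random walk, whatever
has been visited. There are at least eight of them, so a given site is occupied at time \<open>j\<close> with
probability \<open>O(j\<^sup>-\<^sup>4)\<close>. A stretch of \<open>j\<close> steps leaves \<open>j\<close> sites behind, whence a factor
\<open>j \<cdot> j\<^sup>-\<^sup>4 = j\<^sup>-\<^sup>3\<close> per stretch; inverse cubes are stable under convolution, and for small \<open>\<beta>\<close> the kernel
\<open>renewal l\<close> is \<open>O(l\<^sup>-\<^sup>3)\<close> on functions with bounded derivative in direction \<open>k\<close> (\<open>norm_memory_le\<close>,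
\<open>norm_renewal_le\<close>). In particular it annihilates constants for \<open>l > 0\<close>.

The rest is one-dimensional renewal analysis. On \<open>f y = y\<^sub>k\<close> and \<open>f y = y\<^sub>k\<^sup>2\<close> the equation becomes a
recursion for the mean and the second moment whose coefficients are \<open>O(l\<^sup>-\<^sup>3)\<close> and \<open>O(l\<^sup>-\<^sup>2)\<close>; the
former makes the mean linear up to \<open>O(1)\<close>, the latter makes the variance linear up to \<open>O(log n)\<close>
(\<open>renewal_mean\<close>, \<open>renewal_variance\<close>); since \<open>d > 8\<close>, the exponent \<open>1 \<and> (d - 7)/2\<close> equals \<open>1\<close>. The other
coordinates are martingales with variance \<open>n/d\<close>, and reflections kill all covariances between
different coordinates, so \<open>\<Sigma>\<close> is diagonal. On \<open>f y = exp (i s \<bullet> y)\<close> the equation is a perturbed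
geometric recursion, and at \<open>s = t/\<surd>n\<close> its solution tends to \<open>exp (- t \<bullet> \<Sigma> t / 2)\<close>
(\<open>renewal_characteristic_limit\<close>, \<open>char_walk_limit\<close>). A continuity theorem for characteristic
functions on Euclidean space (\<open>levy_continuity_euclidean\<close>) turns this into weak convergence.\<close>

section \<open>Sums of inverse powers\<close>

lemma sum_telescope_bound:
  fixes a f :: "nat \<Rightarrow> real"
  assumes "\<And>j. a j \<le> f j - f (Suc j)"
  shows "(\<Sum>j=m..<n. a j) \<le> (if m \<le> n then f m - f n else 0)"
proof (cases "m \<le> n")
  case True
  then show ?thesis
  proof (induction n rule: dec_induct)
    case (step n) then show ?case using assms[of n] by (simp add: atLeastLessThanSuc)
  qed simp
qed simp

lemma inverse_square_telescope: "1 / (real j + 1)^2 \<le> 2 / (real j + 1) - 2 / (real (Suc j) + 1)"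
  by (simp add: divide_simps power2_eq_square)

lemma inverse_cube_telescope: "1 / (real j + 1)^3 \<le> 2 / (real j + 1)^2 - 2 / (real (Suc j) + 1)^2"
proof -
  have "(real j + 2)^2 \<le> 2 * (2 * real j + 3) * (real j + 1)"
    by (simp add: power2_eq_square algebra_simps)
  then have "1 / (real j + 1)^3 \<le> 2 * (2 * real j + 3) / ((real j + 1)^2 * (real j + 2)^2)"
    by (simp add: divide_simps) (simp add: algebra_simps power_numeral_reduce)
  also have "\<dots> = 2 / (real j + 1)^2 - 2 / (real (Suc j) + 1)^2"
    by (simp add: divide_simps power2_eq_square) (simp add: algebra_simps)
  finally show ?thesis .
qed

lemma inverse_square_sum_le: "(\<Sum>j=m..<n. 1 / (real j + 1)^2) \<le> 2 / (real m + 1)"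
proof -
  have "(\<Sum>j=m..<n. 1 / (real j + 1)^2) \<le> (if m \<le> n then 2 / (real m + 1) - 2 / (real n + 1) else 0)"
    by (rule sum_telescope_bound) (rule inverse_square_telescope)
  also have "\<dots> \<le> 2 / (real m + 1)" by simp
  finally show ?thesis .
qed

lemma inverse_cube_sum_le: "(\<Sum>j=m..<n. 1 / (real j + 1)^3) \<le> 2 / (real m + 1)^2"
proof -
  have "(\<Sum>j=m..<n. 1 / (real j + 1)^3) \<le> (if m \<le> n then 2 / (real m + 1)^2 - 2 / (real n + 1)^2 else 0)"
    by (rule sum_telescope_bound) (rule inverse_cube_telescope)
  also have "\<dots> \<le> 2 / (real m + 1)^2" by simp
  finally show ?thesis .
qed

lemma reciprocal_product:
  fixes x y :: real
  assumes "x > 0" "y > 0"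
  shows "1 / x * (1 / y) = (1 / x + 1 / y) / (x + y)"
proof -
  have "1 / x + 1 / y = (x + y) / (x * y)" using assms by (simp add: add_frac_eq)
  then show ?thesis using assms by simp
qed

text \<open>The identity \<open>1/(a b) = (1/a + 1/b)/(a + b)\<close> shows that in a convolution of inverse powers one of
the two factors is always essentially at its far end, so that the power is reproduced.\<close>

lemma inverse_square_convolution:
  "(\<Sum>l\<le>n. 1 / (real l + 1)^2 * (1 / (real (n - l) + 1)^2)) \<le> 8 / (real n + 2)^2"
proof -
  have "1 / (real l + 1)^2 * (1 / (real (n - l) + 1)^2)
      \<le> 2 / (real n + 2)^2 * (1 / (real l + 1)^2 + 1 / (real (n - l) + 1)^2)" if "l \<le> n" for l
  proof -
    define a b where "a = 1 / (real l + 1)" and "b = 1 / (real (n - l) + 1)"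
    have "a * b = (a + b) / ((real l + 1) + (real (n - l) + 1))"
      unfolding a_def b_def by (rule reciprocal_product) simp_all
    also have "(real l + 1) + (real (n - l) + 1) = real n + 2"
      using that by (simp add: of_nat_diff)
    finally have ab: "a * b = (a + b) / (real n + 2)" .
    have "(a + b)^2 \<le> 2 * (a^2 + b^2)"
      using sum_squares_ge_zero[of "a - b" 0] by (simp add: power2_eq_square algebra_simps)
    then have "(a * b)^2 \<le> 2 / (real n + 2)^2 * (a^2 + b^2)"
      unfolding ab by (simp add: power_divide divide_right_mono)
    then show ?thesis by (simp add: a_def b_def power_divide power_mult_distrib)
  qed
  then have "(\<Sum>l\<le>n. 1 / (real l + 1)^2 * (1 / (real (n - l) + 1)^2))
     \<le> (\<Sum>l\<le>n. 2 / (real n + 2)^2 * (1 / (real l + 1)^2 + 1 / (real (n - l) + 1)^2))"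
    by (intro sum_mono) auto
  also have "\<dots> = 2 / (real n + 2)^2 * ((\<Sum>l\<le>n. 1 / (real l + 1)^2) + (\<Sum>l\<le>n. 1 / (real (n - l) + 1)^2))"
    by (simp only: sum_distrib_left[symmetric] sum.distrib)
  also have "(\<Sum>l\<le>n. 1 / (real (n - l) + 1)^2) = (\<Sum>l\<le>n. 1 / (real l + 1)^2)"
    using sum.atLeastAtMost_rev[of "\<lambda>l. 1 / (real l + 1)^2" 0 n] by (simp add: atMost_atLeast0)
  also have "(\<Sum>l\<le>n. 1 / (real l + 1)^2) \<le> 2"
    using inverse_square_sum_le[of 0 "Suc n"] by (simp add: lessThan_Suc_atMost atLeast0LessThan)
  finally show ?thesis by (simp add: mult_left_mono divide_right_mono)
qed

lemma inverse_cube_convolution: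
  "(\<Sum>l\<le>n. 1 / (real l + 1)^3 * (1 / (real (n - l) + 1)^3)) \<le> 16 / (real n + 2)^3"
proof -
  have "1 / (real l + 1)^3 * (1 / (real (n - l) + 1)^3)
      \<le> 4 / (real n + 2)^3 * (1 / (real l + 1)^3 + 1 / (real (n - l) + 1)^3)" if "l \<le> n" for l
  proof -
    define a b where "a = 1 / (real l + 1)" and "b = 1 / (real (n - l) + 1)"
    have pos: "a \<ge> 0" "b \<ge> 0" by (simp_all add: a_def b_def)
    have "a * b = (a + b) / ((real l + 1) + (real (n - l) + 1))"
      unfolding a_def b_def by (rule reciprocal_product) simp_all
    also have "(real l + 1) + (real (n - l) + 1) = real n + 2"
      using that by (simp add: of_nat_diff)
    finally have ab: "a * b = (a + b) / (real n + 2)" .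
    have "4 * (a^3 + b^3) - (a + b)^3 = 3 * (a + b) * (a - b)^2"
      by (simp add: power_numeral_reduce algebra_simps)
    also have "\<dots> \<ge> 0" using pos by simp
    finally have "(a * b)^3 \<le> 4 / (real n + 2)^3 * (a^3 + b^3)"
      unfolding ab by (simp add: power_divide divide_right_mono)
    then show ?thesis by (simp add: a_def b_def power_divide power_mult_distrib)
  qed
  then have "(\<Sum>l\<le>n. 1 / (real l + 1)^3 * (1 / (real (n - l) + 1)^3))
     \<le> (\<Sum>l\<le>n. 4 / (real n + 2)^3 * (1 / (real l + 1)^3 + 1 / (real (n - l) + 1)^3))"
    by (intro sum_mono) auto
  also have "\<dots> = 4 / (real n + 2)^3 * ((\<Sum>l\<le>n. 1 / (real l + 1)^3) + (\<Sum>l\<le>n. 1 / (real (n - l) + 1)^3))"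
    by (simp only: sum_distrib_left[symmetric] sum.distrib)
  also have "(\<Sum>l\<le>n. 1 / (real (n - l) + 1)^3) = (\<Sum>l\<le>n. 1 / (real l + 1)^3)"
    using sum.atLeastAtMost_rev[of "\<lambda>l. 1 / (real l + 1)^3" 0 n] by (simp add: atMost_atLeast0)
  also have "(\<Sum>l\<le>n. 1 / (real l + 1)^3) \<le> 2"
    using inverse_cube_sum_le[of 0 "Suc n"] by (simp add: lessThan_Suc_atMost atLeast0LessThan)
  finally show ?thesis by (simp add: mult_left_mono divide_right_mono)
qed

lemma summable_inverse_square: "summable (\<lambda>l. 1 / (real l + 1)^2)"
  using summable_Suc_iff[of "\<lambda>l. inverse (real l ^ 2)"] inverse_power_summable[of 2, where ?'a=real]
  by (simp add: inverse_eq_divide add.commute)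

lemma summable_inverse_cube: "summable (\<lambda>l. 1 / (real l + 1)^3)"
  using summable_Suc_iff[of "\<lambda>l. inverse (real l ^ 3)"] inverse_power_summable[of 3, where ?'a=real]
  by (simp add: inverse_eq_divide add.commute)

lemma suminf_tail_bound:
  fixes a :: "nat \<Rightarrow> 'a::banach"
  assumes a: "\<And>l. l \<ge> m \<Longrightarrow> norm (a l) \<le> C * b l"
      and b: "\<And>n. (\<Sum>l=m..<n. b l) \<le> B" and "summable b" "C \<ge> 0"
  shows "summable a" "norm (suminf a - (\<Sum>l<m. a l)) \<le> C * B"
proof -
  show sa: "summable a"
    by (rule summable_comparison_test'[where N=m and g="\<lambda>l. C * b l"]) (use assms in \<open>auto intro: summable_mult\<close>)
  have "(\<lambda>n. \<Sum>l<n. a l) \<longlonglongrightarrow> suminf a"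
    using sa by (simp add: summable_LIMSEQ)
  then have lim: "(\<lambda>n. norm ((\<Sum>l<n. a l) - (\<Sum>l<m. a l))) \<longlonglongrightarrow> norm (suminf a - (\<Sum>l<m. a l))"
    by (intro tendsto_intros)
  show "norm (suminf a - (\<Sum>l<m. a l)) \<le> C * B"
  proof (rule LIMSEQ_le_const2[OF lim], intro exI allI impI)
    fix n assume "m \<le> n"
    have "(\<Sum>l<n. a l) - (\<Sum>l<m. a l) = (\<Sum>l=m..<n. a l)"
      using sum_diff_nat_ivl[of 0 m n a] \<open>m \<le> n\<close> by (simp add: atLeast0LessThan)
    also have "norm \<dots> \<le> (\<Sum>l=m..<n. C * b l)"
      by (rule sum_norm_le) (use a in auto)
    also have "\<dots> \<le> C * B"
      using b[of n] \<open>C \<ge> 0\<close> by (simp add: sum_distrib_left[symmetric] mult_left_mono)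
    finally show "norm ((\<Sum>l<n. a l) - (\<Sum>l<m. a l)) \<le> C * B" .
  qed
qed

lemma cube_tail:
  fixes a :: "nat \<Rightarrow> 'a::banach"
  assumes "\<And>l. l \<ge> m \<Longrightarrow> norm (a l) \<le> C / (real l + 1)^3" "C \<ge> 0"
  shows "summable a" "norm (suminf a - (\<Sum>l<m. a l)) \<le> 2 * C / (real m + 1)^2"
  using suminf_tail_bound[of m a C "\<lambda>l. 1 / (real l + 1)^3" "2 / (real m + 1)^2"] assms
    inverse_cube_sum_le summable_inverse_cube by (simp_all add: mult.commute)

lemma square_tail:
  fixes a :: "nat \<Rightarrow> 'a::banach"
  assumes "\<And>l. l \<ge> m \<Longrightarrow> norm (a l) \<le> C / (real l + 1)^2" "C \<ge> 0"
  shows "summable a" "norm (suminf a - (\<Sum>l<m. a l)) \<le> 2 * C / (real m + 1)"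
  using suminf_tail_bound[of m a C "\<lambda>l. 1 / (real l + 1)^2" "2 / (real m + 1)"] assms
    inverse_square_sum_le summable_inverse_square by (simp_all add: mult.commute)

section \<open>Renewal sequences with cubically decaying memory\<close>

lemma increments_bound:
  fixes D :: "nat \<Rightarrow> 'a::real_normed_vector"
  assumes "\<And>n. norm (D (Suc n) - D n) \<le> b n" "m \<le> n"
  shows "norm (D n - D m) \<le> (\<Sum>i=m..<n. b i)"
  using \<open>m \<le> n\<close>
proof (induction n rule: dec_induct)
  case (step n)
  have "norm (D (Suc n) - D m) \<le> norm (D (Suc n) - D n) + norm (D n - D m)"
    using norm_triangle_ineq[of "D (Suc n) - D n" "D n - D m"] by simp
  then show ?case using step assms(1)[of n] by (simp add: atLeastLessThanSuc)
qed simp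

text \<open>In a convolution only the last \<open>l\<close> increments matter; bounding each of them by the earliest one
costs a factor \<open>l\<close>, which a kernel of order \<open>l\<^sup>-\<^sup>3\<close> turns into \<open>l\<^sup>-\<^sup>2\<close>.\<close>

lemma increments_bound_near:
  fixes D :: "nat \<Rightarrow> 'a::real_normed_vector"
  assumes "\<And>n. norm (D (Suc n) - D n) \<le> a + c / (real n + 1)^2" "c \<ge> 0" "l \<le> n"
  shows "norm (D n - D (n - l)) \<le> real l * (a + c / (real (n - l) + 1)^2)"
proof -
  have "norm (D n - D (n - l)) \<le> (\<Sum>i=n-l..<n. a + c / (real i + 1)^2)"
    by (rule increments_bound) (use assms in auto)
  also have "\<dots> \<le> (\<Sum>i=n-l..<n. a + c / (real (n - l) + 1)^2)"
    by (intro sum_mono add_left_mono divide_left_mono power_mono) (use assms in auto)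
  finally show ?thesis using \<open>l \<le> n\<close> by simp
qed

lemma cube_times_index:
  assumes "C \<ge> 0" shows "C / (real l + 1)^3 * real l \<le> C / (real l + 1)^2"
  using assms by (simp add: divide_simps power_numeral_reduce)  (simp add: algebra_simps mult_left_mono)

text \<open>The increment of \<open>M\<close> misses its limit by the tail of \<open>r\<close>, which is of order \<open>n\<^sup>-\<^sup>2\<close> and thus summable.\<close>

lemma renewal_mean:
  fixes r M :: "nat \<Rightarrow> real"
  assumes r: "\<And>l. \<bar>r l\<bar> \<le> C / (real l + 1)^3"
      and M: "M 0 = 0" "\<And>n. M (Suc n) = M n + (\<Sum>l\<le>n. r l)"
  defines "D \<equiv> \<lambda>n. M n - real n * suminf r"
  shows "\<bar>D (Suc n) - D n\<bar> \<le> 2 * C / (real n + 1)^2" "\<bar>D n\<bar> \<le> 4 * C"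
proof -
  have C: "C \<ge> 0" using r[of 0] by simp
  show *: "\<bar>D (Suc n) - D n\<bar> \<le> 2 * C / (real n + 1)^2" for n
  proof -
    have "D (Suc n) - D n = - (suminf r - (\<Sum>l<Suc n. r l))"
      by (simp add: D_def M algebra_simps lessThan_Suc_atMost)
    also have "norm \<dots> \<le> 2 * C / (real (Suc n) + 1)^2"
      unfolding norm_minus_cancel by (rule cube_tail) (use r C in auto)
    also have "\<dots> \<le> 2 * C / (real n + 1)^2"
      using C by (intro divide_left_mono power_mono) auto
    finally show ?thesis by simp
  qed
  have "norm (D n - D 0) \<le> (\<Sum>i=0..<n. 2 * C / (real i + 1)^2)"
    by (rule increments_bound) (use * in auto)
  also have "\<dots> = 2 * C * (\<Sum>i=0..<n. 1 / (real i + 1)^2)"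
    by (simp add: sum_distrib_left)
  also have "\<dots> \<le> 2 * C * 2"
    using inverse_square_sum_le[of 0 n] C by (intro mult_left_mono) auto
  finally show "\<bar>D n\<bar> \<le> 4 * C" by (simp add: D_def M)
qed

lemma harmonic_sum_le: "n \<ge> 1 \<Longrightarrow> (\<Sum>j<n. 1 / (real j + 1)) \<le> 1 + ln (real n)"
proof (induction n rule: dec_induct)
  case (step n)
  have "ln (1 - 1 / (real n + 1)) \<le> - 1 / (real n + 1)"
    using ln_add_one_self_le_self2[of "- 1 / (real n + 1)"] step by (simp add: field_simps)
  also have "1 - 1 / (real n + 1) = real n / real (Suc n)" by (simp add: field_simps)
  finally have "1 / (real n + 1) \<le> ln (real (Suc n)) - ln (real n)"
    using step by (simp add: ln_div)
  then show ?case using step by simp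
qed simp

text \<open>With \<open>R n = (\<Sum>l\<le>n. r l)\<close> the increment of \<open>v - M\<^sup>2\<close> is
\<open>(\<Sum>l\<le>n. q l) + 2 (\<Sum>l\<le>n. r l (M (n - l) - M n)) - (R n)\<^sup>2\<close>. Inserting \<open>M (n - l) - M n \<approx> - l \<theta>\<close> gives \<open>\<sigma>\<close>; the
tails of \<open>q\<close> and of \<open>l r l\<close> are of order \<open>1/n\<close>, and adding them up produces the logarithm.\<close>

lemma renewal_variance:
  fixes r q M v :: "nat \<Rightarrow> real"
  assumes r: "\<And>l. \<bar>r l\<bar> \<le> C / (real l + 1)^3" and q: "\<And>l. \<bar>q l\<bar> \<le> C / (real l + 1)^2"
      and M: "M 0 = 0" "\<And>n. M (Suc n) = M n + (\<Sum>l\<le>n. r l)"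
      and v: "v 0 = 0" "\<And>n. v (Suc n) = v n + (\<Sum>l\<le>n. q l + 2 * r l * M (n - l))"
  defines "\<theta> \<equiv> suminf r"
  defines "\<sigma> \<equiv> suminf q - 2 * \<theta> * (\<Sum>l. real l * r l) - \<theta>^2"
  shows "\<exists>B. \<forall>n\<ge>1. \<bar>v n - (M n)^2 - real n * \<sigma>\<bar> \<le> B * (1 + ln (real n))"
proof -
  have C: "C \<ge> 0" using r[of 0] by simp
  define D where "D n = M n - real n * \<theta>" for n
  define W where "W n = v n - (M n)^2 - real n * \<sigma>" for n
  define R where "R n = (\<Sum>l\<le>n. r l)" for n
  note DD = renewal_mean[OF r M, folded \<theta>_def, folded D_def]
  have lr: "\<bar>real l * r l\<bar> \<le> C / (real l + 1)^2" for l
  proof -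
    have "\<bar>real l * r l\<bar> \<le> C / (real l + 1)^3 * real l"
      using mult_right_mono[OF r[of l], of "real l"] by (simp add: abs_mult mult.commute)
    also have "\<dots> \<le> C / (real l + 1)^2" by (rule cube_times_index[OF C])
    finally show ?thesis .
  qed
  have Rb: "\<bar>R n\<bar> \<le> 2 * C" for n
  proof -
    have "\<bar>R n\<bar> \<le> (\<Sum>l\<le>n. C / (real l + 1)^3)"
      unfolding R_def by (rule order_trans[OF sum_abs sum_mono]) (use r in auto)
    also have "\<dots> = C * (\<Sum>l=0..<Suc n. 1 / (real l + 1)^3)"
      by (simp add: sum_distrib_left atLeast0LessThan lessThan_Suc_atMost)
    also have "\<dots> \<le> C * 2" using inverse_cube_sum_le[of 0 "Suc n"] C by (intro mult_left_mono) auto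
    finally show ?thesis by simp
  qed
  have RT: "\<bar>\<theta> - R n\<bar> \<le> 2 * C / (real n + 1)" for n
  proof -
    have "norm (suminf r - (\<Sum>l<Suc n. r l)) \<le> 2 * C / (real (Suc n) + 1)^2"
      by (rule cube_tail) (use r C in auto)
    also have "real n + 1 \<le> (real (Suc n) + 1)^2" by (simp add: power2_eq_square algebra_simps)
    then have "2 * C / (real (Suc n) + 1)^2 \<le> 2 * C / (real n + 1)"
      using C by (intro divide_left_mono mult_pos_pos) auto
    finally show ?thesis by (simp add: \<theta>_def R_def lessThan_Suc_atMost)
  qed
  have th: "\<bar>\<theta>\<bar> \<le> 2 * C"
  proof -
    have "norm (suminf r - (\<Sum>l<0. r l)) \<le> 2 * C / (real 0 + 1)^2"
      by (rule cube_tail) (use r C in auto)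
    then show ?thesis by (simp add: \<theta>_def)
  qed
  define B where "B = 2 * C + 8 * C^2 + 32 * C^2 + 8 * C^2"
  have inc: "\<bar>W (Suc n) - W n\<bar> \<le> B / (real n + 1)" for n
  proof -
    have qt: "\<bar>suminf q - (\<Sum>l\<le>n. q l)\<bar> \<le> 2 * C / (real n + 1)"
    proof -
      have "norm (suminf q - (\<Sum>l<Suc n. q l)) \<le> 2 * C / (real (Suc n) + 1)"
        by (rule square_tail) (use q C in auto)
      also have "\<dots> \<le> 2 * C / (real n + 1)" using C by (intro divide_left_mono) auto
      finally show ?thesis by (simp add: lessThan_Suc_atMost)
    qed
    have lt: "\<bar>(\<Sum>l. real l * r l) - (\<Sum>l\<le>n. real l * r l)\<bar> \<le> 2 * C / (real n + 1)"
    proof -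
      have "norm ((\<Sum>l. real l * r l) - (\<Sum>l<Suc n. real l * r l)) \<le> 2 * C / (real (Suc n) + 1)"
        by (rule square_tail) (use lr C in auto)
      also have "\<dots> \<le> 2 * C / (real n + 1)" using C by (intro divide_left_mono) auto
      finally show ?thesis by (simp add: lessThan_Suc_atMost)
    qed
    have Db: "\<bar>r l * (D (n - l) - D n)\<bar> \<le> 2 * C^2 * (1 / (real l + 1)^2 * (1 / (real (n - l) + 1)^2))"
      if "l \<le> n" for l
    proof -
      have "norm (D n - D (n - l)) \<le> real l * (0 + 2 * C / (real (n - l) + 1)^2)"
        by (rule increments_bound_near) (use DD C that in auto)
      then have "\<bar>r l * (D (n - l) - D n)\<bar> \<le> \<bar>r l\<bar> * (real l * (2 * C / (real (n - l) + 1)^2))"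
        unfolding abs_mult by (intro mult_left_mono) (simp_all add: abs_minus_commute)
      also have "\<dots> = \<bar>real l * r l\<bar> * (2 * C / (real (n - l) + 1)^2)"
        by (simp add: abs_mult)
      also have "\<dots> \<le> C / (real l + 1)^2 * (2 * C / (real (n - l) + 1)^2)"
        using C by (intro mult_right_mono lr) auto
      finally show ?thesis by (simp add: power2_eq_square mult_ac)
    qed
    have Ds: "\<bar>\<Sum>l\<le>n. r l * (D (n - l) - D n)\<bar> \<le> 16 * C^2 / (real n + 1)"
    proof -
      have "\<bar>\<Sum>l\<le>n. r l * (D (n - l) - D n)\<bar> \<le> (\<Sum>l\<le>n. 2 * C^2 * (1 / (real l + 1)^2 * (1 / (real (n - l) + 1)^2)))"
        by (rule order_trans[OF sum_abs sum_mono]) (use Db in auto)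
      also have "\<dots> \<le> 2 * C^2 * (8 / (real n + 2)^2)"
        unfolding sum_distrib_left[symmetric] by (intro mult_left_mono inverse_square_convolution) auto
      also have "\<dots> = 16 * C^2 / (real n + 2)^2" by simp
      also have "real n + 1 \<le> (real n + 2)^2" by (simp add: power2_eq_square algebra_simps)
      then have "16 * C^2 / (real n + 2)^2 \<le> 16 * C^2 / (real n + 1)"
        by (intro divide_left_mono mult_pos_pos) auto
      finally show ?thesis .
    qed
    have R2: "\<bar>\<theta>^2 - (R n)^2\<bar> \<le> 8 * C^2 / (real n + 1)"
    proof -
      have "\<bar>\<theta>^2 - (R n)^2\<bar> = \<bar>\<theta> - R n\<bar> * \<bar>\<theta> + R n\<bar>"
        by (simp add: power2_eq_square algebra_simps flip: abs_mult)
      also have "\<dots> \<le> 2 * C / (real n + 1) * (4 * C)"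
        by (intro mult_mono RT) (use th Rb[of n] C in auto)
      finally show ?thesis by (simp add: power2_eq_square)
    qed
    have Ml: "M (n - l) = M n - real l * \<theta> + (D (n - l) - D n)" if "l \<le> n" for l
      using that by (simp add: D_def of_nat_diff algebra_simps)
    have "q l + 2 * r l * M (n - l)
       = q l + 2 * M n * r l - 2 * \<theta> * (real l * r l) + 2 * (r l * (D (n - l) - D n))" if "l \<le> n" for l
      unfolding Ml[OF that] by (simp add: algebra_simps)
    then have "(\<Sum>l\<le>n. q l + 2 * r l * M (n - l))
       = (\<Sum>l\<le>n. q l + 2 * M n * r l - 2 * \<theta> * (real l * r l) + 2 * (r l * (D (n - l) - D n)))"
      by (intro sum.cong) auto
    also have "\<dots> = (\<Sum>l\<le>n. q l) + 2 * M n * R n - 2 * \<theta> * (\<Sum>l\<le>n. real l * r l)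
        + 2 * (\<Sum>l\<le>n. r l * (D (n - l) - D n))"
      by (simp add: sum.distrib sum_subtractf sum_distrib_left R_def)
    finally have "W (Suc n) - W n = - (suminf q - (\<Sum>l\<le>n. q l)) 
        + 2 * \<theta> * ((\<Sum>l. real l * r l) - (\<Sum>l\<le>n. real l * r l))
        + 2 * (\<Sum>l\<le>n. r l * (D (n - l) - D n)) + (\<theta>^2 - (R n)^2)"
      unfolding W_def v M(2) \<sigma>_def R_def by (simp add: power2_eq_square algebra_simps)
    also have "\<bar>\<dots>\<bar> \<le> 2 * C / (real n + 1) + 2 * (2 * C) * (2 * C / (real n + 1))
        + 2 * (16 * C^2 / (real n + 1)) + 8 * C^2 / (real n + 1)"
    proof -
      have "\<bar>2 * \<theta> * ((\<Sum>l. real l * r l) - (\<Sum>l\<le>n. real l * r l))\<bar> \<le> 2 * (2 * C) * (2 * C / (real n + 1))"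
        unfolding abs_mult by (intro mult_mono lt) (use th C in auto)
      then show ?thesis using qt Ds R2 by linarith
    qed
    also have "\<dots> = B / (real n + 1)"
      by (simp add: B_def add_divide_distrib power2_eq_square)
    finally show ?thesis .
  qed
  have "\<bar>W n\<bar> \<le> B * (1 + ln (real n))" if "n \<ge> 1" for n
  proof -
    have "norm (W n - W 0) \<le> (\<Sum>i=0..<n. B / (real i + 1))"
      by (rule increments_bound) (use inc in auto)
    also have "\<dots> = B * (\<Sum>i<n. 1 / (real i + 1))"
      by (simp add: sum_distrib_left atLeast0LessThan)
    also have "\<dots> \<le> B * (1 + ln (real n))"
      by (intro mult_left_mono harmonic_sum_le that) (use C in \<open>auto simp: B_def\<close>)
    finally show ?thesis by (simp add: W_def M v)
  qed
  then show ?thesis unfolding W_def by blast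
qed


text \<open>Here \<open>\<psi> l\<close> is the kernel at a frequency of size \<open>\<sigma>\<close>. If \<open>H\<close> did not vary over the range of the
kernel, one step would multiply it by \<open>1 + A\<close>. The error is controlled by a bootstrap: increments
of \<open>H\<close> are trivially of order \<open>\<sigma>\<close>; used in the convolution this improves them to
\<open>\<sigma>\<^sup>2 + \<sigma>/n\<^sup>2\<close>, and used once more it yields the bound below. Summed over \<open>n \<le> 1/\<sigma>\<^sup>2\<close> it is of order \<open>\<sigma>\<close>.\<close>

lemma renewal_characteristic_step:
  fixes H \<psi> :: "nat \<Rightarrow> complex"
  assumes \<psi>: "\<And>l. l \<ge> 1 \<Longrightarrow> norm (\<psi> l) \<le> C * \<sigma> / (real l + 1)^3"
      and A: "A = suminf \<psi> - 1" "norm A \<le> C * \<sigma>^2"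
      and H: "\<And>n. norm (H n) \<le> 1" "\<And>n. H (Suc n) = (\<Sum>l\<le>n. \<psi> l * H (n - l))"
      and \<sigma>: "0 \<le> \<sigma>" "\<sigma> \<le> 1" and C: "C \<ge> 0"
  defines "K \<equiv> 28 * C^3 + 18 * C^2 + 2 * C"
  shows "norm (H (Suc n) - (1 + A) * H n) \<le> K * (\<sigma>^3 + \<sigma> / (real n + 1)^2)"
proof -
  define S where "S n = (\<Sum>l\<le>n. \<psi> l * (H (n - l) - H n))" for n
  define T where "T n = suminf \<psi> - (\<Sum>l<Suc n. \<psi> l)" for n
  have Hs: "H (Suc n) - (1 + A) * H n = S n - T n * H n" for n
    by (simp add: S_def T_def H(2) A(1) algebra_simps sum_subtractf sum_distrib_left lessThan_Suc_atMost)
  have \<sigma>2: "\<sigma>^2 \<le> \<sigma>" using \<sigma> by (simp add: power2_eq_square mult_left_le)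
  have T: "norm (T n * H n) \<le> 2 * C * \<sigma> / (real n + 1)^2" for n
  proof -
    have "norm (T n) \<le> 2 * (C * \<sigma>) / (real (Suc n) + 1)^2"
      unfolding T_def by (rule cube_tail) (use \<psi> C \<sigma> in auto)
    also have "\<dots> \<le> 2 * (C * \<sigma>) / (real n + 1)^2"
      using C \<sigma> by (intro divide_left_mono power_mono) auto
    finally have "norm (T n) * norm (H n) \<le> 2 * (C * \<sigma>) / (real n + 1)^2 * 1"
      by (intro mult_mono H) (use C \<sigma> in auto)
    then show ?thesis by (simp add: norm_mult)
  qed
  have S: "norm (S n) \<le> C * \<sigma> * (2 * a + 8 * c / (real n + 1)^2)"
    if inc: "\<And>n. norm (H (Suc n) - H n) \<le> a + c / (real n + 1)^2" and "a \<ge> 0" "c \<ge> 0" for a c n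
  proof -
    have "norm (\<psi> l * (H (n - l) - H n))
       \<le> C * \<sigma> * (a * (1 / (real l + 1)^2) + c * (1 / (real l + 1)^2 * (1 / (real (n - l) + 1)^2)))"
      if "l \<le> n" for l
    proof (cases "l = 0")
      case False
      have "norm (\<psi> l * (H (n - l) - H n)) \<le> C * \<sigma> / (real l + 1)^3 * (real l * (a + c / (real (n - l) + 1)^2))"
        unfolding norm_mult
        using increments_bound_near[OF inc \<open>c \<ge> 0\<close> \<open>l \<le> n\<close>] False \<sigma> C \<open>a \<ge> 0\<close> \<open>c \<ge> 0\<close>
        by (intro mult_mono \<psi>) (auto simp: norm_minus_commute)
      also have "\<dots> = (C * \<sigma> / (real l + 1)^3 * real l) * (a + c / (real (n - l) + 1)^2)"
        by (simp add: mult.assoc)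
      also have "\<dots> \<le> (C * \<sigma> / (real l + 1)^2) * (a + c / (real (n - l) + 1)^2)"
        using \<sigma> C \<open>a \<ge> 0\<close> \<open>c \<ge> 0\<close> by (intro mult_right_mono cube_times_index) auto
      finally show ?thesis by (simp add: distrib_left mult_ac)
    qed (use \<sigma> C \<open>a \<ge> 0\<close> \<open>c \<ge> 0\<close> in simp)
    then have "norm (S n) \<le> (\<Sum>l\<le>n. C * \<sigma> * (a * (1 / (real l + 1)^2) + c * (1 / (real l + 1)^2 * (1 / (real (n - l) + 1)^2))))"
      unfolding S_def by (intro sum_norm_le) auto
    also have "\<dots> = C * \<sigma> * (a * (\<Sum>l\<le>n. 1 / (real l + 1)^2) + c * (\<Sum>l\<le>n. 1 / (real l + 1)^2 * (1 / (real (n - l) + 1)^2)))"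
      by (simp only: sum_distrib_left[symmetric] sum.distrib)
    also have "\<dots> \<le> C * \<sigma> * (a * 2 + c * (8 / (real n + 1)^2))"
    proof (intro mult_left_mono add_mono)
      show "(\<Sum>l\<le>n. 1 / (real l + 1)^2) \<le> 2"
        using inverse_square_sum_le[of 0 "Suc n"] by (simp add: lessThan_Suc_atMost atLeast0LessThan)
      have "8 / (real n + 2)^2 \<le> 8 / (real n + 1)^2" by (intro divide_left_mono power_mono) auto
      then show "(\<Sum>l\<le>n. 1 / (real l + 1)^2 * (1 / (real (n - l) + 1)^2)) \<le> 8 / (real n + 1)^2"
        using inverse_square_convolution[of n] by linarith
    qed (use that \<sigma> C in auto)
    finally show ?thesis by (simp add: mult_ac)
  qed
  have AH: "norm (A * H n) \<le> C * \<sigma>^2" for n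
    using mult_mono[OF A(2) H(1)[of n]] C by (simp add: norm_mult)
  have Hd: "H (Suc n) - H n = S n - T n * H n + A * H n" for n
    using Hs[of n] by (simp add: algebra_simps)
  have Hn: "norm (H (Suc n) - H n) \<le> norm (S n) + norm (T n * H n) + norm (A * H n)" for n
    unfolding Hd by (rule order_trans[OF norm_triangle_ineq add_right_mono[OF norm_triangle_ineq4]])
  \<comment> \<open>First round: every term is of order \<open>\<sigma>\<close>.\<close>
  have 0: "norm (H (Suc n) - H n) \<le> 7 * C * \<sigma> + 0 / (real n + 1)^2" for n
  proof -
    have "norm (\<psi> l * (H (n - l) - H n)) \<le> 2 * C * \<sigma> * (1 / (real l + 1)^3)" if "l \<le> n" for l
    proof (cases "l = 0")
      case False
      have "norm (H (n - l) - H n) \<le> 2"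
        using norm_triangle_ineq4[of "H (n - l)" "H n"] H(1)[of n] H(1)[of "n - l"] by linarith
      then have "norm (\<psi> l * (H (n - l) - H n)) \<le> C * \<sigma> / (real l + 1)^3 * 2"
        unfolding norm_mult using False C \<sigma> by (intro mult_mono \<psi>) auto
      then show ?thesis by (simp add: mult_ac)
    qed (use C \<sigma> in simp)
    then have "norm (S n) \<le> (\<Sum>l\<le>n. 2 * C * \<sigma> * (1 / (real l + 1)^3))"
      unfolding S_def by (intro sum_norm_le) auto
    also have "\<dots> = 2 * C * \<sigma> * (\<Sum>l=0..<Suc n. 1 / (real l + 1)^3)"
      by (simp only: sum_distrib_left atLeast0LessThan lessThan_Suc_atMost)
    also have "\<dots> \<le> 2 * C * \<sigma> * 2"
      using inverse_cube_sum_le[of 0 "Suc n"] C \<sigma> by (intro mult_left_mono) auto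
    finally have s: "norm (S n) \<le> 4 * (C * \<sigma>)" by simp
    have t: "norm (T n * H n) \<le> 2 * (C * \<sigma>)"
    proof (rule order_trans[OF T])
      have "2 * C * \<sigma> / (real n + 1)^2 \<le> 2 * C * \<sigma> / 1"
        using C \<sigma> by (intro divide_left_mono) auto
      then show "2 * C * \<sigma> / (real n + 1)^2 \<le> 2 * (C * \<sigma>)" by simp
    qed
    have "norm (A * H n) \<le> C * \<sigma>"
      using AH[of n] mult_left_mono[OF \<sigma>2 C] by linarith
    then show ?thesis using Hn[of n] s t by simp
  qed
  \<comment> \<open>Second round: the convolution gains a factor \<open>\<sigma>\<close>; the remaining \<open>\<sigma>/n\<^sup>2\<close> is the tail of the kernel.\<close>
  have 1: "norm (H (Suc n) - H n) \<le> (14 * C^2 + C) * \<sigma>^2 + 2 * C * \<sigma> / (real n + 1)^2" for n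
    using Hn[of n] S[OF 0, of n] T[of n] AH[of n] C \<sigma> by (simp add: power2_eq_square algebra_simps)
  have "norm (S n) \<le> C * \<sigma> * (2 * ((14 * C^2 + C) * \<sigma>^2) + 8 * (2 * C * \<sigma>) / (real n + 1)^2)"
    using C \<sigma> by (intro S[OF 1]) auto
  also have "\<dots> = (28 * C^3 + 2 * C^2) * \<sigma>^3 + 16 * C^2 * \<sigma>^2 / (real n + 1)^2"
    by (simp add: power_numeral_reduce algebra_simps)
  also have "\<dots> \<le> (28 * C^3 + 2 * C^2) * \<sigma>^3 + 16 * C^2 * \<sigma> / (real n + 1)^2"
    using \<sigma>2 C by (intro add_left_mono divide_right_mono mult_left_mono) auto
  finally have "norm (S n - T n * H n) \<le> (28 * C^3 + 2 * C^2) * \<sigma>^3 + (16 * C^2 + 2 * C) * (\<sigma> / (real n + 1)^2)"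
    using norm_triangle_ineq4[of "S n" "T n * H n"] T[of n] by (simp add: algebra_simps add_divide_distrib)
  also have "\<dots> \<le> K * \<sigma>^3 + K * (\<sigma> / (real n + 1)^2)"
  proof -
    have "28 * C^3 + 2 * C^2 \<le> K" "16 * C^2 + 2 * C \<le> K" using C by (auto simp: K_def)
    then show ?thesis using \<sigma> by (intro add_mono mult_right_mono) auto
  qed
  finally show ?thesis unfolding Hs by (simp add: distrib_left)
qed

lemma perturbed_geometric:
  fixes H :: "nat \<Rightarrow> complex"
  assumes "\<And>n. norm (H (Suc n) - exp A * H n) \<le> e n" "norm A \<le> a"
  shows "norm (H N - exp (of_nat N * A) * H 0) \<le> exp (real N * a) * (\<Sum>n<N. e n)"
proof (induction N)
  case (Suc N)
  have ea: "norm (exp A) \<le> exp a"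
    using norm_exp[of A] assms(2) by (meson exp_le_cancel_iff order_trans)
  have a0: "a \<ge> 0" using assms(2) norm_ge_zero order_trans by blast
  have e0: "e n \<ge> 0" for n using assms(1)[of n] norm_ge_zero order_trans by blast
  have "H (Suc N) - exp (of_nat (Suc N) * A) * H 0
      = (H (Suc N) - exp A * H N) + exp A * (H N - exp (of_nat N * A) * H 0)"
    by (simp add: algebra_simps exp_add)
  also have "norm \<dots> \<le> e N + exp a * (exp (real N * a) * (\<Sum>n<N. e n))"
    by (rule order_trans[OF norm_triangle_ineq]) (use Suc ea assms(1)[of N] in \<open>auto simp: norm_mult intro!: add_mono mult_mono\<close>)
  also have "\<dots> = e N + exp (real (Suc N) * a) * (\<Sum>n<N. e n)"
    by (simp add: exp_add algebra_simps)
  also have "\<dots> \<le> exp (real (Suc N) * a) * e N + exp (real (Suc N) * a) * (\<Sum>n<N. e n)"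
    using mult_right_mono[of 1 "exp (real (Suc N) * a)" "e N"] a0 e0[of N] by simp
  finally show ?case by (simp add: distrib_left algebra_simps)
qed simp

lemma norm_exp_minus_linear:
  fixes z :: complex
  assumes "norm z \<le> 1"
  shows "norm (exp z - (1 + z)) \<le> 3 * (norm z)^2"
proof -
  have "norm (exp z - (\<Sum>i\<le>1. z^i / fact i)) \<le> exp \<bar>Re z\<bar> * (norm z ^ Suc 1) / fact 1"
    by (rule Taylor_exp)
  moreover have "exp \<bar>Re z\<bar> \<le> 3"
    using abs_Re_le_cmod[of z] assms exp_le by (meson exp_le_cancel_iff order_trans)
  ultimately show ?thesis
    by (simp add: power2_eq_square) (meson mult_right_mono order_trans zero_le_mult_iff norm_ge_zero)
qed

text \<open>The frequency is of order \<open>N\<^sup>-\<^sup>1\<^sup>/\<^sup>2\<close>, so the \<open>N\<close> one-step errors \<open>\<sigma>\<^sup>3 + \<sigma>/n\<^sup>2\<close> add up to \<open>O(N\<^sup>-\<^sup>1\<^sup>/\<^sup>2)\<close>.\<close>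

lemma renewal_characteristic_limit:
  fixes H \<psi> :: "nat \<Rightarrow> nat \<Rightarrow> complex" and A :: "nat \<Rightarrow> complex" and c :: real
  defines "\<sigma> \<equiv> \<lambda>N. c / sqrt (real N)"
  assumes \<psi>: "\<And>N l. N \<ge> m \<Longrightarrow> l \<ge> 1 \<Longrightarrow> norm (\<psi> N l) \<le> C * \<sigma> N / (real l + 1)^3"
      and A: "\<And>N. A N = suminf (\<psi> N) - 1" "\<And>N. N \<ge> m \<Longrightarrow> norm (A N) \<le> C * (\<sigma> N)^2"
      and H: "\<And>N n. norm (H N n) \<le> 1" "\<And>N n. H N (Suc n) = (\<Sum>l\<le>n. \<psi> N l * H N (n - l))" "\<And>N. H N 0 = 1"
      and C: "C \<ge> 0" "c \<ge> 0" and lim: "(\<lambda>N. of_nat N * A N) \<longlonglongrightarrow> z"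
  shows "(\<lambda>N. H N N) \<longlonglongrightarrow> exp z"
proof -
  define K where "K = 28 * C^3 + 18 * C^2 + 2 * C"
  have K: "K \<ge> 0" using C by (simp add: K_def)
  define E where "E N = exp (real N * (C * (\<sigma> N)^2)) * (real N * (K * (\<sigma> N)^3) + 2 * K * \<sigma> N + real N * (3 * (C * (\<sigma> N)^2)^2))" for N
  have \<sigma>lim: "\<sigma> \<longlonglongrightarrow> 0" unfolding \<sigma>_def by real_asymp
  moreover have "(\<lambda>N. C * (\<sigma> N)^2) \<longlonglongrightarrow> 0"
    using tendsto_mult[OF tendsto_const tendsto_power[OF \<sigma>lim, of 2], of C] by simp
  ultimately have ev: "eventually (\<lambda>N. \<sigma> N < 1 \<and> C * (\<sigma> N)^2 < 1 \<and> N \<ge> m) sequentially"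
    by (intro eventually_conj order_tendstoD(2)[of \<sigma>] order_tendstoD(2)[of "\<lambda>N. C * (\<sigma> N)^2"] eventually_ge_at_top) auto
  have "eventually (\<lambda>N. norm (H N N - exp (of_nat N * A N)) \<le> E N) sequentially"
    using ev
  proof eventually_elim
    case (elim N)
    have \<sigma>0: "\<sigma> N \<ge> 0" using C by (simp add: \<sigma>_def)
    note AN = A(2)[of N]
    have "norm (H N (Suc n) - exp (A N) * H N n)
       \<le> K * ((\<sigma> N)^3 + \<sigma> N / (real n + 1)^2) + 3 * (C * (\<sigma> N)^2)^2" for n
    proof -
      have 1: "norm (H N (Suc n) - (1 + A N) * H N n) \<le> K * ((\<sigma> N)^3 + \<sigma> N / (real n + 1)^2)"
        unfolding K_def by (rule renewal_characteristic_step[where H="H N" and \<psi>="\<psi> N"]) (use assms elim \<sigma>0 in auto)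
      have "norm (exp (A N) - (1 + A N)) \<le> 3 * (norm (A N))^2"
        using AN elim by (intro norm_exp_minus_linear) auto
      also have "\<dots> \<le> 3 * (C * (\<sigma> N)^2)^2"
        using AN elim by (intro mult_left_mono power_mono) auto
      finally have "norm (exp (A N) - (1 + A N)) * norm (H N n) \<le> 3 * (C * (\<sigma> N)^2)^2 * 1"
        by (intro mult_mono H) auto
      then have 2: "norm ((exp (A N) - (1 + A N)) * H N n) \<le> 3 * (C * (\<sigma> N)^2)^2"
        by (simp add: norm_mult)
      have "H N (Suc n) - exp (A N) * H N n
         = (H N (Suc n) - (1 + A N) * H N n) - (exp (A N) - (1 + A N)) * H N n"
        by (simp add: algebra_simps)
      then show ?thesis using 1 2 norm_triangle_ineq4 by (smt (verit, best))
    qed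
    then have "norm (H N N - exp (of_nat N * A N) * H N 0) \<le> exp (real N * (C * (\<sigma> N)^2)) *
         (\<Sum>n<N. K * ((\<sigma> N)^3 + \<sigma> N / (real n + 1)^2) + 3 * (C * (\<sigma> N)^2)^2)"
      by (rule perturbed_geometric) (use AN elim in auto)
    also have "(\<Sum>n<N. K * ((\<sigma> N)^3 + \<sigma> N / (real n + 1)^2) + 3 * (C * (\<sigma> N)^2)^2)
       = real N * (K * (\<sigma> N)^3) + K * \<sigma> N * (\<Sum>n<N. 1 / (real n + 1)^2) + real N * (3 * (C * (\<sigma> N)^2)^2)"
      by (simp add: sum.distrib sum_distrib_left distrib_left)
    also have "exp (real N * (C * (\<sigma> N)^2)) * \<dots> \<le> E N"
      unfolding E_def using inverse_square_sum_le[of 0 N] K \<sigma>0 mult_left_mono[of "\<Sum>n<N. 1 / (real n + 1)^2" 2 "K * \<sigma> N"]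
      by (intro mult_left_mono add_mono) (auto simp: atLeast0LessThan)
    finally show ?case by (simp add: H(3))
  qed
  moreover have "E \<longlonglongrightarrow> 0"
    unfolding E_def \<sigma>_def
  proof -
    have 1: "(\<lambda>N. real N * (K * (c / sqrt (real N))^3) + 2 * K * (c / sqrt (real N)) + real N * (3 * (C * (c / sqrt (real N))^2)^2)) \<longlonglongrightarrow> 0"
    proof -
      have a: "(\<lambda>N. real N * (1 / sqrt (real N))^3) \<longlonglongrightarrow> 0" "(\<lambda>N. 1 / sqrt (real N)) \<longlonglongrightarrow> 0"
        "(\<lambda>N. real N * ((1 / sqrt (real N))^2)^2) \<longlonglongrightarrow> 0"
        by real_asymp+
      have "(\<lambda>N. K * c^3 * (real N * (1 / sqrt (real N))^3) + 2 * K * c * (1 / sqrt (real N))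
          + 3 * C^2 * c^4 * (real N * ((1 / sqrt (real N))^2)^2)) \<longlonglongrightarrow> K * c^3 * 0 + 2 * K * c * 0 + 3 * C^2 * c^4 * 0"
        by (intro tendsto_intros a)
      then show ?thesis by (simp add: power_divide power_mult_distrib mult_ac flip: power_mult)
    qed
    have "eventually (\<lambda>N. exp (C * c^2) = exp (real N * (C * (c / sqrt (real N))^2))) sequentially"
      using eventually_gt_at_top[of 0] by eventually_elim (simp add: power_divide)
    then have 2: "(\<lambda>N. exp (real N * (C * (c / sqrt (real N))^2))) \<longlonglongrightarrow> exp (C * c^2)"
      by (rule tendsto_cong[THEN iffD1]) simp
    show "(\<lambda>N. exp (real N * (C * (c / sqrt (real N))^2)) * (real N * (K * (c / sqrt (real N))^3) + 2 * K * (c / sqrt (real N)) + real N * (3 * (C * (c / sqrt (real N))^2)^2))) \<longlonglongrightarrow> 0"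
      using tendsto_mult[OF 2 1] by simp
  qed
  ultimately have "(\<lambda>N. H N N - exp (of_nat N * A N)) \<longlonglongrightarrow> 0"
    by (rule Lim_null_comparison)
  moreover have "(\<lambda>N. exp (of_nat N * A N)) \<longlonglongrightarrow> exp z"
    using lim by (intro tendsto_exp)
  ultimately show ?thesis
    using tendsto_add[of "\<lambda>N. H N N - exp (of_nat N * A N)" 0 sequentially "\<lambda>N. exp (of_nat N * A N)" "exp z"] by simp
qed

section \<open>Weak convergence in Euclidean space\<close>

text \<open>The phase \<open>b\<close> makes sines and constants available and the class closed under products, while
linearity keeps integrals accessible through the characteristic function.\<close>

inductive trig_sum :: "('a::euclidean_space \<Rightarrow> real) \<Rightarrow> bool" where
  wave: "trig_sum (\<lambda>x. a * cos (t \<bullet> x + b))"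
| add: "trig_sum f \<Longrightarrow> trig_sum g \<Longrightarrow> trig_sum (\<lambda>x. f x + g x)"

lemma trig_sum_const: "trig_sum (\<lambda>x::'a::euclidean_space. c)"
  using trig_sum.wave[of c "0::'a" 0] by simp

lemma trig_sum_mult:
  assumes "trig_sum f" "trig_sum g"
  shows "trig_sum (\<lambda>x. f x * g x)"
  using assms(1)
proof induction
  case f: (wave a t b)
  show ?case
    using assms(2)
  proof induction
    case (wave a' t' b')
    have "(\<lambda>x. a * cos (t \<bullet> x + b) * (a' * cos (t' \<bullet> x + b')))
        = (\<lambda>x. (a * a' / 2) * cos ((t - t') \<bullet> x + (b - b')) + (a * a' / 2) * cos ((t + t') \<bullet> x + (b + b')))"
    proof
      fix x
      have e: "(t - t') \<bullet> x + (b - b') = (t \<bullet> x + b) - (t' \<bullet> x + b')"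
        "(t + t') \<bullet> x + (b + b') = (t \<bullet> x + b) + (t' \<bullet> x + b')"
        by (simp_all add: inner_diff_left inner_add_left)
      have "a * cos u * (a' * cos v) = (a * a' / 2) * cos (u - v) + (a * a' / 2) * cos (u + v)" for u v
        by (simp add: cos_add cos_diff field_simps)
      then show "a * cos (t \<bullet> x + b) * (a' * cos (t' \<bullet> x + b'))
        = (a * a' / 2) * cos ((t - t') \<bullet> x + (b - b')) + (a * a' / 2) * cos ((t + t') \<bullet> x + (b + b'))"
        unfolding e .
    qed
    then show ?case by (simp only:) (rule trig_sum.add; rule trig_sum.wave)
  next
    case (add f g)
    then show ?case unfolding distrib_left by (intro trig_sum.add)
  qed
next
  case (add f g)
  then show ?case unfolding distrib_right by (intro trig_sum.add)
qed

lemma trig_sum_props: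
  assumes "trig_sum f"
  shows "continuous_on UNIV f" "\<exists>B. \<forall>x. \<bar>f x\<bar> \<le> B"
proof -
  show "continuous_on UNIV f" using assms by induction (auto intro!: continuous_intros)
  show "\<exists>B. \<forall>x. \<bar>f x\<bar> \<le> B" using assms
  proof induction
    case (wave a t b)
    have "\<bar>a * cos (t \<bullet> x + b)\<bar> \<le> \<bar>a\<bar>" for x
      using mult_left_mono[OF abs_cos_le_one[of "t \<bullet> x + b"], of "\<bar>a\<bar>"] by (simp add: abs_mult)
    then show ?case by blast
  next
    case (add f g)
    then obtain B1 B2 where "\<forall>x. \<bar>f x\<bar> \<le> B1" "\<forall>x. \<bar>g x\<bar> \<le> B2" by auto
    then have "\<forall>x. \<bar>f x + g x\<bar> \<le> B1 + B2" by (meson abs_triangle_ineq add_mono order_trans)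
    then show ?case by blast
  qed
qed

lemma trig_sum_polynomial:
  assumes "real_polynomial_function p" "trig_sum g"
  shows "trig_sum (\<lambda>x. p (g x :: real))"
  using assms(1)
proof induction
  case (linear f)
  have fu: "f u = f 1 * u" for u
    using linear_simps(5)[OF linear, of u 1] by (simp add: mult.commute)
  have "(\<lambda>x. f (g x)) = (\<lambda>x. f 1 * g x)" by (rule ext) (rule fu)
  then show ?case using trig_sum_mult[OF trig_sum_const assms(2)] by simp
qed (rule trig_sum_const, erule (1) trig_sum.add, erule (1) trig_sum_mult)

lemma trig_sum_separates:
  fixes x y :: "'a::euclidean_space"
  assumes "x \<noteq> y"
  shows "\<exists>f. trig_sum f \<and> f x \<noteq> f y"
proof -
  define t where "t = (1 / (norm (x - y))^2) *\<^sub>R (x - y)"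
  have "t \<bullet> (x - y) = 1"
    using assms by (simp add: t_def power2_norm_eq_inner)
  then have "t \<bullet> x + (- (t \<bullet> y)) = 1" "t \<bullet> y + (- (t \<bullet> y)) = 0"
    by (simp_all add: inner_diff_right)
  moreover have "cos (1::real) \<noteq> cos 0" using cos_monotone_0_pi[of 0 1] pi_gt3 by simp
  ultimately show ?thesis
    by (intro exI[of _ "\<lambda>z. 1 * cos (t \<bullet> z + (- (t \<bullet> y)))"] conjI trig_sum.wave) simp
qed

text \<open>Stone-Weierstrass only controls the approximation on a ball. Since a trigonometric sum takes values
in a compact interval, a second approximation, of the truncation \<open>u \<mapsto> max (- B) (min B u)\<close> by a
polynomial in one variable, makes it bounded everywhere without leaving the class.\<close>

lemma trig_sum_approximation:
  fixes f :: "'a::euclidean_space \<Rightarrow> real"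
  assumes f: "continuous_on UNIV f" and B: "\<And>x. \<bar>f x\<bar> \<le> B" and e: "e > 0"
  obtains h where "trig_sum h" "\<And>x. norm x \<le> R \<Longrightarrow> \<bar>f x - h x\<bar> \<le> e" "\<And>x. \<bar>h x\<bar> \<le> B + e"
proof -
  have B0: "B \<ge> 0" using B[of 0] by linarith
  have "\<exists>g. trig_sum g \<and> (\<forall>x\<in>cball 0 R. \<bar>f x - g x\<bar> < e / 2)"
  proof (rule Stone_Weierstrass_HOL)
    show "continuous_on (cball 0 R) g" if "trig_sum g" for g :: "'a \<Rightarrow> real"
      using trig_sum_props(1)[OF that] continuous_on_subset by blast
    show "continuous_on (cball 0 R) f" using f continuous_on_subset by blast
    show "0 < e / 2" using e by simp
    show "trig_sum (\<lambda>x. g x + h x)" "trig_sum (\<lambda>x. g x * h x)" if "trig_sum g \<and> trig_sum h" for g h :: "'a \<Rightarrow> real"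
      using that by (auto intro: trig_sum.add[of g h] trig_sum_mult[of g h])
    show "\<exists>g. trig_sum g \<and> g x \<noteq> g y" if "x \<in> cball 0 R \<and> y \<in> cball 0 R \<and> x \<noteq> y" for x y :: 'a
      using trig_sum_separates[of x y] that by simp
  qed (rule compact_cball trig_sum_const)+
  then obtain g where g: "trig_sum g" "\<And>x. x \<in> cball 0 R \<Longrightarrow> \<bar>f x - g x\<bar> < e / 2" by blast
  obtain G where G: "\<And>x. \<bar>g x\<bar> \<le> G" using trig_sum_props(2)[OF g(1)] by blast
  \<comment> \<open>Truncation at the level of \<open>f\<close> changes \<open>g\<close> only where it exceeds \<open>B\<close>, hence moves it closer to \<open>f\<close>.\<close>
  define clip where "clip u = max (- B) (min B u)" for u :: real
  have "continuous_on (cball 0 G) clip" unfolding clip_def by (intro continuous_intros)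
  then obtain p where p: "real_polynomial_function p" "\<And>u. u \<in> cball 0 G \<Longrightarrow> \<bar>clip u - p u\<bar> < e / 2"
    using Stone_Weierstrass_real_polynomial_function[of "cball 0 G" clip "e / 2"] e by auto
  have pg: "\<bar>clip (g x) - p (g x)\<bar> < e / 2" for x using G[of x] by (intro p) simp
  show ?thesis
  proof
    show "trig_sum (\<lambda>x. p (g x))" by (rule trig_sum_polynomial[OF p(1) g(1)])
    show "\<bar>f x - p (g x)\<bar> \<le> e" if "norm x \<le> R" for x
    proof -
      have "\<bar>f x - g x\<bar> < e / 2" using g(2)[of x] that by simp
      moreover have "\<bar>f x - clip (g x)\<bar> \<le> \<bar>f x - g x\<bar>"
        using B[of x] by (auto simp: clip_def)
      ultimately show ?thesis using pg[of x] by linarith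
    qed
    show "\<bar>p (g x)\<bar> \<le> B + e" for x
    proof -
      have "\<bar>clip (g x)\<bar> \<le> B" using B0 by (auto simp: clip_def)
      then show ?thesis using pg[of x] e by linarith
    qed
  qed
qed

lemma prob_tight:
  fixes N :: "'a::euclidean_space measure"
  assumes "prob_space N" and [measurable_cong]: "sets N = sets borel" and "e > 0"
  shows "\<exists>R. measure N {x. norm x > R} \<le> e"
proof -
  interpret prob_space N by fact
  have "(\<lambda>n. measure N {x. norm x > real n}) \<longlonglongrightarrow> measure N (\<Inter>n. {x. norm x > real n})"
    by (rule finite_Lim_measure_decseq) (auto simp: decseq_def)
  moreover have "(\<Inter>n. {x::'a. norm x > real n}) = {}"
    by auto (metis real_arch_simple not_le)
  ultimately have "(\<lambda>n. measure N {x. norm x > real n}) \<longlonglongrightarrow> 0" by simp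
  then have "eventually (\<lambda>n. measure N {x. norm x > real n} < e) sequentially"
    using \<open>e > 0\<close> by (rule order_tendstoD)
  then show ?thesis by (meson eventually_happens' less_imp_le sequentially_bot)
qed

lemma trig_sum_integral_limit:
  fixes \<mu> :: "nat \<Rightarrow> 'a::euclidean_space measure"
  assumes \<mu>: "\<And>n. prob_space (\<mu> n)" "\<And>n. sets (\<mu> n) = sets borel"
      and N: "prob_space N" "sets N = sets borel"
      and char: "\<And>t. (\<lambda>n. \<integral>x. iexp (t \<bullet> x) \<partial>\<mu> n) \<longlonglongrightarrow> (\<integral>x. iexp (t \<bullet> x) \<partial>N)"
      and "trig_sum h"
  shows "(\<lambda>n. \<integral>x. h x \<partial>\<mu> n) \<longlonglongrightarrow> (\<integral>x. h x \<partial>N)"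
proof -
  have int: "integrable M h" if "prob_space M" and [measurable_cong]: "sets M = sets borel" and "trig_sum h" for M h
  proof -
    interpret prob_space M by fact
    obtain B where "\<forall>x. \<bar>h x\<bar> \<le> B" using trig_sum_props(2)[OF \<open>trig_sum h\<close>] by blast
    moreover have "h \<in> borel_measurable M"
      using borel_measurable_continuous_onI[OF trig_sum_props(1)[OF \<open>trig_sum h\<close>]] by measurable
    ultimately show ?thesis by (intro integrable_const_bound[of _ B]) auto
  qed
  have cosint: "(\<integral>x. a * cos (t \<bullet> x + b) \<partial>M) = a * Re (iexp b * (\<integral>x. iexp (t \<bullet> x) \<partial>M))"
    if "prob_space M" and [measurable_cong]: "sets M = sets borel" for M and a b and t :: 'a
  proof -
    interpret prob_space M by fact
    have "integrable M (\<lambda>x. iexp (t \<bullet> x))"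
      by (rule integrable_const_bound[of _ 1]) auto
    then have "Re (iexp b * (\<integral>x. iexp (t \<bullet> x) \<partial>M)) = (\<integral>x. Re (iexp b * iexp (t \<bullet> x)) \<partial>M)"
      by (subst integral_Re) auto
    also have "\<dots> = (\<integral>x. cos (t \<bullet> x + b) \<partial>M)"
      by (intro Bochner_Integration.integral_cong refl) (simp add: exp_add[symmetric] Re_exp add.commute)
    finally show ?thesis by simp
  qed
  show ?thesis using \<open>trig_sum h\<close>
  proof induction
    case (wave a t b)
    show ?case unfolding cosint[OF \<mu>] cosint[OF N] by (intro tendsto_intros char)
  next
    case (add f g)
    have "(\<integral>x. f x + g x \<partial>M) = (\<integral>x. f x \<partial>M) + (\<integral>x. g x \<partial>M)"
      if "prob_space M" "sets M = sets borel" for M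
      using int[OF that] add.hyps by simp
    then show ?case using add.IH \<mu> N by (simp add: tendsto_add)
  qed
qed

text \<open>Off an event that is small by tightness, \<open>f\<close> is uniformly close to a trigonometric sum with almost the
same bound everywhere, and integrals of the latter converge because characteristic functions do.\<close>

theorem levy_continuity_euclidean:
  fixes \<mu> :: "nat \<Rightarrow> 'a::euclidean_space measure" and f :: "'a \<Rightarrow> real"
  assumes \<mu>: "\<And>n. prob_space (\<mu> n)" "\<And>n. sets (\<mu> n) = sets borel"
      and N: "prob_space N" "sets N = sets borel"
      and char: "\<And>t. (\<lambda>n. \<integral>x. iexp (t \<bullet> x) \<partial>\<mu> n) \<longlonglongrightarrow> (\<integral>x. iexp (t \<bullet> x) \<partial>N)"
      and tight: "\<And>e. e > 0 \<Longrightarrow> \<exists>R. \<forall>\<^sub>F n in sequentially. measure (\<mu> n) {x. norm x > R} \<le> e"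
      and f: "continuous_on UNIV f" "bounded (range f)"
  shows "(\<lambda>n. \<integral>x. f x \<partial>\<mu> n) \<longlonglongrightarrow> (\<integral>x. f x \<partial>N)"
proof (rule tendstoI)
  fix e :: real assume "e > 0"
  obtain B where B: "\<And>x. \<bar>f x\<bar> \<le> B" using f(2) by (auto simp: bounded_iff)
  have B0: "B \<ge> 0" using B[of 0] by linarith
  define d where "d = min 1 (e / 4)"
  have d: "0 < d" "d \<le> 1" "d \<le> e / 4" using \<open>e > 0\<close> by (auto simp: d_def)
  define \<eta> where "\<eta> = d / (4 * (2 * B + 1))"
  have \<eta>: "\<eta> > 0" "(2 * B + 1) * \<eta> = d / 4" using d B0 by (auto simp: \<eta>_def field_simps)
  obtain R1 where R1: "\<forall>\<^sub>F n in sequentially. measure (\<mu> n) {x. norm x > R1} \<le> \<eta>" using tight[OF \<eta>(1)] by blast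
  obtain R2 where R2: "measure N {x. norm x > R2} \<le> \<eta>" using prob_tight[OF N \<eta>(1)] by blast
  define R where "R = max R1 R2"
  obtain h where h: "trig_sum h" "\<And>x. norm x \<le> R \<Longrightarrow> \<bar>f x - h x\<bar> \<le> d" "\<And>x. \<bar>h x\<bar> \<le> B + d"
    using trig_sum_approximation[OF f(1) B d(1)] by metis
  have close: "\<bar>(\<integral>x. f x \<partial>M) - (\<integral>x. h x \<partial>M)\<bar> \<le> d + d / 4"
    if "prob_space M" and [measurable_cong]: "sets M = sets borel" and "R' \<le> R" "measure M {x. norm x > R'} \<le> \<eta>" for M R'
  proof -
    interpret prob_space M by fact
    have [measurable]: "f \<in> borel_measurable M" "h \<in> borel_measurable M"
      using borel_measurable_continuous_onI[OF f(1)] borel_measurable_continuous_onI[OF trig_sum_props(1)[OF h(1)]]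
      by measurable
    have int: "integrable M f" "integrable M h"
      by (rule integrable_const_bound[of _ B], use B in auto) (rule integrable_const_bound[of _ "B + d"], use h in auto)
    have set: "{x. norm x > R'} \<in> sets M" by measurable
    have "\<bar>(\<integral>x. f x \<partial>M) - (\<integral>x. h x \<partial>M)\<bar> = \<bar>\<integral>x. f x - h x \<partial>M\<bar>" using int by simp
    also have "\<dots> \<le> (\<integral>x. \<bar>f x - h x\<bar> \<partial>M)" by (rule integral_abs_bound)
    also have "\<dots> \<le> (\<integral>x. d + (2 * B + 1) * indicator {x. norm x > R'} x \<partial>M)"
    proof (rule integral_mono)
      show "integrable M (\<lambda>x. d + (2 * B + 1) * indicator {x. norm x > R'} x)"
        using set by (intro Bochner_Integration.integrable_add integrable_mult_right integrable_real_indicator) (auto simp: emeasure_eq_measure)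
      show "\<bar>f x - h x\<bar> \<le> d + (2 * B + 1) * indicator {x. norm x > R'} x" for x
        using h(2)[of x] h(3)[of x] B[of x] B0 d \<open>R' \<le> R\<close> by (auto simp: indicator_def)
    qed (use int in auto)
    also have "\<dots> = d + (2 * B + 1) * measure M {x. norm x > R'}"
      using set by (subst Bochner_Integration.integral_add) (auto simp: prob_space emeasure_eq_measure)
    also have "\<dots> \<le> d + (2 * B + 1) * \<eta>" using that B0 by (intro add_left_mono mult_left_mono) auto
    finally show ?thesis using \<eta> by simp
  qed
  have "\<forall>\<^sub>F n in sequentially. dist (\<integral>x. h x \<partial>\<mu> n) (\<integral>x. h x \<partial>N) < d"
    by (rule tendstoD[OF trig_sum_integral_limit[OF \<mu> N char h(1)] d(1)])
  with R1 show "\<forall>\<^sub>F n in sequentially. dist (\<integral>x. f x \<partial>\<mu> n) (\<integral>x. f x \<partial>N) < e"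
  proof eventually_elim
    case (elim n)
    show ?case
      using close[OF \<mu>(1) \<mu>(2) _ elim(1)] close[OF N _ R2] elim(2) d unfolding R_def dist_real_def by linarith
  qed
qed

section \<open>Centred normal laws\<close>

lemma centred_normal_char:
  assumes "is_centred_normal \<Sigma> N"
  shows "(\<integral>x. iexp (t \<bullet> x) \<partial>N) = exp (- complex_of_real (t \<bullet> (\<Sigma> *v t)) / 2)"
proof -
  define c where "c = sqrt (t \<bullet> (\<Sigma> *v t))"
  have N: "prob_space N" and [measurable_cong]: "sets N = sets borel" and pos: "0 \<le> t \<bullet> (\<Sigma> *v t)"
    and d: "distr N borel (\<lambda>x. t \<bullet> x) = distr std_normal_distribution borel (\<lambda>z. c * z)"
    using assms by (auto simp: is_centred_normal_def c_def)
  have "(\<integral>x. iexp (t \<bullet> x) \<partial>N) = (\<integral>y. iexp y \<partial>distr N borel (\<lambda>x. t \<bullet> x))"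
    by (subst integral_distr) auto
  also have "\<dots> = (\<integral>z. iexp (c * z) \<partial>std_normal_distribution)"
    unfolding d by (subst integral_distr) auto
  also have "\<dots> = char std_normal_distribution c" by (simp add: char_def)
  also have "\<dots> = complex_of_real (exp (- (c^2) / 2))" by (simp add: char_std_normal_distribution)
  also have "c^2 = t \<bullet> (\<Sigma> *v t)" using pos by (simp add: c_def)
  finally show ?thesis by (simp add: exp_of_real[symmetric])
qed

text \<open>Independent normal coordinates with the prescribed variances. The laws of linear functionals are
identified by their characteristic functions, which covers vanishing variances as well.\<close>

lemma diagonal_normal_exists:
  fixes s :: "'n::finite \<Rightarrow> real"
  assumes s: "\<And>i. s i \<ge> 0"
  shows "\<exists>N. is_centred_normal (\<chi> i j. if i = j then s i else 0) N"
proof -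
  define \<Sigma> :: "real^'n^'n" where "\<Sigma> = (\<chi> i j. if i = j then s i else 0)"
  define P where "P = (\<Pi>\<^sub>M i\<in>(UNIV::'n set). std_normal_distribution)"
  define F :: "('n \<Rightarrow> real) \<Rightarrow> real^'n" where "F x = (\<chi> i. sqrt (s i) * x i)" for x
  define N where "N = distr P borel F"
  have std: "prob_space std_normal_distribution" using prob_space_normal_density by simp
  interpret product_prob_space "\<lambda>_::'n. std_normal_distribution" UNIV
    using std by (auto simp: product_prob_space_def product_prob_space_axioms_def product_sigma_finite_def prob_space_imp_sigma_finite)
  have P: "prob_space P" unfolding P_def by (rule prob_space_axioms)
  have F [measurable]: "F \<in> borel_measurable P"
    unfolding F_def P_def by (subst borel_measurable_euclidean_space) (auto simp: Basis_vec_def inner_axis)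
  have N: "prob_space N" unfolding N_def using F by (intro prob_space.prob_space_distr P)
  have quad: "t \<bullet> (\<Sigma> *v t) = (\<Sum>i\<in>UNIV. s i * (t $ i)^2)" for t
  proof -
    have "(\<Sum>j\<in>UNIV. (if i = j then s i else 0) * t $ j) = s i * t $ i" for i
      by (simp add: if_distrib[of "\<lambda>z. z * _"] cong: if_cong)
    then show ?thesis
      by (simp add: \<Sigma>_def inner_vec_def matrix_vector_mult_def power2_eq_square mult_ac)
  qed
  have "distr N borel (\<lambda>x. t \<bullet> x) = distr std_normal_distribution borel (\<lambda>z. sqrt (t \<bullet> (\<Sigma> *v t)) * z)" for t
  proof (rule Levy_uniqueness)
    interpret N: prob_space N by (rule N)
    have [measurable_cong]: "sets N = sets borel" by (simp add: N_def)
    show "real_distribution (distr N borel (\<lambda>x. t \<bullet> x))" by (rule N.real_distribution_distr) measurable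
    show "real_distribution (distr std_normal_distribution borel (\<lambda>z. sqrt (t \<bullet> (\<Sigma> *v t)) * z))"
      by (rule prob_space.real_distribution_distr[OF std]) measurable
    show "char (distr N borel (\<lambda>x. t \<bullet> x)) = char (distr std_normal_distribution borel (\<lambda>z. sqrt (t \<bullet> (\<Sigma> *v t)) * z))"
    proof
      fix u
      have "char (distr N borel (\<lambda>x. t \<bullet> x)) u = (\<integral>x. iexp (u * (t \<bullet> x)) \<partial>N)"
        unfolding char_def by (subst integral_distr) auto
      also have "\<dots> = (\<integral>x. iexp (u * (t \<bullet> F x)) \<partial>P)"
        unfolding N_def by (subst integral_distr) auto
      also have "\<dots> = (\<integral>x. (\<Prod>i\<in>UNIV. iexp (u * t $ i * sqrt (s i) * x i)) \<partial>P)"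
        by (simp add: F_def inner_vec_def exp_sum[symmetric] sum_distrib_left mult_ac)
      also have "\<dots> = (\<Prod>i\<in>UNIV. \<integral>z. iexp (u * t $ i * sqrt (s i) * z) \<partial>std_normal_distribution)"
        unfolding P_def by (rule product_integral_prod) (auto intro!: finite_measure.integrable_const_bound[OF prob_space.finite_measure[OF std], of _ 1])
      also have "\<dots> = (\<Prod>i\<in>UNIV. complex_of_real (exp (- (u^2 * (s i * (t $ i)^2)) / 2)))"
      proof (intro prod.cong refl)
        fix i
        have "(\<integral>z. iexp (u * t $ i * sqrt (s i) * z) \<partial>std_normal_distribution) = char std_normal_distribution (u * t $ i * sqrt (s i))"
          by (simp add: char_def)
        also have "\<dots> = complex_of_real (exp (- ((u * t $ i * sqrt (s i))^2) / 2))"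
          by (simp only: char_std_normal_distribution)
        also have "(u * t $ i * sqrt (s i))^2 = u^2 * (s i * (t $ i)^2)"
          using s by (simp add: power_mult_distrib)
        finally show "(\<integral>z. iexp (u * t $ i * sqrt (s i) * z) \<partial>std_normal_distribution) = complex_of_real (exp (- (u^2 * (s i * (t $ i)^2)) / 2))" .
      qed
      also have "\<dots> = complex_of_real (exp (- (u^2 * (t \<bullet> (\<Sigma> *v t))) / 2))"
        by (simp add: quad exp_sum[symmetric] sum_distrib_left sum_negf sum_divide_distrib flip: of_real_prod)
      also have "u^2 * (t \<bullet> (\<Sigma> *v t)) = (u * sqrt (t \<bullet> (\<Sigma> *v t)))^2"
        using s by (simp add: power_mult_distrib quad sum_nonneg)
      also have "complex_of_real (exp (- ((u * sqrt (t \<bullet> (\<Sigma> *v t)))^2) / 2)) = char std_normal_distribution (u * sqrt (t \<bullet> (\<Sigma> *v t)))"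
        by (simp only: char_std_normal_distribution)
      also have "\<dots> = char (distr std_normal_distribution borel (\<lambda>z. sqrt (t \<bullet> (\<Sigma> *v t)) * z)) u"
        unfolding char_def by (subst integral_distr) (auto simp: mult_ac)
      finally show "char (distr N borel (\<lambda>x. t \<bullet> x)) u = char (distr std_normal_distribution borel (\<lambda>z. sqrt (t \<bullet> (\<Sigma> *v t)) * z)) u" .
    qed
  qed
  moreover have "transpose \<Sigma> = \<Sigma>" by (auto simp: \<Sigma>_def transpose_def vec_eq_iff)
  moreover have "0 \<le> t \<bullet> (\<Sigma> *v t)" for t using s by (simp add: quad sum_nonneg)
  ultimately have "is_centred_normal \<Sigma> N" using N by (simp add: is_centred_normal_def N_def)
  then show ?thesis unfolding \<Sigma>_def by blast
qed

section \<open>Averages over one step\<close>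

abbreviation unit_vectors :: "(int ^ 'n::finite) set" where
  "unit_vectors \<equiv> {e. norm (real_vec e) = 1}"

lemma finite_unit_vectors [simp]: "finite (unit_vectors :: (int ^ 'n::finite) set)"
  unfolding unit_steps by simp

lemma sum_unit_vectors:
  "(\<Sum>e\<in>(unit_vectors :: (int ^ 'n::finite) set). f e) = (\<Sum>i\<in>UNIV. f (axis i 1) + f (axis i (-1)))"
proof -
  have inj: "inj_on (\<lambda>(i::'n, s::int). axis i s) (UNIV \<times> {1, -1})"
    by (auto simp: inj_on_def axis_eq_axis)
  have "(\<Sum>e\<in>(unit_vectors :: (int ^ 'n::finite) set). f e) = (\<Sum>(i, s)\<in>UNIV \<times> {1, -1}. f (axis i s))"
    unfolding unit_steps by (subst sum.reindex[OF inj]) (simp add: case_prod_unfold)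
  also have "\<dots> = (\<Sum>i\<in>UNIV. \<Sum>s\<in>{1, -1}. f (axis i s))"
    by (rule sum.cartesian_product[symmetric])
  finally show ?thesis by simp
qed

lemma step_prob_axis:
  "step_prob k b (axis i 1) = (1 + (if i = k then b else 0)) / (2 * real CARD('n))"
  "step_prob k b (axis i (-1)) = (1 - (if i = k then b else 0)) / (2 * real CARD('n))"
  for k i :: "'n::finite"
proof -
  have ip: "axis k 1 \<bullet> real_vec (axis i s) = (if i = k then real_of_int s else 0)" for s
    by (simp add: inner_axis' real_vec_def) (simp add: axis_def)
  have "axis i 1 \<in> (unit_vectors :: (int ^ 'n) set)" "axis i (-1) \<in> (unit_vectors :: (int ^ 'n) set)"
    unfolding unit_steps by auto
  then show "step_prob k b (axis i 1) = (1 + (if i = k then b else 0)) / (2 * real CARD('n))"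
    "step_prob k b (axis i (-1)) = (1 - (if i = k then b else 0)) / (2 * real CARD('n))"
    by (simp_all add: step_prob_def ip)
qed

definition step_avg :: "'n::finite \<Rightarrow> real \<Rightarrow> (int ^ 'n \<Rightarrow> 'b::real_vector) \<Rightarrow> int ^ 'n \<Rightarrow> 'b" where
  "step_avg k b g x = (\<Sum>e\<in>unit_vectors. step_prob k b e *\<^sub>R g (x + e))"

lemma step_avg_diff: "step_avg k b (\<lambda>y. g y - h y) x = step_avg k b g x - step_avg k b h x"
  by (simp add: step_avg_def scaleR_diff_right sum_subtractf)

lemma step_avg_linear: "linear h \<Longrightarrow> step_avg k b (\<lambda>y. h (g y)) x = h (step_avg k b g x)"
  by (simp add: step_avg_def linear_sum linear_scale)

lemma step_avg_sum: "step_avg k b (\<lambda>y. \<Sum>i\<in>I. g i y) x = (\<Sum>i\<in>I. step_avg k b (g i) x)"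
  by (simp add: step_avg_def scaleR_sum_right sum.swap[of _ I])

lemma step_avg_const: "step_avg k b (\<lambda>y. c) x = c"
  using step_prob_sum[of k b] by (simp add: step_avg_def scaleR_sum_left[symmetric])

text \<open>The excitement enters as a discrete derivative in direction \<open>k\<close>. This is why its effect on slowly
varying functions is small.\<close>

lemma step_avg_explicit:
  fixes k :: "'n::finite"
  shows "step_avg k b g x = (1 / (2 * real CARD('n))) *\<^sub>R (\<Sum>i\<in>UNIV. g (x + axis i 1) + g (x + axis i (-1)))
    + (b / (2 * real CARD('n))) *\<^sub>R (g (x + axis k 1) - g (x + axis k (-1)))"
proof -
  define c where "c = 1 / (2 * real CARD('n))"
  have "step_avg k b g x = (\<Sum>i\<in>UNIV. c *\<^sub>R (g (x + axis i 1) + g (x + axis i (-1)))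
     + (if i = k then (b * c) *\<^sub>R (g (x + axis k 1) - g (x + axis k (-1))) else 0))"
    unfolding step_avg_def sum_unit_vectors
    by (intro sum.cong) (auto simp: step_prob_axis c_def add_divide_distrib diff_divide_distrib algebra_simps)
  then show ?thesis by (subst (asm) sum.distrib) (simp add: scaleR_sum_right c_def)
qed

lemma step_avg_mono:
  fixes g h :: "int ^ 'n::finite \<Rightarrow> real"
  assumes "0 \<le> b" "b \<le> 1" "\<And>e. e \<in> unit_vectors \<Longrightarrow> g (x + e) \<le> h (x + e)"
  shows "step_avg k b g x \<le> step_avg k b h x"
  unfolding step_avg_def by (intro sum_mono scaleR_left_mono step_prob_nonneg) (use assms in auto)

lemma norm_step_avg_le:
  fixes g :: "int ^ 'n::finite \<Rightarrow> 'b::real_normed_vector"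
  assumes "0 \<le> b" "b \<le> 1" "\<And>e. e \<in> unit_vectors \<Longrightarrow> norm (g (x + e)) \<le> h (x + e)"
  shows "norm (step_avg k b g x) \<le> step_avg k b h x"
  unfolding step_avg_def
  by (intro sum_norm_le) (use assms in \<open>auto simp: step_prob_nonneg intro!: mult_left_mono\<close>)

lemma axis_nth: "axis i a $ j = (if j = i then a else 0)"
  by (simp add: axis_def)

lemma norm_axis: "norm (axis i x :: 'a::real_inner ^ 'm) = norm x"
  by (simp add: norm_eq_sqrt_inner inner_axis_axis)

definition near :: "nat \<Rightarrow> int ^ 'n \<Rightarrow> int ^ 'n \<Rightarrow> bool" where
  "near m x y \<longleftrightarrow> (\<forall>i. \<bar>y $ i - x $ i\<bar> \<le> int m)"

lemma near_refl [simp]: "near m x x" by (simp add: near_def)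

lemma near_trans: "near m x y \<Longrightarrow> near l y z \<Longrightarrow> m + l \<le> j \<Longrightarrow> near j x z"
  unfolding near_def
proof
  fix i assume "\<forall>i. \<bar>y $ i - x $ i\<bar> \<le> int m" "\<forall>i. \<bar>z $ i - y $ i\<bar> \<le> int l" "m + l \<le> j"
  then have "\<bar>y $ i - x $ i\<bar> \<le> int m" "\<bar>z $ i - y $ i\<bar> \<le> int l" "int m + int l \<le> int j" by auto
  then show "\<bar>z $ i - x $ i\<bar> \<le> int j" by linarith
qed

lemma near_step: "e \<in> unit_vectors \<Longrightarrow> near 1 x (x + e)"
  unfolding unit_steps by (auto simp: near_def axis_def)

section \<open>The walk among visited sites\<close>

text \<open>Functions of the visited set \<open>V\<close> and the position \<open>x\<close> are propagated by the Markov operator \<open>move S\<close>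
of the walk for which the sites in \<open>S\<close> also count as visited. Powers of this operator replace sums
over paths.\<close>

locale excited_walk =
  fixes k :: "'n::finite" and \<beta> :: real
  assumes \<beta>: "0 \<le> \<beta>" "\<beta> \<le> 1"
begin

definition move :: "(int ^ 'n) set \<Rightarrow> ((int ^ 'n) set \<Rightarrow> int ^ 'n \<Rightarrow> 'b::real_vector) \<Rightarrow> (int ^ 'n) set \<Rightarrow> int ^ 'n \<Rightarrow> 'b" where
  "move S F V x = step_avg k (if x \<in> S \<union> V then 0 else \<beta>) (F (insert x V)) x"

definition kick :: "(int ^ 'n) set \<Rightarrow> ((int ^ 'n) set \<Rightarrow> int ^ 'n \<Rightarrow> 'b::real_vector) \<Rightarrow> (int ^ 'n) set \<Rightarrow> int ^ 'n \<Rightarrow> 'b" where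
  "kick S F V x = move S F V x - move {} F V x"

lemma excitement: "0 \<le> (if P then 0 else \<beta>)" "(if P then 0 else \<beta>) \<le> 1"
  using \<beta> by auto

lemma kick_explicit:
  "kick S F V x = (if x \<in> S - V then
     (\<beta> / (2 * real CARD('n))) *\<^sub>R (F (insert x V) (x + axis k (-1)) - F (insert x V) (x + axis k 1)) else 0)"
  by (auto simp: kick_def move_def step_avg_explicit scaleR_diff_right)

lemma funpow_move_Suc:
  "(move S ^^ Suc n) F V x = step_avg k (if x \<in> S \<union> V then 0 else \<beta>) ((move S ^^ n) F (insert x V)) x"
  by (simp add: move_def)

lemma move_linear: "linear h \<Longrightarrow> move S (\<lambda>W y. h (F W y)) = (\<lambda>W y. h (move S F W y))"
  by (intro ext) (simp add: move_def step_avg_linear)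

lemma funpow_move_linear:
  "linear h \<Longrightarrow> (move S ^^ n) (\<lambda>W y. h (F W y)) = (\<lambda>W y. h ((move S ^^ n) F W y))"
  by (induction n) (simp_all add: move_linear)

lemma move_diff: "move S (\<lambda>W y. F W y - G W y) = (\<lambda>W y. move S F W y - move S G W y)"
  by (intro ext) (simp add: move_def step_avg_diff)

lemma funpow_move_diff:
  "(move S ^^ n) (\<lambda>W y. F W y - G W y) = (\<lambda>W y. (move S ^^ n) F W y - (move S ^^ n) G W y)"
  by (induction n) (simp_all add: move_diff)

lemma move_sum: "move S (\<lambda>W y. \<Sum>i\<in>I. F i W y) = (\<lambda>W y. \<Sum>i\<in>I. move S (F i) W y)"
  by (intro ext) (simp add: move_def step_avg_sum)

lemma funpow_move_sum:
  "(move S ^^ n) (\<lambda>W y. \<Sum>i\<in>I. F i W y) = (\<lambda>W y. \<Sum>i\<in>I. (move S ^^ n) (F i) W y)"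
  by (induction n) (simp_all add: move_sum)

lemma funpow_move_const: "(move S ^^ n) (\<lambda>W y. c) = (\<lambda>W y. c)"
proof (induction n)
  case (Suc n)
  then show ?case by (simp add: move_def[abs_def] step_avg_const)
qed simp

text \<open>In \<open>n\<close> steps the walk adds at most \<open>n\<close> visited sites and moves at most \<open>n\<close> in every coordinate, so a
bound is only needed at states within this range.\<close>

lemma norm_funpow_move_le:
  fixes F :: "(int ^ 'n) set \<Rightarrow> int ^ 'n \<Rightarrow> 'b::real_normed_vector"
  assumes "finite V"
    and "\<And>W y. finite W \<Longrightarrow> card W \<le> card V + n \<Longrightarrow> near n x y \<Longrightarrow> norm (F W y) \<le> G W y"
  shows "norm ((move S ^^ n) F V x) \<le> (move S ^^ n) G V x"
  using assms
proof (induction n arbitrary: V x)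
  case 0
  then show ?case by simp
next
  case (Suc n)
  show ?case unfolding funpow_move_Suc
  proof (rule norm_step_avg_le[OF excitement])
    fix e :: "int ^ 'n" assume e: "e \<in> unit_vectors"
    show "norm ((move S ^^ n) F (insert x V) (x + e)) \<le> (move S ^^ n) G (insert x V) (x + e)"
    proof (rule Suc.IH)
      fix W :: "(int ^ 'n) set" and y assume "finite W" "card W \<le> card (insert x V) + n" "near n (x + e) y"
      moreover have "card (insert x V) \<le> Suc (card V)" using Suc.prems(1) by (simp add: card_insert_if)
      ultimately show "norm (F W y) \<le> G W y"
        using near_trans[OF near_step[OF e] \<open>near n (x + e) y\<close>, of "Suc n"] by (intro Suc.prems(2)) auto
    qed (use Suc.prems in simp)
  qed
qed

lemma funpow_move_mono:
  fixes F G :: "(int ^ 'n) set \<Rightarrow> int ^ 'n \<Rightarrow> real"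
  assumes "\<And>W y. F W y \<le> G W y"
  shows "(move S ^^ n) F V x \<le> (move S ^^ n) G V x"
proof (induction n arbitrary: V x)
  case (Suc n)
  then show ?case unfolding funpow_move_Suc by (intro step_avg_mono excitement) auto
qed (use assms in simp)

definition expect :: "nat \<Rightarrow> (int ^ 'n \<Rightarrow> 'b::real_vector) \<Rightarrow> (int ^ 'n) set \<Rightarrow> int ^ 'n \<Rightarrow> 'b" where
  "expect n f = (move {} ^^ n) (\<lambda>_. f)"

lemma expect_0 [simp]: "expect 0 f V x = f x"
  by (simp add: expect_def)

lemma expect_Suc: "expect (Suc n) f V x = step_avg k (if x \<in> V then 0 else \<beta>) (expect n f (insert x V)) x"
  using funpow_move_Suc[of n "{}" "\<lambda>_. f" V x] by (simp add: expect_def)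

text \<open>Moving the dependence on the visited set into the operator makes expectations from different sets
comparable by telescoping.\<close>

lemma expect_forced: "(move S ^^ n) (\<lambda>_. f) V x = expect n f (S \<union> V) x"
proof (induction n arbitrary: V x)
  case (Suc n)
  have "(move S ^^ n) (\<lambda>_. f) (insert x V) = expect n f (insert x (S \<union> V))"
    by (rule ext) (simp add: Suc)
  then show ?case unfolding funpow_move_Suc expect_Suc by simp
qed simp

text \<open>The operator identity \<open>T\<^sup>n - U\<^sup>n = \<Sum>\<^sub>j T\<^sup>j (T - U) U\<^sup>n\<^sup>-\<^sup>1\<^sup>-\<^sup>j\<close>: the set \<open>S\<close> is remembered up to time \<open>j\<close> and
forgotten afterwards, except that the sites visited by then are still known.\<close>

lemma move_telescope:
  "(move S ^^ n) F V x - (move {} ^^ n) F V x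
     = (\<Sum>j<n. (move S ^^ j) (kick S ((move {} ^^ (n - Suc j)) F)) V x)"
proof (induction n arbitrary: F)
  case (Suc n)
  have "(move S ^^ Suc n) F V x - (move {} ^^ Suc n) F V x
      = (move S ^^ n) (move S F) V x - (move {} ^^ n) (move {} F) V x"
    by (simp only: funpow_Suc_right comp_def)
  also have "\<dots> = (move S ^^ n) (kick S F) V x + ((move S ^^ n) (move {} F) V x - (move {} ^^ n) (move {} F) V x)"
    unfolding kick_def[abs_def] funpow_move_diff by simp
  also have "(move S ^^ n) (move {} F) V x - (move {} ^^ n) (move {} F) V x
      = (\<Sum>j<n. (move S ^^ j) (kick S ((move {} ^^ (Suc n - Suc j)) F)) V x)"
    unfolding Suc.IH
  proof (intro sum.cong refl)
    fix j assume "j \<in> {..<n}"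
    then have "Suc n - Suc j = Suc (n - Suc j)" by auto
    then show "(move S ^^ j) (kick S ((move {} ^^ (n - Suc j)) (move {} F))) V x
      = (move S ^^ j) (kick S ((move {} ^^ (Suc n - Suc j)) F)) V x"
      by (simp only: funpow_Suc_right comp_def)
  qed
  finally show ?case by simp
qed simp

section \<open>Expansion in the memory of the past\<close>

text \<open>The part of an expectation in which the effect of the set \<open>S\<close>, handed on by successive kicks, lasts for
exactly \<open>m\<close> steps, after which a walk without memory starts, with value \<open>g\<close> at its starting point.
The walk hits \<open>S\<close> after \<open>j\<close> steps, is kicked there, and from then on remembers only the \<open>j + 1\<close> sites it
has visited itself. That the full past is never carried along keeps the combinatorial factors small.\<close>

fun memory :: "nat \<Rightarrow> (int ^ 'n \<Rightarrow> 'b::real_vector) \<Rightarrow> (int ^ 'n) set \<Rightarrow> int ^ 'n \<Rightarrow> 'b" where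
  "memory 0 g = (\<lambda>S x. g x)"
| "memory (Suc m) g = (\<lambda>S x. \<Sum>j\<le>m. (move S ^^ j) (kick S (memory (m - j) g)) {} x)"

lemma kick_sum: "kick S (\<lambda>W y. \<Sum>i\<in>I. F i W y) = (\<lambda>W y. \<Sum>i\<in>I. kick S (F i) W y)"
  by (intro ext) (simp add: kick_def move_sum sum_subtractf)

lemma kick_linear: "linear h \<Longrightarrow> kick S (\<lambda>W y. h (F W y)) = (\<lambda>W y. h (kick S F W y))"
  by (intro ext) (simp add: kick_def move_linear linear_diff)

text \<open>Telescoping between memory \<open>S\<close> and no memory leaves expectations in which the walk remembers its own
first \<open>j + 1\<close> sites and has fewer steps to go; these are expanded by induction.\<close>

lemma memory_expansion:
  "expect n f S x = (\<Sum>m\<le>n. memory m (expect (n - m) f {}) S x)"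
proof (induction n arbitrary: S x rule: less_induct)
  case (less n)
  show ?case
  proof (cases n)
    case (Suc N)
    define a where "a j l = (move S ^^ j) (kick S (memory l (expect (N - j - l) f {}))) {} x" for j l
    have "expect n f S x = (move S ^^ n) (\<lambda>_. f) {} x" by (simp add: expect_forced)
    also have "\<dots> = expect n f {} x + (\<Sum>j\<le>N. (move S ^^ j) (kick S (expect (N - j) f)) {} x)"
      using move_telescope[of n S "\<lambda>_. f" "{}" x]
      by (simp add: expect_def Suc lessThan_Suc_atMost algebra_simps del: funpow.simps sum.lessThan_Suc)
    also have "(\<Sum>j\<le>N. (move S ^^ j) (kick S (expect (N - j) f)) {} x) = (\<Sum>j\<le>N. \<Sum>l\<le>N - j. a j l)"
    proof (intro sum.cong refl)
      fix j assume "j \<in> {..N}"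
      have "expect (N - j) f = (\<lambda>W y. \<Sum>l\<le>N - j. memory l (expect (N - j - l) f {}) W y)"
        by (intro ext less) (simp add: Suc)
      then show "(move S ^^ j) (kick S (expect (N - j) f)) {} x = (\<Sum>l\<le>N - j. a j l)"
        by (simp only: kick_sum funpow_move_sum a_def)
    qed
    also have "(\<Sum>j\<le>N. \<Sum>l\<le>N - j. a j l) = (\<Sum>(j, l)\<in>{(j, l). j + l \<le> N}. a j l)"
      by (subst sum.Sigma) (auto intro!: sum.cong)
    also have "\<dots> = (\<Sum>m\<le>N. \<Sum>j\<le>m. a j (m - j))"
      by (rule sum.triangle_reindex_eq)
    also have "\<dots> = (\<Sum>m\<le>N. memory (Suc m) (expect (n - Suc m) f {}) S x)"
      by (intro sum.cong refl) (auto simp: a_def Suc intro!: sum.cong)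
    finally show ?thesis
      by (simp only: Suc sum.atMost_Suc_shift) (simp add: Suc)
  qed simp
qed

lemma memory_linear: "linear h \<Longrightarrow> memory m (\<lambda>y. h (g y)) S x = h (memory m g S x)"
proof (induction m arbitrary: S x rule: less_induct)
  case (less m)
  show ?case
  proof (cases m)
    case (Suc l)
    have "memory m (\<lambda>y. h (g y)) S x = (\<Sum>j\<le>l. (move S ^^ j) (kick S (memory (l - j) (\<lambda>y. h (g y)))) {} x)"
      by (simp add: Suc)
    also have "\<dots> = (\<Sum>j\<le>l. h ((move S ^^ j) (kick S (memory (l - j) g)) {} x))"
    proof (intro sum.cong refl)
      fix j
      have "memory (l - j) (\<lambda>y. h (g y)) = (\<lambda>W y. h (memory (l - j) g W y))"
        by (intro ext less) (auto simp: Suc less)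
      then show "(move S ^^ j) (kick S (memory (l - j) (\<lambda>y. h (g y)))) {} x = h ((move S ^^ j) (kick S (memory (l - j) g)) {} x)"
        using less.prems by (simp add: kick_linear funpow_move_linear)
    qed
    also have "\<dots> = h (memory m g S x)"
      using less.prems by (simp add: Suc linear_sum)
    finally show ?thesis .
  qed simp
qed

lemma memory_sum: "memory m (\<lambda>y. \<Sum>i\<in>I. g i y) S x = (\<Sum>i\<in>I. memory m (g i) S x)"
proof (induction m arbitrary: S x rule: less_induct)
  case (less m)
  show ?case
  proof (cases m)
    case (Suc l)
    have "memory m (\<lambda>y. \<Sum>i\<in>I. g i y) S x = (\<Sum>j\<le>l. \<Sum>i\<in>I. (move S ^^ j) (kick S (memory (l - j) (g i))) {} x)"
      unfolding Suc memory.simps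
    proof (intro sum.cong refl)
      fix j
      have "memory (l - j) (\<lambda>y. \<Sum>i\<in>I. g i y) = (\<lambda>W y. \<Sum>i\<in>I. memory (l - j) (g i) W y)"
        by (intro ext less) (auto simp: Suc)
      then show "(move S ^^ j) (kick S (memory (l - j) (\<lambda>y. \<Sum>i\<in>I. g i y))) {} x = (\<Sum>i\<in>I. (move S ^^ j) (kick S (memory (l - j) (g i))) {} x)"
        by (simp add: kick_sum funpow_move_sum)
    qed
    also have "\<dots> = (\<Sum>i\<in>I. memory m (g i) S x)"
      by (simp add: Suc sum.swap[of _ I])
    finally show ?thesis .
  qed simp
qed

text \<open>The probability of hitting a set of \<open>r\<close> sites at time \<open>j\<close> is at most \<open>r C (j + 1)\<^sup>-\<^sup>4\<close>. The kick hands
over \<open>j + 1\<close> sites, so the induction hypothesis contributes \<open>(j + 1) (m - j)\<^sup>-\<^sup>3\<close>; the convolution of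
\<open>(j + 1)\<^sup>-\<^sup>3\<close> with \<open>(m - j)\<^sup>-\<^sup>3\<close> again decays cubically, and the additional factor \<open>\<beta>\<close> absorbs the constants.
The final kick leaves the difference of \<open>g\<close> at the two neighbours in direction \<open>k\<close>.\<close>

lemma norm_memory_le:
  fixes g :: "int ^ 'n \<Rightarrow> 'b::real_normed_vector"
  assumes heat: "\<And>S j x z. (move S ^^ j) (\<lambda>_ y. indicator {z} y :: real) {} x \<le> C / (real j + 1)^4"
    and small: "32 * \<beta> * C \<le> 1" and "finite S" "0 \<le> L"
    and g: "\<And>y. near m x y \<Longrightarrow> norm (g (y + axis k (-1)) - g (y + axis k 1)) \<le> L"
  shows "norm (memory (Suc m) g S x) \<le> 2 * \<beta> * C * real (card S) * L / (real m + 1)^3"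
  using \<open>finite S\<close> g
proof (induction m arbitrary: S x rule: less_induct)
  case (less m)
  have "(move {} ^^ 0) (\<lambda>_ y. indicator {0} y :: real) {} 0 \<le> C / (real 0 + 1)^4" by (rule heat)
  then have C: "0 \<le> C" by simp
  define D where "D = 2 * real CARD('n)"
  have D: "D \<ge> 2" by (simp add: D_def Suc_leI)
  \<comment> \<open>The bound for a kick at time \<open>j\<close>. A kick at time \<open>m\<close> is the last one and acts on \<open>g\<close> itself.\<close>
  define c where "c j = (if j = m then \<beta> * L else \<beta> * (2 * \<beta> * C * (real j + 1) * L / (real (m - j))^3))" for j
  have c0: "c j \<ge> 0" for j using \<beta> C \<open>0 \<le> L\<close> by (auto simp: c_def)
  have kick: "norm (kick S (memory (m - j) g) W y) \<le> c j * indicator S y"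
    if "j \<le> m" "finite W" "card W \<le> j" "near j x y" for j W y
  proof -
    let ?d = "memory (m - j) g (insert y W) (y + axis k (-1)) - memory (m - j) g (insert y W) (y + axis k 1)"
    have main: "norm ?d * (\<beta> / D) \<le> c j"
    proof (cases "j = m")
      case True
      then have "norm (g (y + axis k (-1)) - g (y + axis k 1)) \<le> L" using that by (intro less.prems) auto
      then have "norm (g (y + axis k (-1)) - g (y + axis k 1)) * (\<beta> / D) \<le> L * (\<beta> / 1)"
        using \<beta> D \<open>0 \<le> L\<close> by (intro mult_mono divide_left_mono) auto
      then show ?thesis using True by (simp add: c_def mult.commute)
    next
      case False
      define l where "l = m - Suc j"
      have l: "m - j = Suc l" "l < m" using False \<open>j \<le> m\<close> by (auto simp: l_def)
      define b where "b = 2 * \<beta> * C * (real j + 1) * L / (real (m - j))^3"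
      have card: "card (insert y W) \<le> Suc j" using that by (simp add: card_insert_if)
      have "norm (memory (Suc l) g (insert y W) (y + e)) \<le> b" if "e = axis k 1 \<or> e = axis k (-1)" for e
      proof -
        have e: "e \<in> unit_vectors" using that unfolding unit_steps by auto
        have "norm (memory (Suc l) g (insert y W) (y + e)) \<le> 2 * \<beta> * C * real (card (insert y W)) * L / (real l + 1)^3"
        proof (rule less.IH[OF l(2)])
          fix z assume "near l (y + e) z"
          then have "near (Suc l) y z" using near_trans[OF near_step[OF e, of y]] by auto
          then have "near m x z" using near_trans[OF \<open>near j x y\<close>] l by auto
          then show "norm (g (z + axis k (-1)) - g (z + axis k 1)) \<le> L" by (rule less.prems)
        qed (use \<open>finite W\<close> in simp)
        also have "\<dots> \<le> 2 * \<beta> * C * (real j + 1) * L / (real l + 1)^3"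
          using card \<beta> C \<open>0 \<le> L\<close> by (intro divide_right_mono mult_right_mono mult_left_mono) (auto simp: of_nat_diff)
        finally show ?thesis using l by (simp add: b_def add.commute)
      qed
      then have "norm ?d \<le> b + b"
        unfolding l(1) by (intro order_trans[OF norm_triangle_ineq4] add_mono) auto
      then have "norm ?d * (\<beta> / D) \<le> (b + b) * (\<beta> / 2)"
        using \<beta> D C \<open>0 \<le> L\<close> by (intro mult_mono divide_left_mono) (auto simp: b_def)
      moreover have "(b + b) * (\<beta> / 2) = c j" using False by (simp add: c_def b_def)
      ultimately show ?thesis by simp
    qed
    show ?thesis
      unfolding kick_explicit D_def[symmetric] using main c0[of j] \<beta> D
      by (auto simp: indicator_def mult.commute)
  qed
  have term_le: "norm ((move S ^^ j) (kick S (memory (m - j) g)) {} x) \<le> real (card S) * C * (c j / (real j + 1)^4)" if "j \<le> m" for j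
  proof -
    have "norm ((move S ^^ j) (kick S (memory (m - j) g)) {} x) \<le> (move S ^^ j) (\<lambda>_ y. c j * indicator S y) {} x"
      by (rule norm_funpow_move_le) (use kick that in auto)
    also have "\<dots> = (move S ^^ j) (\<lambda>_ y. \<Sum>z\<in>S. c j * indicator {z} y) {} x"
    proof -
      have "(\<Sum>z\<in>S. c j * indicator {z} y) = c j * indicator S y" for y
        using less.prems(1) by (simp add: sum_distrib_left[symmetric] indicator_def)
      then show ?thesis by presburger
    qed
    also have "\<dots> = (\<Sum>z\<in>S. c j * (move S ^^ j) (\<lambda>_ y. indicator {z} y) {} x)"
      unfolding funpow_move_sum by (simp add: funpow_move_linear[where h="\<lambda>u. c j * u"] linear_times)
    also have "\<dots> \<le> (\<Sum>z\<in>S. c j * (C / (real j + 1)^4))"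
      by (intro sum_mono mult_left_mono heat c0)
    finally show ?thesis by (simp add: mult_ac)
  qed
  have "norm (memory (Suc m) g S x) \<le> (\<Sum>j\<le>m. real (card S) * C * (c j / (real j + 1)^4))"
    unfolding memory.simps by (intro sum_norm_le) (use term_le in auto)
  also have "\<dots> = real (card S) * C * (\<Sum>j\<le>m. c j / (real j + 1)^4)"
    by (simp only: sum_distrib_left)
  also have "(\<Sum>j\<le>m. c j / (real j + 1)^4) \<le> 2 * \<beta> * L / (real m + 1)^3"
  proof -
    have p4: "u / (real j + 1)^4 \<le> u / (real j + 1)^3" if "0 \<le> u" for u j
      using that by (intro divide_left_mono power_increasing) auto
    have "(\<Sum>j<m. c j / (real j + 1)^4) \<le> \<beta> * L / (real m + 1)^3"
    proof (cases m)
      case (Suc l)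
      have "(\<Sum>j<m. c j / (real j + 1)^4) = (\<Sum>j\<le>l. 2 * \<beta>^2 * C * L * (1 / (real j + 1)^3 * (1 / (real (l - j) + 1)^3)))"
        unfolding Suc lessThan_Suc_atMost
      proof (intro sum.cong refl)
        fix j assume j: "j \<in> {..l}"
        define r where "r = real (l - j) + 1"
        have r: "real (Suc l - j) = r" using j by (simp add: r_def Suc_diff_le)
        have "c j = \<beta> * (2 * \<beta> * C * (real j + 1) * L / r^3)"
          unfolding r[symmetric] using j by (simp add: c_def Suc)
        then have "c j / (real j + 1)^4 = 2 * \<beta>^2 * C * L * ((real j + 1) / (real j + 1)^4 * (1 / r^3))"
          by (simp add: power2_eq_square mult_ac)
        also have "(real j + 1) / (real j + 1)^4 = 1 / (real j + 1)^3"
          by (simp add: power_numeral_reduce)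
        finally show "c j / (real j + 1)^4 = 2 * \<beta>^2 * C * L * (1 / (real j + 1)^3 * (1 / (real (l - j) + 1)^3))"
          unfolding r_def .
      qed
      also have "\<dots> \<le> 2 * \<beta>^2 * C * L * (16 / (real l + 2)^3)"
        unfolding sum_distrib_left[symmetric] using \<beta> C \<open>0 \<le> L\<close> by (intro mult_left_mono inverse_cube_convolution) auto
      also have "\<dots> = (32 * \<beta> * C) * (\<beta> * L / (real m + 1)^3)"
        by (simp add: Suc power2_eq_square add.commute)
      also have "\<dots> \<le> 1 * (\<beta> * L / (real m + 1)^3)"
        using small \<beta> \<open>0 \<le> L\<close> by (intro mult_right_mono) auto
      finally show ?thesis by simp
    qed (use \<beta> \<open>0 \<le> L\<close> in simp)
    then have "(\<Sum>j<m. c j / (real j + 1)^4) + c m / (real m + 1)^4 \<le> \<beta> * L / (real m + 1)^3 + \<beta> * L / (real m + 1)^3"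
    proof (rule add_mono)
      show "c m / (real m + 1)^4 \<le> \<beta> * L / (real m + 1)^3"
        using p4[of "\<beta> * L" m] \<beta> \<open>0 \<le> L\<close> by (simp add: c_def)
    qed
    also have "\<dots> = 2 * \<beta> * L / (real m + 1)^3" by (simp add: mult.assoc)
    finally show ?thesis unfolding lessThan_Suc_atMost[symmetric] sum.lessThan_Suc .
  qed
  then have "real (card S) * C * (\<Sum>j\<le>m. c j / (real j + 1)^4) \<le> real (card S) * C * (2 * \<beta> * L / (real m + 1)^3)"
    using C by (intro mult_left_mono) auto
  finally show ?case by (simp add: mult_ac)
qed

end

section \<open>Return probabilities\<close>

lemma central_binomial_square: "(real ((2 * m) choose m))^2 * (2 * real m + 1) \<le> 16^m"
proof (induction m)
  case (Suc m)
  define a b where "a = real ((2 * m) choose m)" and "b = real ((2 * Suc m) choose Suc m)"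
  define c where "c = real (Suc (2 * m) choose Suc m)"
  have "real (Suc (2 * m)) * a = c * real (Suc m)"
    unfolding a_def c_def by (simp only: of_nat_mult[symmetric] Suc_times_binomial_eq)
  then have c: "c * (real m + 1) = (2 * real m + 1) * a"
    by (simp add: algebra_simps)
  have "Suc (2 * m) choose m = Suc (2 * m) choose Suc m"
    using binomial_symmetric[of m "Suc (2 * m)"] by (simp del: binomial_Suc_Suc)
  then have b: "b = 2 * c" by (simp add: b_def c_def)
  have "b^2 * (2 * real (Suc m) + 1) * (real m + 1)^2 = 4 * (c * (real m + 1))^2 * (2 * real m + 3)"
    by (simp add: b power2_eq_square algebra_simps)
  also have "\<dots> = 4 * ((2 * real m + 1) * (2 * real m + 3)) * (a^2 * (2 * real m + 1))"
    unfolding c by (simp add: power2_eq_square algebra_simps)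
  also have "\<dots> \<le> 4 * ((2 * real m + 1) * (2 * real m + 3)) * 16^m"
    using Suc by (intro mult_left_mono) (auto simp: a_def)
  also have "\<dots> \<le> 4 * (4 * (real m + 1)^2) * 16^m"
    by (intro mult_right_mono mult_left_mono) (auto simp: power2_eq_square algebra_simps)
  also have "\<dots> = 16^Suc m * (real m + 1)^2" by simp
  finally show ?case unfolding b_def by (rule mult_right_le_imp_le) simp
qed simp

lemma binomial_bound: "real (N choose j) / 2^N \<le> 1 / sqrt (real N + 1)"
proof -
  have "(real (N choose j) / 2^N)^2 * (real N + 1) \<le> 1"
  proof (cases "even N")
    case True
    then obtain m where N: "N = 2 * m" by auto
    have "real (N choose j) \<le> real ((2 * m) choose m)" using binomial_maximum[of N j] N by simp
    then have "(real (N choose j))^2 \<le> (real ((2 * m) choose m))^2" by (intro power_mono) auto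
    then have "(real (N choose j))^2 * (real N + 1) \<le> (real ((2 * m) choose m))^2 * (real N + 1)"
      by (intro mult_right_mono) auto
    also have "\<dots> \<le> 16^m" using central_binomial_square[of m] N by simp
    also have "(16::real)^m = (2^N)^2" by (simp add: N flip: power_mult) (simp add: power_mult)
    finally show ?thesis by (simp add: power_divide divide_le_eq)
  next
    case False
    then obtain m where N: "N = 2 * m + 1" by (auto elim: oddE)
    have "N div 2 = m" using N by simp
    then have "real (N choose j) \<le> real (N choose m)" using binomial_maximum[of N j] by simp
    moreover have "real ((2 * Suc m) choose Suc m) = 2 * real (N choose m)"
      using binomial_symmetric[of m "Suc (2 * m)"] by (simp add: N del: binomial_Suc_Suc) simp
    ultimately have "2 * real (N choose j) \<le> real ((2 * Suc m) choose Suc m)" by linarith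
    then have "(2 * real (N choose j))^2 \<le> (real ((2 * Suc m) choose Suc m))^2" by (intro power_mono) auto
    then have "(2 * real (N choose j))^2 * (real N + 1) \<le> (real ((2 * Suc m) choose Suc m))^2 * (2 * real (Suc m) + 1)"
      by (intro mult_mono) (auto simp: N)
    also have "\<dots> \<le> 16^Suc m" by (rule central_binomial_square)
    also have "(16::real)^Suc m = 4 * (2^N)^2" by (simp add: N flip: power_mult) (simp add: power_mult)
    finally show ?thesis by (simp add: power_divide divide_le_eq power_mult_distrib)
  qed
  then have "(real (N choose j) / 2^N)^2 \<le> (1 / sqrt (real N + 1))^2"
    by (simp add: power_divide pos_le_divide_eq)
  then show ?thesis by (rule power2_le_imp_le) simp
qed

text \<open>The probability that simple random walk on the integers leads from \<open>x\<close> to \<open>0\<close> in \<open>N\<close> steps.\<close>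

fun line_walk :: "nat \<Rightarrow> int \<Rightarrow> real" where
  "line_walk 0 x = (if x = 0 then 1 else 0)"
| "line_walk (Suc N) x = (line_walk N (x + 1) + line_walk N (x - 1)) / 2"

lemma line_walk_binomial:
  "line_walk N x = (if even (x + int N) \<and> 0 \<le> x + int N then real (N choose nat ((x + int N) div 2)) / 2^N else 0)"
proof (induction N arbitrary: x)
  case 0
  show ?case
  proof (cases "even x \<and> 0 \<le> x \<and> x \<noteq> 0")
    case True
    then have "nat (x div 2) \<noteq> 0" by (auto elim!: evenE)
    then show ?thesis using True by (simp add: binomial_eq_0)
  qed auto
next
  case (Suc N)
  show ?case
  proof (cases "even (x + int (Suc N))")
    case True
    then obtain a where a: "x + int (Suc N) = 2 * a" by (rule evenE)
    have e: "x + 1 + int N = 2 * a" "x - 1 + int N = 2 * (a - 1)" using a by auto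
    have u1: "line_walk N (x + 1) = (if 0 \<le> a then real (N choose nat a) / 2^N else 0)"
      unfolding Suc e by simp
    have u2: "line_walk N (x - 1) = (if 1 \<le> a then real (N choose nat (a - 1)) / 2^N else 0)"
      unfolding Suc e by simp
    consider "a < 0" | "a = 0" | b where "a = int b + 1"
      by (metis add.commute int_one_le_iff_zero_less linorder_neqE_linordered_idom zle_iff_zadd zero_le_imp_eq_int add_diff_cancel_left' diff_ge_0_iff_ge)
    then show ?thesis
    proof cases
      case 1
      then show ?thesis unfolding a using u1 u2 by simp
    next
      case 2
      then show ?thesis unfolding a using u1 u2 by simp
    next
      case 3
      then have "nat a = Suc b" "nat (a - 1) = b" by auto
      then show ?thesis unfolding a using u1 u2 3 by (simp add: add_divide_distrib)
    qed
  next
    case False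
    then have "odd (x + 1 + int N)" "odd (x - 1 + int N)" by auto
    then show ?thesis using False by (simp add: Suc)
  qed
qed

lemma line_walk_bounds: "0 \<le> line_walk N x" "line_walk N x \<le> 1 / sqrt (real N + 1)"
  unfolding line_walk_binomial using binomial_bound by auto

definition bump :: "'n \<Rightarrow> ('n \<Rightarrow> nat) \<Rightarrow> 'n \<Rightarrow> nat" where
  "bump i N = N(i := Suc (N i))"

lemma bump_apply: "bump l N i = (if l = i then Suc (N i) else N i)"
  by (simp add: bump_def)

lemma bump_commute: "bump i (bump l N) = bump l (bump i N)"
  by (auto simp: bump_def)

text \<open>A step of the walk first chooses a coordinate uniformly. The powers of \<open>pick\<close> are the expectations
over the multinomial numbers \<open>N i\<close> of choices of coordinate \<open>i\<close>.\<close>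

definition pick :: "(('n::finite \<Rightarrow> nat) \<Rightarrow> real) \<Rightarrow> ('n \<Rightarrow> nat) \<Rightarrow> real" where
  "pick G N = (\<Sum>i\<in>UNIV. G (bump i N)) / real CARD('n)"

lemma pick_linear: "pick (\<lambda>N. a * F N + b * G N) = (\<lambda>N. a * pick F N + b * pick G N)"
  by (rule ext) (simp add: pick_def sum.distrib sum_distrib_left add_divide_distrib)

lemma funpow_pick_linear:
  "(pick ^^ j) (\<lambda>N. a * F N + b * G N) = (\<lambda>N. a * (pick ^^ j) F N + b * (pick ^^ j) G N)"
  by (induction j) (simp_all add: pick_linear)

lemma funpow_pick_const: "(pick ^^ j) (\<lambda>N. c) = (\<lambda>N. c)"
  by (induction j) (simp_all add: pick_def[abs_def])

lemma pick_bump: "pick (\<lambda>N. F (bump i N)) = (\<lambda>N. pick F (bump i N))"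
  by (simp add: pick_def[abs_def] bump_commute)

lemma funpow_pick_bump: "(pick ^^ j) (\<lambda>N. F (bump i N)) = (\<lambda>N. (pick ^^ j) F (bump i N))"
  by (induction j) (simp_all add: pick_bump)

lemma funpow_pick_mono:
  assumes "\<And>N. F N \<le> G N"
  shows "(pick ^^ j) F N \<le> (pick ^^ j) G N"
  using assms by (induction j arbitrary: N) (auto simp: pick_def intro!: divide_right_mono sum_mono)

lemma funpow_pick_Suc:
  "(pick ^^ Suc j) F N = (\<Sum>i\<in>(UNIV::'n::finite set). (pick ^^ j) F (bump i N)) / real CARD('n)"
  by (simp add: pick_def)

text \<open>Started from \<open>N\<close>, the count of \<open>i\<close> is \<open>N i\<close> plus one for each of the \<open>j + 1\<close> choices that happens to be
\<open>i\<close>. Each of them is so with probability \<open>1/d\<close>, and the other \<open>j\<close> choices are independent of it.\<close>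

lemma pick_palm:
  fixes F :: "('n::finite \<Rightarrow> nat) \<Rightarrow> real"
  shows "(pick ^^ Suc j) (\<lambda>N. real (N i) * F N) N
    = real (N i) * (pick ^^ Suc j) F N + real (Suc j) / real CARD('n) * (pick ^^ j) F (bump i N)"
proof (induction j arbitrary: N)
  case 0
  have "(\<Sum>l\<in>UNIV. real (bump l N i) * F (bump l N))
      = (\<Sum>l\<in>UNIV. real (N i) * F (bump l N) + (if l = i then F (bump i N) else 0))"
    by (intro sum.cong) (auto simp: bump_def algebra_simps)
  then show ?case
    by (simp add: pick_def sum.distrib sum_distrib_left[symmetric] add_divide_distrib)
next
  case (Suc j)
  have "(pick ^^ Suc (Suc j)) (\<lambda>N. real (N i) * F N) N
     = (\<Sum>l\<in>UNIV. (pick ^^ Suc j) (\<lambda>N. real (N i) * F N) (bump l N)) / real CARD('n)"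
    by (simp add: pick_def)
  also have "\<dots> = (\<Sum>l\<in>UNIV. real (N i) * (pick ^^ Suc j) F (bump l N)
      + (if l = i then (pick ^^ Suc j) F (bump i N) else 0)
      + real (Suc j) / real CARD('n) * (pick ^^ j) F (bump l (bump i N))) / real CARD('n)"
    unfolding Suc by (intro arg_cong2[where f="(/)"] sum.cong refl)
      (auto simp: bump_apply bump_commute[of i] algebra_simps simp del: funpow.simps)
  also have "\<dots> = real (N i) * (pick ^^ Suc (Suc j)) F N + (pick ^^ Suc j) F (bump i N) / real CARD('n)
      + real (Suc j) / real CARD('n) * (pick ^^ Suc j) F (bump i N)"
    unfolding sum.distrib sum_distrib_left[symmetric]
    by (simp add: funpow_pick_Suc[of "Suc j" F N] funpow_pick_Suc[of j F "bump i N"] add_divide_distrib del: funpow.simps)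
  also have "\<dots> = real (N i) * (pick ^^ Suc (Suc j)) F N + real (Suc (Suc j)) / real CARD('n) * (pick ^^ Suc j) F (bump i N)"
    by (simp add: algebra_simps add_divide_distrib del: funpow.simps)
  finally show ?case .
qed

text \<open>The identity \<open>pick_palm\<close> read backwards: a factor \<open>1/(N i + 1)\<close> is traded for one further step and a
factor \<open>d/(j + 1)\<close>. Each coordinate can be used once, as long as \<open>H\<close> does not depend on it.\<close>

lemma pick_occupation_bound:
  fixes H :: "('n::finite \<Rightarrow> nat) \<Rightarrow> real"
  assumes H: "\<And>N. 0 \<le> H N" "\<And>N. H (bump i N) = H N"
  shows "(pick ^^ j) (\<lambda>N. H N / (real (N i) + 1)) (\<lambda>_. 0)
    \<le> real CARD('n) / (real j + 1) * (pick ^^ Suc j) H (\<lambda>_. 0)"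
proof -
  \<comment> \<open>Where \<open>N i = 0\<close> this is \<open>0\<close>, so \<open>N i * F N\<close> is at most \<open>H N\<close>.\<close>
  define F where "F N = H N / real (N i)" for N
  have "(\<lambda>N. F (bump i N)) = (\<lambda>N. H N / (real (N i) + 1))"
    by (rule ext) (simp add: F_def H bump_apply add.commute)
  then have "(pick ^^ j) (\<lambda>N. H N / (real (N i) + 1)) (\<lambda>_. 0) = (pick ^^ j) F (bump i (\<lambda>_. 0))"
    using fun_cong[OF funpow_pick_bump[of j F i]] by simp
  also have "\<dots> = real CARD('n) / (real j + 1) * (pick ^^ Suc j) (\<lambda>N. real (N i) * F N) (\<lambda>_. 0)"
    unfolding pick_palm by (simp add: add.commute del: funpow.simps)
  also have "\<dots> \<le> real CARD('n) / (real j + 1) * (pick ^^ Suc j) H (\<lambda>_. 0)"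
    by (intro mult_left_mono funpow_pick_mono) (auto simp: F_def H)
  finally show ?thesis .
qed

lemma pick_inverse_moment:
  fixes A :: "'n::finite set"
  shows "(pick ^^ j) (\<lambda>N. \<Prod>i\<in>A. 1 / (real (N i) + 1)) (\<lambda>_. 0) \<le> (real CARD('n) / (real j + 1))^card A"
  using finite[of A]
proof (induction A arbitrary: j rule: finite_induct)
  case empty
  then show ?case by (simp add: funpow_pick_const)
next
  case (insert i A)
  let ?H = "\<lambda>N::'n \<Rightarrow> nat. \<Prod>i\<in>A. 1 / (real (N i) + 1)"
  have "(\<lambda>N. \<Prod>i\<in>insert i A. 1 / (real (N i) + 1)) = (\<lambda>N. ?H N / (real (N i) + 1))"
    using insert.hyps by (simp add: mult.commute)
  moreover have "?H (bump i N) = ?H N" for N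
    using insert.hyps by (intro prod.cong) (auto simp: bump_def)
  ultimately have "(pick ^^ j) (\<lambda>N. \<Prod>i\<in>insert i A. 1 / (real (N i) + 1)) (\<lambda>_. 0)
     \<le> real CARD('n) / (real j + 1) * (pick ^^ Suc j) ?H (\<lambda>_. 0)"
    using pick_occupation_bound[of ?H i j] by (simp add: prod_nonneg del: funpow.simps)
  also have "\<dots> \<le> real CARD('n) / (real j + 1) * (real CARD('n) / (real (Suc j) + 1))^card A"
    by (intro mult_left_mono insert.IH) simp
  also have "\<dots> \<le> real CARD('n) / (real j + 1) * (real CARD('n) / (real j + 1))^card A"
    by (intro mult_left_mono power_mono divide_left_mono) auto
  finally show ?case using insert.hyps by simp
qed

definition coordinate_walks :: "'n set \<Rightarrow> int ^ 'n \<Rightarrow> ('n::finite \<Rightarrow> nat) \<Rightarrow> int ^ 'n \<Rightarrow> real" where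
  "coordinate_walks A z N y = (\<Prod>i\<in>A. line_walk (N i) (y $ i - z $ i))"

lemma coordinate_walks_step:
  "(coordinate_walks A z N (y + axis i 1) + coordinate_walks A z N (y + axis i (-1))) / 2
    = coordinate_walks A z (if i \<in> A then bump i N else N) y"
proof (cases "i \<in> A")
  case True
  have *: "coordinate_walks A z N' y' = line_walk (N' i) (y' $ i - z $ i) * (\<Prod>l\<in>A - {i}. line_walk (N' l) (y' $ l - z $ l))" for N' y'
    unfolding coordinate_walks_def using True by (intro prod.remove) auto
  have "(\<Prod>l\<in>A - {i}. line_walk (N l) ((y + axis i s) $ l - z $ l)) = (\<Prod>l\<in>A - {i}. line_walk (N l) (y $ l - z $ l))" for s
    by (intro prod.cong) (auto simp: axis_def)
  moreover have "(\<Prod>l\<in>A - {i}. line_walk (bump i N l) (y $ l - z $ l)) = (\<Prod>l\<in>A - {i}. line_walk (N l) (y $ l - z $ l))"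
    by (intro prod.cong) (auto simp: bump_def)
  moreover have "bump i N i = Suc (N i)" by (simp add: bump_def)
  ultimately show ?thesis
    using True by (simp add: * axis_def distrib_right[symmetric] add_divide_distrib) (simp add: algebra_simps)
next
  case False
  have "coordinate_walks A z N (y + axis i s) = coordinate_walks A z N y" for s
    unfolding coordinate_walks_def using False by (intro prod.cong) (auto simp: axis_def)
  then show ?thesis using False by simp
qed

lemma coordinate_walks_bump: "i \<notin> A \<Longrightarrow> coordinate_walks A z (bump i N) y = coordinate_walks A z N y"
  unfolding coordinate_walks_def by (intro prod.cong) (auto simp: bump_def)

context excited_walk
begin

text \<open>Steps in direction \<open>k\<close> do not change a function of the other coordinates, so the excitement is
invisible to it.\<close>

lemma move_coordinate_walks:
  assumes "k \<notin> A"
  shows "move S (\<lambda>_ y. coordinate_walks A z N y) = (\<lambda>_ y. pick (\<lambda>N. coordinate_walks A z N y) N)"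
proof (intro ext)
  fix V :: "(int ^ 'n) set" and y
  have "coordinate_walks A z N (y + axis k s) = coordinate_walks A z N y" for s
    unfolding coordinate_walks_def using assms by (intro prod.cong) (auto simp: axis_def)
  then have "move S (\<lambda>_ y. coordinate_walks A z N y) V y
     = (1 / (2 * real CARD('n))) * (\<Sum>i\<in>UNIV. coordinate_walks A z N (y + axis i 1) + coordinate_walks A z N (y + axis i (-1)))"
    by (simp add: move_def step_avg_explicit)
  also have "\<dots> = (\<Sum>i\<in>UNIV. (coordinate_walks A z N (y + axis i 1) + coordinate_walks A z N (y + axis i (-1))) / 2) / real CARD('n)"
    by (simp add: sum_divide_distrib[symmetric])
  also have "\<dots> = (\<Sum>i\<in>UNIV. coordinate_walks A z (bump i N) y) / real CARD('n)"
    unfolding coordinate_walks_step by (intro arg_cong2[where f="(/)"] sum.cong) (auto simp: coordinate_walks_bump)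
  finally show "move S (\<lambda>_ y. coordinate_walks A z N y) V y = pick (\<lambda>N. coordinate_walks A z N y) N"
    by (simp add: pick_def)
qed

lemma funpow_move_coordinate_walks:
  assumes "k \<notin> A"
  shows "(move S ^^ j) (\<lambda>_ y. coordinate_walks A z N y) = (\<lambda>_ y. (pick ^^ j) (\<lambda>N. coordinate_walks A z N y) N)"
proof (induction j arbitrary: N)
  case (Suc j)
  have lin: "linear (\<lambda>u::real. u / real CARD('n))" by (simp add: linear_iff add_divide_distrib)
  have "(move S ^^ Suc j) (\<lambda>_ y. coordinate_walks A z N y)
      = (move S ^^ j) (\<lambda>W y. (\<Sum>i\<in>UNIV. coordinate_walks A z (bump i N) y) / real CARD('n))"
    by (simp only: funpow_Suc_right comp_def move_coordinate_walks[OF assms] pick_def)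
  also have "\<dots> = (\<lambda>_ y. (\<Sum>i\<in>UNIV. (pick ^^ j) (\<lambda>N. coordinate_walks A z N y) (bump i N)) / real CARD('n))"
    by (simp only: funpow_move_linear[OF lin, where F="\<lambda>W y. \<Sum>i\<in>UNIV. coordinate_walks A z (bump i N) y"] funpow_move_sum Suc)
  finally show ?case by (simp only: funpow.simps comp_def pick_def[of "(pick ^^ j) G" for G])
qed simp

text \<open>Forget all but eight of the coordinates different from \<open>k\<close>. Given the numbers \<open>N i\<close> of steps in each of
them the coordinates are independent simple random walks, so the probability of being at \<open>z\<close> is at
most the product of \<open>(N i + 1)\<^sup>-\<^sup>1\<^sup>/\<^sup>2\<close>. Its mean is at most the square root of the mean of the product
of \<open>(N i + 1)\<^sup>-\<^sup>1\<close>, which is of order \<open>j\<^sup>-\<^sup>8\<close>.\<close>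

theorem return_bound:
  assumes "CARD('n) > 8"
  shows "(move S ^^ j) (\<lambda>_ y. indicator {z} y :: real) V x \<le> (real CARD('n)^8 + 1) / 2 / (real j + 1)^4"
proof -
  have "card (UNIV - {k}) \<ge> 8" using assms by simp
  then obtain A where A: "A \<subseteq> UNIV - {k}" "card A = 8" by (meson obtain_subset_with_card_n)
  let ?r = "real j + 1"
  have prod_bound: "coordinate_walks A z N y \<le> (?r^4 / 2) * (\<Prod>i\<in>A. 1 / (real (N i) + 1)) + (1 / (2 * ?r^4)) * 1" for N y
  proof -
    define p where "p = (\<Prod>i\<in>A. 1 / sqrt (real (N i) + 1))"
    have "coordinate_walks A z N y \<le> p"
      unfolding coordinate_walks_def p_def by (intro prod_mono) (use line_walk_bounds in auto)
    moreover have "p^2 = (\<Prod>i\<in>A. 1 / (real (N i) + 1))"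
      unfolding p_def prod_power_distrib by (intro prod.cong) (auto simp: power_divide)
    \<comment> \<open>In place of the Cauchy-Schwarz inequality for \<open>pick\<close>: the weights balance the two terms at their
      expected size \<open>(j + 1)\<^sup>-\<^sup>4\<close>.\<close>
    moreover have "p \<le> (?r^4 / 2) * p^2 + 1 / (2 * ?r^4)"
    proof -
      have "0 \<le> (?r^4 * p - 1)^2 / (2 * ?r^4)" by simp
      also have "\<dots> = (?r^4 / 2) * p^2 + 1 / (2 * ?r^4) - p"
        by (simp add: power2_eq_square field_simps)
      finally show ?thesis by simp
    qed
    ultimately show ?thesis by simp
  qed
  have "(move S ^^ j) (\<lambda>_ y. indicator {z} y :: real) V x \<le> (move S ^^ j) (\<lambda>_ y. coordinate_walks A z (\<lambda>_. 0) y) V x"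
    by (rule funpow_move_mono) (auto simp: indicator_def coordinate_walks_def intro!: prod_nonneg)
  also have "\<dots> = (pick ^^ j) (\<lambda>N. coordinate_walks A z N x) (\<lambda>_. 0)"
    using A by (subst funpow_move_coordinate_walks) auto
  also have "\<dots> \<le> (pick ^^ j) (\<lambda>N. (?r^4 / 2) * (\<Prod>i\<in>A. 1 / (real (N i) + 1)) + (1 / (2 * ?r^4)) * 1) (\<lambda>_. 0)"
    by (intro funpow_pick_mono prod_bound)
  also have "\<dots> = (?r^4 / 2) * (pick ^^ j) (\<lambda>N. \<Prod>i\<in>A. 1 / (real (N i) + 1)) (\<lambda>_. 0) + 1 / (2 * ?r^4)"
    unfolding funpow_pick_linear funpow_pick_const by simp
  also have "\<dots> \<le> (?r^4 / 2) * (real CARD('n) / ?r)^8 + 1 / (2 * ?r^4)"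
    using pick_inverse_moment[of j A] A by (intro add_right_mono mult_left_mono) auto
  also have "(?r^4 / 2) * (real CARD('n) / ?r)^8 = real CARD('n)^8 / 2 / ?r^4"
  proof -
    have "?r^8 = ?r^4 * ?r^4" by (simp flip: power_add)
    then have "(real CARD('n) / ?r)^8 = real CARD('n)^8 / (?r^4 * ?r^4)" by (simp only: power_divide)
    moreover have "(a / 2) * (D / (a * a)) = D / 2 / a" if "a \<noteq> 0" for a D :: real
      using that by (simp add: field_simps)
    ultimately show ?thesis by (metis (no_types) power_not_zero of_nat_Suc of_nat_neq_0 add.commute)
  qed
  finally show ?thesis by (simp add: add_divide_distrib)
qed

end

section \<open>Lattice symmetries\<close>

abbreviation coord :: "'n \<Rightarrow> int ^ 'n \<Rightarrow> real" where
  "coord i y \<equiv> real_of_int (y $ i)"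

lemma real_vec_component [simp]: "real_vec x $ i = real_of_int (x $ i)"
  by (simp add: real_vec_def)

lemma real_vec_add: "real_vec (x + y) = real_vec x + real_vec y"
  by (simp add: vec_eq_iff)

lemma real_vec_zero [simp]: "real_vec 0 = 0"
  by (simp add: vec_eq_iff)

text \<open>An injective map of the lattice that permutes the directions of the steps without changing their
weights. Translations and reflections in the coordinates other than \<open>k\<close> are the instances.\<close>

definition (in excited_walk) symmetry :: "(int ^ 'n \<Rightarrow> int ^ 'n) \<Rightarrow> bool" where
  "symmetry \<phi> \<longleftrightarrow> inj \<phi> \<and> (\<exists>p. bij_betw p unit_vectors unit_vectors \<and>
     (\<forall>e\<in>unit_vectors. (\<forall>x. \<phi> (x + e) = \<phi> x + p e) \<and> (\<forall>b. step_prob k b (p e) = step_prob k b e)))"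

definition reflect :: "'n \<Rightarrow> int ^ 'n \<Rightarrow> int ^ 'n" where
  "reflect i x = (\<chi> j. if j = i then - x $ j else x $ j)"

context excited_walk
begin

lemma symmetry_translation: "symmetry (\<lambda>x. a + x)"
  unfolding symmetry_def by (auto simp: inj_def add.assoc intro!: exI[of _ id])

lemma symmetry_reflect:
  assumes "i \<noteq> k"
  shows "symmetry (reflect i)"
  unfolding symmetry_def
proof (intro conjI exI ballI allI)
  have inv: "reflect i (reflect i x) = x" for x :: "int ^ 'n"
    by (simp add: reflect_def vec_eq_iff)
  then show "inj (reflect i :: int ^ 'n \<Rightarrow> _)" by (metis injI)
  have norm: "norm (real_vec (reflect i x)) = norm (real_vec x)" for x :: "int ^ 'n"
    unfolding norm_vec_def L2_set_def by (intro arg_cong[where f=sqrt] sum.cong) (auto simp: reflect_def)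
  show "bij_betw (reflect i) (unit_vectors :: (int ^ 'n) set) unit_vectors"
    by (rule bij_betwI[of _ _ _ "reflect i"]) (auto simp: inv norm)
  fix e x :: "int ^ 'n" and b
  show "reflect i (x + e) = reflect i x + reflect i e"
    by (simp add: reflect_def vec_eq_iff)
  show "step_prob k b (reflect i e) = step_prob k b e"
    using assms by (simp add: step_prob_def norm indicator_def inner_axis') (simp add: reflect_def)
qed

lemma step_avg_symmetry:
  assumes "symmetry \<phi>"
  shows "step_avg k b (\<lambda>y. g (\<phi> y)) x = step_avg k b g (\<phi> x)"
proof -
  obtain p where p: "bij_betw p unit_vectors unit_vectors"
    "\<And>e x. e \<in> unit_vectors \<Longrightarrow> \<phi> (x + e) = \<phi> x + p e"
    "\<And>e b. e \<in> unit_vectors \<Longrightarrow> step_prob k b (p e) = step_prob k b e"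
    using assms unfolding symmetry_def by blast
  have "step_avg k b g (\<phi> x) = (\<Sum>e\<in>unit_vectors. step_prob k b (p e) *\<^sub>R g (\<phi> x + p e))"
    unfolding step_avg_def by (rule sum.reindex_bij_betw[OF p(1), symmetric])
  then show ?thesis by (simp add: step_avg_def p)
qed

lemma move_symmetry:
  assumes "symmetry \<phi>"
  shows "move S (\<lambda>V y. F (\<phi> ` V) (\<phi> y)) = (\<lambda>V y. move (\<phi> ` S) F (\<phi> ` V) (\<phi> y))"
proof (intro ext)
  fix V x
  have "\<phi> x \<in> \<phi> ` A \<longleftrightarrow> x \<in> A" for A using assms by (auto simp: symmetry_def inj_image_mem_iff)
  then show "move S (\<lambda>V y. F (\<phi> ` V) (\<phi> y)) V x = move (\<phi> ` S) F (\<phi> ` V) (\<phi> x)"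
    using step_avg_symmetry[OF assms, of _ "F (\<phi> ` insert x V)" x] by (simp add: move_def)
qed

lemma funpow_move_symmetry:
  assumes "symmetry \<phi>"
  shows "(move S ^^ n) (\<lambda>V y. F (\<phi> ` V) (\<phi> y)) = (\<lambda>V y. (move (\<phi> ` S) ^^ n) F (\<phi> ` V) (\<phi> y))"
  by (induction n) (simp_all add: move_symmetry[OF assms])

lemma expect_symmetry:
  assumes "symmetry \<phi>"
  shows "expect n (\<lambda>y. f (\<phi> y)) V x = expect n f (\<phi> ` V) (\<phi> x)"
  using funpow_move_symmetry[OF assms, of n "{}" "\<lambda>_. f"] by (simp add: expect_def)

lemma kick_symmetry:
  assumes "symmetry \<phi>"
  shows "kick S (\<lambda>V y. F (\<phi> ` V) (\<phi> y)) = (\<lambda>V y. kick (\<phi> ` S) F (\<phi> ` V) (\<phi> y))"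
  by (intro ext) (simp add: kick_def move_symmetry[OF assms])

lemma memory_symmetry:
  assumes "symmetry \<phi>"
  shows "memory m (\<lambda>y. g (\<phi> y)) S x = memory m g (\<phi> ` S) (\<phi> x)"
proof (induction m arbitrary: S x rule: less_induct)
  case (less m)
  show ?case
  proof (cases m)
    case (Suc l)
    have "(move S ^^ j) (kick S (memory (l - j) (\<lambda>y. g (\<phi> y)))) {} x
        = (move (\<phi> ` S) ^^ j) (kick (\<phi> ` S) (memory (l - j) g)) {} (\<phi> x)" for j
    proof -
      have "memory (l - j) (\<lambda>y. g (\<phi> y)) = (\<lambda>V y. memory (l - j) g (\<phi> ` V) (\<phi> y))"
        by (intro ext less) (simp add: Suc)
      then show ?thesis
        by (simp add: kick_symmetry[OF assms] funpow_move_symmetry[OF assms])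
    qed
    then show ?thesis by (simp add: Suc)
  qed simp
qed

section \<open>The renewal equation\<close>

lemma expect_linear: "linear h \<Longrightarrow> expect n (\<lambda>y. h (f y)) V x = h (expect n f V x)"
  using funpow_move_linear[of h n "{}" "\<lambda>_. f"] by (simp add: expect_def)

lemma expect_sum: "expect n (\<lambda>y. \<Sum>i\<in>I. f i y) V x = (\<Sum>i\<in>I. expect n (f i) V x)"
  using funpow_move_sum[of n "{}" "\<lambda>i _. f i" I] by (simp add: expect_def)

lemma expect_const: "expect n (\<lambda>y. c) V x = c"
  using funpow_move_const[of n "{}" c] by (simp add: expect_def)

lemma expect_add: "expect n (\<lambda>y. f y + g y) V x = expect n f V x + expect n g V x"
  using expect_sum[of n "\<lambda>b. if b then f else g" UNIV V x] by (simp add: UNIV_bool add.commute)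

lemma expect_translate: "expect n f {} y = expect n (\<lambda>z. f (y + z)) {} 0"
  using expect_symmetry[OF symmetry_translation, of n f y "{}" 0] by simp

lemma norm_expect_le:
  fixes f :: "int ^ 'n \<Rightarrow> 'b::real_normed_vector"
  assumes "finite V" "\<And>y. near n x y \<Longrightarrow> norm (f y) \<le> c"
  shows "norm (expect n f V x) \<le> c"
  using norm_funpow_move_le[of V n x "\<lambda>_. f" "\<lambda>_ _. c" "{}"] assms
  by (simp add: expect_def funpow_move_const)

text \<open>The first step from the origin is excited, and afterwards the origin is the only site to be
remembered.\<close>

definition renewal :: "nat \<Rightarrow> (int ^ 'n \<Rightarrow> 'b::real_vector) \<Rightarrow> 'b" where
  "renewal l g = step_avg k \<beta> (memory l g {0}) 0"

lemma renewal_equation: "expect (Suc n) f {} 0 = (\<Sum>l\<le>n. renewal l (expect (n - l) f {}))"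
proof -
  have "expect n f {0} = (\<lambda>x. \<Sum>l\<le>n. memory l (expect (n - l) f {}) {0} x)"
    by (rule ext) (rule memory_expansion)
  then show ?thesis by (simp add: expect_Suc renewal_def step_avg_sum)
qed

lemma renewal_linear: "linear h \<Longrightarrow> renewal l (\<lambda>y. h (g y)) = h (renewal l g)"
proof -
  assume h: "linear h"
  then have "memory l (\<lambda>y. h (g y)) {0} = (\<lambda>x. h (memory l g {0} x))"
    by (intro ext) (rule memory_linear)
  then show ?thesis using h by (simp add: renewal_def step_avg_linear)
qed

lemma renewal_sum: "renewal l (\<lambda>y. \<Sum>i\<in>I. g i y) = (\<Sum>i\<in>I. renewal l (g i))"
proof -
  have "memory l (\<lambda>y. \<Sum>i\<in>I. g i y) {0} = (\<lambda>x. \<Sum>i\<in>I. memory l (g i) {0} x)"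
    by (intro ext) (rule memory_sum)
  then show ?thesis by (simp add: renewal_def step_avg_sum)
qed

lemma renewal_add: "renewal l (\<lambda>y. f y + g y) = renewal l f + renewal l g"
  using renewal_sum[of l "\<lambda>b. if b then f else g" UNIV] by (simp add: UNIV_bool add.commute)

lemma renewal_reflect:
  assumes "i \<noteq> k"
  shows "renewal l (\<lambda>y. g (reflect i y)) = renewal l g"
proof -
  have 0: "reflect i 0 = (0 :: int ^ 'n)" by (simp add: reflect_def vec_eq_iff)
  note s = symmetry_reflect[OF assms]
  have "memory l (\<lambda>y. g (reflect i y)) {0} = (\<lambda>x. memory l g {0} (reflect i x))"
    using memory_symmetry[OF s, of l g "{0}"] by (intro ext) (simp add: 0)
  then show ?thesis
    using step_avg_symmetry[OF s, of \<beta> "memory l g {0}" 0] by (simp add: renewal_def 0)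
qed

end

text \<open>The constant of \<open>return_bound\<close>. It depends on the dimension alone, which is passed as a type; hence
so does the threshold for \<open>\<beta>\<close>.\<close>

definition return_const :: "'n::finite itself \<Rightarrow> real" where
  "return_const _ = (real CARD('n)^8 + 1) / 2"

text \<open>Below this threshold the bound of \<open>norm_memory_le\<close> reproduces itself under one more kick.\<close>

locale weakly_excited_walk = excited_walk k \<beta> for k :: "'n::finite" and \<beta> :: real +
  assumes dim: "CARD('n) > 8" and small: "32 * \<beta> * return_const TYPE('n) \<le> 1"
begin

lemma norm_renewal_le:
  fixes g :: "int ^ 'n \<Rightarrow> 'b::real_normed_vector"
  assumes "l \<ge> 1" "0 \<le> L" "\<And>y. near l 0 y \<Longrightarrow> norm (g (y + axis k (-1)) - g (y + axis k 1)) \<le> L"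
  shows "norm (renewal l g) \<le> 8 * L / (real l + 1)^3"
proof -
  obtain m where m: "l = Suc m" using assms(1) by (cases l) auto
  have "norm (memory l g {0} (0 + e)) \<le> L / (real m + 1)^3" if e: "e \<in> unit_vectors" for e
  proof -
    have "norm (memory (Suc m) g {0} (0 + e)) \<le> 2 * \<beta> * return_const TYPE('n) * real (card {0 :: int ^ 'n}) * L / (real m + 1)^3"
    proof (rule norm_memory_le[OF _ small])
      show "(move S ^^ j) (\<lambda>_. indicat_real {z}) {} x \<le> return_const TYPE('n) / (real j + 1)^4" for S j x z
        unfolding return_const_def by (rule return_bound[OF dim])
      fix y assume "near m (0 + e) y"
      then have "near l 0 y" using near_trans[OF near_step[OF e]] m by auto
      then show "norm (g (y + axis k (-1)) - g (y + axis k 1)) \<le> L" by (rule assms)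
    qed (use assms in auto)
    also have "\<dots> \<le> 1 * L / (real m + 1)^3"
      using small \<beta> assms by (intro divide_right_mono mult_right_mono) auto
    finally show ?thesis by (simp add: m)
  qed
  then have "norm (renewal l g) \<le> step_avg k \<beta> (\<lambda>_. L / (real m + 1)^3) 0"
    unfolding renewal_def by (intro norm_step_avg_le \<beta>) auto
  also have "\<dots> = L / (real m + 1)^3" by (rule step_avg_const)
  also have "\<dots> \<le> 8 * L / (real l + 1)^3"
  proof -
    have "(real l + 1)^3 \<le> (2 * (real m + 1))^3" by (intro power_mono) (auto simp: m)
    also have "(2 * (real m + 1))^3 = 8 * (real m + 1)^3" unfolding power_mult_distrib by simp
    finally have "L * (real l + 1)^3 \<le> L * (8 * (real m + 1)^3)" using \<open>0 \<le> L\<close> by (rule mult_left_mono)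
    then show ?thesis by (simp add: frac_le_eq pos_divide_le_eq pos_le_divide_eq mult_ac)
  qed
  finally show ?thesis .
qed

lemma renewal_const: "renewal l (\<lambda>_. c :: 'b::real_normed_vector) = (if l = 0 then c else 0)"
proof (cases "l = 0")
  case True
  then show ?thesis by (simp add: renewal_def step_avg_const)
next
  case False
  then have "norm (renewal l (\<lambda>_. c)) \<le> 8 * 0 / (real l + 1)^3" by (intro norm_renewal_le) auto
  then show ?thesis using False by simp
qed

lemma renewal_0: "renewal 0 g = step_avg k \<beta> g 0"
  by (simp add: renewal_def)

section \<open>Mean and second moments\<close>

text \<open>The coefficients of the recursions for the mean and the second moment of the coordinate \<open>k\<close>.\<close>

definition drift_term :: "nat \<Rightarrow> real" where
  "drift_term l = renewal l (\<lambda>y. coord k y)"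

definition square_term :: "nat \<Rightarrow> real" where
  "square_term l = renewal l (\<lambda>y. (coord k y)^2)"

lemma step_avg_square:
  "step_avg k b (\<lambda>y. (coord i y)^2) x = (coord i x)^2 + 1 / real CARD('n)
     + (if i = k then 2 * b * coord i x / real CARD('n) else 0)"
proof -
  have "(\<Sum>j\<in>UNIV. (real_of_int ((x + axis j 1) $ i))^2 + (real_of_int ((x + axis j (-1)) $ i))^2)
     = (\<Sum>j\<in>UNIV. 2 * (coord i x)^2 + (if j = i then 2 else 0))"
    by (intro sum.cong) (auto simp: axis_nth power2_eq_square algebra_simps)
  also have "\<dots> = 2 * real CARD('n) * (coord i x)^2 + 2"
    by (simp add: sum.distrib)
  finally show ?thesis
    by (simp add: step_avg_explicit axis_nth) (simp add: field_simps power2_eq_square)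
qed

lemma step_avg_coordinate:
  "step_avg k b (\<lambda>y. coord i y) x = coord i x + (if i = k then b / real CARD('n) else 0)"
proof -
  have "(\<Sum>j\<in>UNIV. real_of_int ((x + axis j 1) $ i) + real_of_int ((x + axis j (-1)) $ i))
     = (\<Sum>j\<in>(UNIV::'n set). 2 * coord i x)"
    by (intro sum.cong) (auto simp: axis_nth)
  then show ?thesis by (simp add: step_avg_explicit axis_nth field_simps)
qed

lemma drift_term_bound: "\<bar>drift_term l\<bar> \<le> 32 / (real l + 1)^3"
proof (cases "l = 0")
  case True
  have "drift_term 0 = \<beta> / real CARD('n)"
    by (simp add: drift_term_def renewal_0 step_avg_coordinate)
  moreover have "0 \<le> \<beta> / real CARD('n)" "\<beta> / real CARD('n) \<le> 1 / 1"
    using \<beta> by simp (use \<beta> in \<open>intro frac_le, auto simp: Suc_leI\<close>)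
  ultimately have "\<bar>drift_term 0\<bar> \<le> 32" by linarith
  then show ?thesis using True by simp
next
  case False
  then have "norm (renewal l (\<lambda>y. coord k y)) \<le> 8 * 2 / (real l + 1)^3"
    by (intro norm_renewal_le) (auto simp: axis_nth)
  also have "\<dots> \<le> 32 / (real l + 1)^3" by (intro divide_right_mono) auto
  finally show ?thesis by (simp add: drift_term_def)
qed

lemma square_term_bound: "\<bar>square_term l\<bar> \<le> 32 / (real l + 1)^2"
proof (cases "l = 0")
  case True
  have "square_term 0 = 1 / real CARD('n)"
    by (simp add: square_term_def renewal_0 step_avg_square)
  moreover have "0 \<le> 1 / real CARD('n)" "1 / real CARD('n) \<le> 1" using dim by (simp_all add: divide_le_eq)
  ultimately have "\<bar>square_term 0\<bar> \<le> 32" by linarith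
  then show ?thesis using True by simp
next
  case False
  have "norm (renewal l (\<lambda>y. (coord k y)^2)) \<le> 8 * (4 * real l) / (real l + 1)^3"
  proof (rule norm_renewal_le)
    fix y :: "int ^ 'n" assume "near l 0 y"
    then have "\<bar>y $ k\<bar> \<le> int l" by (simp add: near_def)
    then have "\<bar>coord k y\<bar> \<le> real l" by linarith
    moreover have "(real_of_int ((y + axis k (-1)) $ k))^2 - (real_of_int ((y + axis k 1) $ k))^2 = - 4 * coord k y"
      by (simp add: axis_nth power2_eq_square algebra_simps)
    ultimately show "norm ((real_of_int ((y + axis k (-1)) $ k))^2 - (real_of_int ((y + axis k 1) $ k))^2) \<le> 4 * real l"
      by simp
  qed (use False in auto)
  also have "\<dots> = 32 / (real l + 1)^3 * real l" by simp
  also have "\<dots> \<le> 32 / (real l + 1)^2" by (rule cube_times_index) simp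
  finally show ?thesis by (simp add: square_term_def)
qed

definition mean_k :: "nat \<Rightarrow> real" where
  "mean_k n = expect n (\<lambda>y. coord k y) {} 0"

definition square_k :: "nat \<Rightarrow> real" where
  "square_k n = expect n (\<lambda>y. (coord k y)^2) {} 0"

lemma expect_coordinate_from: "expect n (\<lambda>y. coord k y) {} y = coord k y + mean_k n"
  by (subst expect_translate) (simp add: expect_add expect_const mean_k_def)

lemma expect_square_from:
  "expect n (\<lambda>y. (coord k y)^2) {} y
    = (coord k y)^2 + 2 * coord k y * mean_k n + square_k n"
proof -
  have "expect n (\<lambda>y. (coord k y)^2) {} y
     = expect n (\<lambda>z. ((coord k y)^2 + 2 * coord k y * coord k z) + (coord k z)^2) {} 0"
    by (subst expect_translate) (simp add: power2_sum algebra_simps)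
  then show ?thesis
    using expect_linear[of "\<lambda>u. 2 * coord k y * u" n "\<lambda>z. coord k z" "{}" 0]
    by (simp add: expect_add expect_const mean_k_def square_k_def linear_times)
qed

lemma mean_k_renewal: "mean_k 0 = 0" "mean_k (Suc n) = mean_k n + (\<Sum>l\<le>n. drift_term l)"
proof -
  show "mean_k 0 = 0" by (simp add: mean_k_def)
  have "mean_k (Suc n) = (\<Sum>l\<le>n. renewal l (\<lambda>y. coord k y + mean_k (n - l)))"
    unfolding mean_k_def[of "Suc n"] renewal_equation by (simp add: expect_coordinate_from[abs_def])
  also have "\<dots> = (\<Sum>l\<le>n. drift_term l + (if l = 0 then mean_k n else 0))"
    by (intro sum.cong) (auto simp: renewal_add renewal_const drift_term_def)
  finally show "mean_k (Suc n) = mean_k n + (\<Sum>l\<le>n. drift_term l)"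
    by (simp add: sum.distrib)
qed

lemma square_k_renewal: "square_k 0 = 0"
  "square_k (Suc n) = square_k n + (\<Sum>l\<le>n. square_term l + 2 * drift_term l * mean_k (n - l))"
proof -
  show "square_k 0 = 0" by (simp add: square_k_def)
  have "square_k (Suc n) = (\<Sum>l\<le>n. renewal l (\<lambda>y. (coord k y)^2 + 2 * coord k y * mean_k (n - l) + square_k (n - l)))"
    unfolding square_k_def[of "Suc n"] renewal_equation by (simp add: expect_square_from[abs_def])
  also have "\<dots> = (\<Sum>l\<le>n. square_term l + 2 * drift_term l * mean_k (n - l) + (if l = 0 then square_k n else 0))"
  proof (intro sum.cong refl)
    fix l
    have "renewal l (\<lambda>y. 2 * coord k y * mean_k (n - l)) = 2 * drift_term l * mean_k (n - l)"
      using renewal_linear[OF linear_times[of "2 * mean_k (n - l)"], of l "\<lambda>y. coord k y"]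
      by (simp add: drift_term_def mult_ac)
    then show "renewal l (\<lambda>y. (coord k y)^2 + 2 * coord k y * mean_k (n - l) + square_k (n - l))
        = square_term l + 2 * drift_term l * mean_k (n - l) + (if l = 0 then square_k n else 0)"
      by (auto simp: renewal_add renewal_const square_term_def)
  qed
  finally show "square_k (Suc n) = square_k n + (\<Sum>l\<le>n. square_term l + 2 * drift_term l * mean_k (n - l))"
    by (simp add: sum.distrib)
qed

definition speed :: real where "speed = suminf drift_term"

text \<open>The limit of the variance of coordinate \<open>k\<close> per step, as produced by \<open>renewal_variance\<close>.\<close>

definition variance_k :: real where
  "variance_k = suminf square_term - 2 * speed * (\<Sum>l. real l * drift_term l) - speed^2"

lemma mean_k_asymptotic: "\<bar>mean_k n - real n * speed\<bar> \<le> 128"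
  using renewal_mean(2)[of drift_term 32 mean_k n] drift_term_bound mean_k_renewal
  by (simp add: speed_def)

lemma variance_k_asymptotic:
  "\<exists>B. \<forall>n\<ge>1. \<bar>square_k n - (mean_k n)^2 - real n * variance_k\<bar> \<le> B * (1 + ln (real n))"
  using renewal_variance[of drift_term 32 square_term mean_k square_k]
    drift_term_bound square_term_bound mean_k_renewal square_k_renewal
  by (simp add: variance_k_def speed_def)

lemma expect_coordinate:
  assumes "i \<noteq> k"
  shows "expect n (\<lambda>y. coord i y) V x = coord i x"
proof (induction n arbitrary: V x)
  case (Suc n)
  have "expect n (\<lambda>y. coord i y) (insert x V) = (\<lambda>y. coord i y)"
    by (rule ext) (rule Suc)
  then show ?case using assms by (simp add: expect_Suc step_avg_coordinate)
qed simp

lemma expect_square: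
  assumes "i \<noteq> k"
  shows "expect n (\<lambda>y. (coord i y)^2) V x = (coord i x)^2 + real n / real CARD('n)"
proof (induction n arbitrary: V x)
  case (Suc n)
  have "expect n (\<lambda>y. (coord i y)^2) (insert x V) = (\<lambda>y. (coord i y)^2 + real n / real CARD('n))"
    by (rule ext) (rule Suc)
  moreover have "step_avg k b (\<lambda>y. (coord i y)^2 + c) x = step_avg k b (\<lambda>y. (coord i y)^2) x + c" for b c
    using step_avg_diff[of k b "\<lambda>y. (coord i y)^2" "\<lambda>_. - c" x] by (simp add: step_avg_const)
  ultimately show ?case using assms by (simp add: expect_Suc step_avg_square add_divide_distrib)
qed simp

lemma reflect_product:
  assumes "i \<noteq> j"
  shows "real_of_int (reflect i y $ i) * real_of_int (reflect i y $ j) = - (coord i y * coord j y)"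
  using assms by (simp add: reflect_def)

text \<open>A reflection in one of the two coordinates, chosen different from \<open>k\<close>, changes the sign.\<close>

lemma expect_product:
  assumes "i \<noteq> j"
  shows "expect n (\<lambda>y. coord i y * coord j y) {} 0 = 0"
proof -
  have 1: "expect n (\<lambda>y. coord i y * coord j y) {} 0 = 0" if "i \<noteq> j" "i \<noteq> k" for i j
  proof -
    have "reflect i 0 = (0 :: int ^ 'n)" by (simp add: reflect_def vec_eq_iff)
    then have "expect n (\<lambda>y. real_of_int (reflect i y $ i) * real_of_int (reflect i y $ j)) {} 0
      = expect n (\<lambda>y. coord i y * coord j y) {} 0"
      using expect_symmetry[OF symmetry_reflect[OF \<open>i \<noteq> k\<close>], of n "\<lambda>y. coord i y * coord j y" "{}" 0] by simp
    then show ?thesis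
      using expect_linear[of uminus n "\<lambda>y. coord i y * coord j y" "{}" 0]
      unfolding reflect_product[OF \<open>i \<noteq> j\<close>] by (simp add: linear_uminus)
  qed
  show ?thesis
    using 1[of i j] 1[of j i] assms by (cases "i = k") (auto simp: mult.commute)
qed

lemma renewal_product:
  assumes "i \<noteq> j"
  shows "renewal l (\<lambda>y. coord i y * coord j y) = 0"
proof -
  have 1: "renewal l (\<lambda>y. coord i y * coord j y) = 0" if "i \<noteq> j" "i \<noteq> k" for i j
    using renewal_reflect[OF \<open>i \<noteq> k\<close>, of l "\<lambda>y. coord i y * coord j y"]
      renewal_linear[of uminus l "\<lambda>y. coord i y * coord j y"]
    unfolding reflect_product[OF \<open>i \<noteq> j\<close>] by (simp add: linear_uminus)
  show ?thesis
    using 1[of i j] 1[of j i] assms by (cases "i = k") (auto simp: mult.commute)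
qed

lemma renewal_coordinate: "renewal l (\<lambda>y. coord i y) = (if i = k then drift_term l else 0)"
proof (cases "i = k \<or> l = 0")
  case True
  then show ?thesis by (auto simp: drift_term_def renewal_0 step_avg_coordinate)
next
  case False
  then have "norm (renewal l (\<lambda>y. coord i y)) \<le> 8 * 0 / (real l + 1)^3"
    by (intro norm_renewal_le) (auto simp: axis_nth)
  then show ?thesis using False by simp
qed

lemma renewal_square:
  "renewal l (\<lambda>y. (coord i y)^2) = (if i = k then square_term l else if l = 0 then 1 / real CARD('n) else 0)"
proof (cases "i = k \<or> l = 0")
  case True
  then show ?thesis by (auto simp: square_term_def renewal_0 step_avg_square)
next
  case False
  then have "norm (renewal l (\<lambda>y. (coord i y)^2)) \<le> 8 * 0 / (real l + 1)^3"
    by (intro norm_renewal_le) (auto simp: axis_nth)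
  then show ?thesis using False by simp
qed

end

section \<open>The characteristic function of the walk\<close>

definition exp_remainder :: "real \<Rightarrow> complex" where
  "exp_remainder u = iexp u - 1 - \<i> * u + u^2 / 2"

lemma iexp_lipschitz: "norm (iexp a - iexp b) \<le> \<bar>a - b\<bar>"
proof -
  have "iexp a - iexp b = iexp b * (iexp (a - b) - 1)"
    by (simp add: algebra_simps exp_add[symmetric])
  also have "norm \<dots> \<le> \<bar>a - b\<bar>"
    using iexp_approx1[of "a - b" 0] by (simp add: norm_mult)
  finally show ?thesis .
qed

text \<open>The derivative of the remainder is at most \<open>min (u\<^sup>2/2) (2\<bar>u\<bar>)\<close>, hence at most the geometric mean
\<open>\<bar>u\<bar>\<^sup>3\<^sup>/\<^sup>2\<close>. The quadratic bound alone would lead to a divergent sum against the kernel, since the phase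
grows linearly in \<open>l\<close>, and the linear one would not beat the order of the main term.\<close>

lemma exp_remainder_diff:
  assumes "\<bar>a\<bar> \<le> B" "\<bar>b\<bar> \<le> B"
  shows "norm (exp_remainder a - exp_remainder b) \<le> B * sqrt B * \<bar>a - b\<bar>"
proof -
  define g where "g u = \<i> * (iexp u - 1 - \<i> * u)" for u :: real
  have B: "B \<ge> 0" using assms by linarith
  have gb: "norm (g u) \<le> B * sqrt B" if "\<bar>u\<bar> \<le> B" for u
  proof -
    have 1: "norm (g u) \<le> u^2 / 2"
      using iexp_approx1[of u 1] by (simp add: g_def norm_mult diff_diff_eq power2_eq_square)
    have 2: "norm (g u) \<le> 2 * \<bar>u\<bar>"
      using iexp_approx2[of u 1] by (simp add: g_def norm_mult diff_diff_eq)
    have "(norm (g u))^2 \<le> (u^2 / 2) * (2 * \<bar>u\<bar>)"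
      unfolding power2_eq_square[of "norm (g u)"] by (intro mult_mono 1 2) auto
    also have "\<dots> = \<bar>u\<bar>^3" by (simp add: power_numeral_reduce power2_eq_square)
    also have "\<dots> \<le> B^3" using that by (intro power_mono) auto
    also have "\<dots> = (B * sqrt B)^2" using B by (simp add: power_mult_distrib power_numeral_reduce)
    finally show ?thesis by (rule power2_le_imp_le) (use B in simp)
  qed
  have "norm (exp_remainder a - exp_remainder b) \<le> B * sqrt B * norm (a - b)"
  proof (rule differentiable_bound[where S="{-B..B}" and f'="\<lambda>u h. h *\<^sub>R g u"])
    fix u assume u: "u \<in> {-B..B}"
    have "(exp_remainder has_vector_derivative g u) (at u within {-B..B})"
      unfolding exp_remainder_def[abs_def] g_def
      by (auto intro!: derivative_eq_intros has_vector_derivative_of_real simp: algebra_simps power2_eq_square)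
    then show "(exp_remainder has_derivative (\<lambda>h. h *\<^sub>R g u)) (at u within {-B..B})"
      by (simp add: has_vector_derivative_def)
    show "onorm (\<lambda>h. h *\<^sub>R g u) \<le> B * sqrt B"
    proof (rule onorm_le)
      fix h
      show "norm (h *\<^sub>R g u) \<le> B * sqrt B * norm h"
        using mult_left_mono[OF gb[of u], of "\<bar>h\<bar>"] u by (simp add: mult.commute abs_le_iff)
    qed
  qed (use assms in auto)
  then show ?thesis by simp
qed

lemma norm_exp_remainder:
  assumes "\<bar>u\<bar> \<le> B" shows "norm (exp_remainder u) \<le> B^2 * sqrt B"
proof -
  have "B \<ge> 0" using assms by linarith
  have "norm (exp_remainder u - exp_remainder 0) \<le> B * sqrt B * \<bar>u - 0\<bar>"
    using assms by (intro exp_remainder_diff) auto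
  also have "\<dots> \<le> B * sqrt B * B" using assms \<open>B \<ge> 0\<close> by (intro mult_left_mono) auto
  finally show ?thesis by (simp add: exp_remainder_def power2_eq_square mult_ac)
qed

text \<open>The power \<open>(l + 1)\<^sup>-\<^sup>3\<^sup>/\<^sup>2\<close>.\<close>

definition sesqui :: "nat \<Rightarrow> real" where
  "sesqui l = 1 / ((real l + 1) * sqrt (real l + 1))"

lemma summable_sesqui: "summable sesqui"
proof -
  have "summable (\<lambda>n. real n powr (- 3 / 2))"
    by (simp only: summable_real_powr_iff)
  then have "summable (\<lambda>n. real (Suc n) powr (- 3 / 2))"
    by (subst summable_Suc_iff)
  moreover have "real (Suc n) powr (- 3 / 2) = sesqui n" for n
  proof -
    have "real (Suc n) powr (- 3 / 2) = 1 / real (Suc n) powr (1 + 1 / 2)"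
      by (subst powr_minus_divide[symmetric]) simp
    also have "real (Suc n) powr (1 + 1 / 2) = real (Suc n) * sqrt (real (Suc n))"
      by (simp only: powr_add powr_half_sqrt) simp
    finally show ?thesis by (simp add: sesqui_def add.commute)
  qed
  ultimately show ?thesis by simp
qed

lemma sesqui_nonneg: "0 \<le> sesqui l" by (simp add: sesqui_def)

lemma inner_near_bound:
  fixes y :: "int ^ 'n::finite"
  assumes "near m 0 y"
  shows "\<bar>s \<bullet> real_vec y\<bar> \<le> norm s * (real CARD('n) * real m)"
proof -
  have "\<bar>s \<bullet> real_vec y\<bar> \<le> norm s * norm (real_vec y)" by (rule Cauchy_Schwarz_ineq2)
  also have "norm (real_vec y) \<le> (\<Sum>i\<in>UNIV. \<bar>real_vec y $ i\<bar>)" by (rule norm_le_l1_cart)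
  also have "\<dots> \<le> (\<Sum>i\<in>(UNIV::'n set). real m)"
  proof (intro sum_mono)
    fix i show "\<bar>real_vec y $ i\<bar> \<le> real m"
      using assms[unfolded near_def, rule_format, of i] by simp
  qed
  finally show ?thesis by (simp add: mult_left_mono)
qed

context weakly_excited_walk
begin

text \<open>The frequency \<open>s\<close> paired with the displacement after \<open>l\<close> steps relative to the limiting velocity. After
centring, the first order terms of the kernel cancel.\<close>

definition phase :: "real ^ 'n \<Rightarrow> nat \<Rightarrow> int ^ 'n \<Rightarrow> real" where
  "phase s l y = s \<bullet> real_vec y - real l * speed * s $ k"

definition char_walk :: "real ^ 'n \<Rightarrow> nat \<Rightarrow> complex" where
  "char_walk s n = expect n (\<lambda>y. iexp (phase s n y)) {} 0"

definition char_term :: "real ^ 'n \<Rightarrow> nat \<Rightarrow> complex" where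
  "char_term s l = renewal l (\<lambda>y. iexp (phase s (Suc l) y))"

lemma norm_char_walk_le: "norm (char_walk s n) \<le> 1"
  unfolding char_walk_def by (rule norm_expect_le) auto

lemma char_walk_renewal: "char_walk s 0 = 1"
  "char_walk s (Suc n) = (\<Sum>l\<le>n. char_term s l * char_walk s (n - l))"
proof -
  show "char_walk s 0 = 1" by (simp add: char_walk_def phase_def)
  have "expect (n - l) (\<lambda>y. iexp (phase s (Suc n) y)) {} y = char_walk s (n - l) * iexp (phase s (Suc l) y)"
    if "l \<le> n" for l y
  proof -
    have "phase s (Suc n) (y + z) = phase s (Suc l) y + phase s (n - l) z" for z
      using that by (simp add: phase_def real_vec_add inner_add_right of_nat_diff algebra_simps)
    then have "expect (n - l) (\<lambda>y. iexp (phase s (Suc n) y)) {} y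
      = expect (n - l) (\<lambda>z. iexp (phase s (Suc l) y) * iexp (phase s (n - l) z)) {} 0"
      by (subst expect_translate) (simp add: distrib_left exp_add)
    then show ?thesis
      using expect_linear[OF linear_times[of "iexp (phase s (Suc l) y)"], of "n - l" "\<lambda>z. iexp (phase s (n - l) z)" "{}" 0]
      by (simp add: char_walk_def mult.commute)
  qed
  then have "char_walk s (Suc n) = (\<Sum>l\<le>n. renewal l (\<lambda>y. char_walk s (n - l) * iexp (phase s (Suc l) y)))"
    unfolding char_walk_def[of s "Suc n"] renewal_equation
    by (intro sum.cong refl arg_cong[where f="renewal _"] ext) auto
  also have "\<dots> = (\<Sum>l\<le>n. char_term s l * char_walk s (n - l))"
    by (intro sum.cong refl)
      (simp add: renewal_linear[OF linear_times] char_term_def mult.commute)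
  finally show "char_walk s (Suc n) = (\<Sum>l\<le>n. char_term s l * char_walk s (n - l))" .
qed

lemma phase_axis: "phase s l (y + axis k (-1)) - phase s l (y + axis k 1) = - 2 * s $ k"
proof -
  have "s \<bullet> real_vec (axis k a) = real_of_int a * s $ k" for a
  proof -
    have "real_vec (axis k a :: int ^ 'n) = axis k (real_of_int a)"
      by (auto simp: vec_eq_iff axis_def)
    then show ?thesis by (simp add: inner_axis)
  qed
  then show ?thesis by (simp add: phase_def real_vec_add inner_add_right)
qed

lemma norm_char_term_le:
  assumes "l \<ge> 1"
  shows "norm (char_term s l) \<le> 16 * norm s / (real l + 1)^3"
proof -
  have "norm (char_term s l) \<le> 8 * (2 * norm s) / (real l + 1)^3"
    unfolding char_term_def
  proof (rule norm_renewal_le[OF assms])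
    fix y
    have "norm (iexp (phase s (Suc l) (y + axis k (-1))) - iexp (phase s (Suc l) (y + axis k 1)))
        \<le> \<bar>phase s (Suc l) (y + axis k (-1)) - phase s (Suc l) (y + axis k 1)\<bar>"
      by (rule iexp_lipschitz)
    also have "\<dots> \<le> 2 * norm s" unfolding phase_axis using component_le_norm_cart[of s k] by simp
    finally show "norm (iexp (phase s (Suc l) (y + axis k (-1))) - iexp (phase s (Suc l) (y + axis k 1))) \<le> 2 * norm s" .
  qed simp
  then show ?thesis by simp
qed

definition cov :: "'n \<Rightarrow> real" where
  "cov i = (if i = k then variance_k else 1 / real CARD('n))"

definition quad :: "real ^ 'n \<Rightarrow> real" where
  "quad s = (\<Sum>i\<in>UNIV. cov i * (s $ i)^2)"

lemma renewal_inner: "renewal l (\<lambda>y. s \<bullet> real_vec y) = s $ k * drift_term l"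
proof -
  have "renewal l (\<lambda>y. s \<bullet> real_vec y) = (\<Sum>i\<in>UNIV. renewal l (\<lambda>y. s $ i * coord i y))"
    by (simp add: inner_vec_def renewal_sum)
  also have "\<dots> = (\<Sum>i\<in>UNIV. if i = k then s $ k * drift_term l else 0)"
    by (intro sum.cong) (auto simp: renewal_linear[OF linear_times] renewal_coordinate)
  finally show ?thesis by simp
qed

lemma renewal_inner_square:
  "renewal l (\<lambda>y. (s \<bullet> real_vec y)^2)
    = (s $ k)^2 * square_term l + (if l = 0 then (\<Sum>i\<in>UNIV - {k}. (s $ i)^2) / real CARD('n) else 0)"
proof -
  have "renewal l (\<lambda>y. (s \<bullet> real_vec y)^2)
     = (\<Sum>i\<in>UNIV. \<Sum>j\<in>UNIV. renewal l (\<lambda>y. (s $ i * s $ j) * (coord i y * coord j y)))"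
    by (simp add: inner_vec_def power2_eq_square sum_product renewal_sum mult_ac)
  also have "\<dots> = (\<Sum>i\<in>UNIV. \<Sum>j\<in>UNIV. if j = i then (s $ i)^2 * renewal l (\<lambda>y. (coord i y)^2) else 0)"
    by (intro sum.cong) (auto simp: renewal_linear[OF linear_times] renewal_product power2_eq_square)
  also have "\<dots> = (\<Sum>i\<in>UNIV. (s $ i)^2 * renewal l (\<lambda>y. (coord i y)^2))" by simp
  also have "\<dots> = (s $ k)^2 * renewal l (\<lambda>y. (coord k y)^2)
      + (\<Sum>i\<in>UNIV - {k}. (s $ i)^2 * renewal l (\<lambda>y. (coord i y)^2))"
    by (rule sum.remove) auto
  also have "(\<Sum>i\<in>UNIV - {k}. (s $ i)^2 * renewal l (\<lambda>y. (coord i y)^2))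
      = (\<Sum>i\<in>UNIV - {k}. if l = 0 then (s $ i)^2 / real CARD('n) else 0)"
    by (intro sum.cong) (auto simp: renewal_square)
  finally show ?thesis by (simp add: renewal_square sum_divide_distrib)
qed

lemma summable_drift_terms: "summable drift_term" "summable (\<lambda>l. real l * drift_term l)" "summable square_term"
proof -
  show "summable drift_term" by (rule cube_tail(1)[of 0 _ 32]) (use drift_term_bound in auto)
  show "summable square_term" by (rule square_tail(1)[of 0 _ 32]) (use square_term_bound in auto)
  have "norm (real l * drift_term l) \<le> 32 / (real l + 1)^2" for l
  proof -
    have "norm (real l * drift_term l) \<le> 32 / (real l + 1)^3 * real l"
      using mult_right_mono[OF drift_term_bound[of l], of "real l"] by (simp add: abs_mult mult.commute)
    also have "\<dots> \<le> 32 / (real l + 1)^2" by (rule cube_times_index) simp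
    finally show ?thesis .
  qed
  then show "summable (\<lambda>l. real l * drift_term l)" by (intro square_tail(1)[of 0 _ 32]) auto
qed

lemma renewal_phase: "renewal l (\<lambda>y. phase s (Suc l) y) = s $ k * drift_term l - (if l = 0 then speed * s $ k else 0)"
  using renewal_add[of l "\<lambda>y. s \<bullet> real_vec y" "\<lambda>_. - (real (Suc l) * speed * s $ k)"]
  by (simp add: phase_def renewal_inner renewal_const)

text \<open>The speed is the sum of the drift terms, so the centred phase has no first order contribution.\<close>

lemma renewal_phase_sums: "(\<lambda>l. renewal l (\<lambda>y. phase s (Suc l) y)) sums 0"
proof -
  have "(\<lambda>l. s $ k * drift_term l - (if l = 0 then speed * s $ k else 0)) sums (s $ k * speed - speed * s $ k)"
    unfolding speed_def
    by (intro sums_diff sums_mult summable_sums summable_drift_terms sums_single[of 0 "\<lambda>_. suminf drift_term * s $ k"])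
  then show ?thesis by (simp add: renewal_phase)
qed

lemma renewal_phase_square:
  "renewal l (\<lambda>y. (phase s (Suc l) y)^2)
    = (s $ k)^2 * (square_term l - 2 * speed * (real l * drift_term l) - 2 * speed * drift_term l)
      + (if l = 0 then (\<Sum>i\<in>UNIV - {k}. (s $ i)^2) / real CARD('n) + speed^2 * (s $ k)^2 else 0)"
proof -
  define c where "c = real (Suc l) * speed * s $ k"
  have "(\<lambda>y. (phase s (Suc l) y)^2) = (\<lambda>y. ((s \<bullet> real_vec y)^2 + (- 2 * c) * (s \<bullet> real_vec y)) + c^2)"
    by (rule ext) (simp add: phase_def c_def power2_eq_square algebra_simps)
  then have "renewal l (\<lambda>y. (phase s (Suc l) y)^2)
      = renewal l (\<lambda>y. (s \<bullet> real_vec y)^2) - 2 * c * (s $ k * drift_term l) + (if l = 0 then c^2 else 0)"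
    by (simp only: renewal_add renewal_const renewal_linear[OF linear_times] renewal_inner)
  then show ?thesis
    unfolding renewal_inner_square by (simp add: c_def power2_eq_square algebra_simps)
qed

text \<open>The second order terms of the kernel add up to the quadratic form of the variances found from the
moment recursion.\<close>

lemma renewal_phase_square_sums: "(\<lambda>l. renewal l (\<lambda>y. (phase s (Suc l) y)^2)) sums quad s"
proof -
  have "(\<lambda>l. (s $ k)^2 * (square_term l - 2 * speed * (real l * drift_term l) - 2 * speed * drift_term l)
      + (if l = 0 then (\<Sum>i\<in>UNIV - {k}. (s $ i)^2) / real CARD('n) + speed^2 * (s $ k)^2 else 0))
    sums ((s $ k)^2 * (suminf square_term - 2 * speed * (\<Sum>l. real l * drift_term l) - 2 * speed * suminf drift_term)
      + ((\<Sum>i\<in>UNIV - {k}. (s $ i)^2) / real CARD('n) + speed^2 * (s $ k)^2))"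
    by (intro sums_add sums_diff sums_mult summable_sums summable_drift_terms
        sums_single[of 0 "\<lambda>_. (\<Sum>i\<in>UNIV - {k}. (s $ i)^2) / real CARD('n) + speed^2 * (s $ k)^2"])
  moreover have "quad s = (s $ k)^2 * (suminf square_term - 2 * speed * (\<Sum>l. real l * drift_term l) - 2 * speed * suminf drift_term)
      + ((\<Sum>i\<in>UNIV - {k}. (s $ i)^2) / real CARD('n) + speed^2 * (s $ k)^2)"
  proof -
    have "quad s = cov k * (s $ k)^2 + (\<Sum>i\<in>UNIV - {k}. cov i * (s $ i)^2)"
      unfolding quad_def by (rule sum.remove) auto
    also have "(\<Sum>i\<in>UNIV - {k}. cov i * (s $ i)^2) = (\<Sum>i\<in>UNIV - {k}. (s $ i)^2 / real CARD('n))"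
      by (intro sum.cong) (auto simp: cov_def)
    finally show ?thesis
      by (simp add: cov_def variance_k_def speed_def[symmetric] sum_divide_distrib power2_eq_square algebra_simps)
  qed
  ultimately show ?thesis by (simp add: renewal_phase_square)
qed

lemma char_term_expansion:
  "char_term s l = (if l = 0 then 1 else 0) + \<i> * complex_of_real (renewal l (\<lambda>y. phase s (Suc l) y))
     - complex_of_real (renewal l (\<lambda>y. (phase s (Suc l) y)^2)) / 2
     + renewal l (\<lambda>y. exp_remainder (phase s (Suc l) y))"
proof -
  have lin: "linear (\<lambda>u. \<i> * complex_of_real u)" "linear (\<lambda>u. - complex_of_real u / 2)"
    by (simp_all add: linear_iff algebra_simps scaleR_conv_of_real)
  have "(\<lambda>y. iexp (phase s (Suc l) y)) = (\<lambda>y. ((1 + \<i> * complex_of_real (phase s (Suc l) y))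
      + (- complex_of_real ((phase s (Suc l) y)^2) / 2)) + exp_remainder (phase s (Suc l) y))"
    by (rule ext) (simp add: exp_remainder_def)
  then show ?thesis
    unfolding char_term_def
    by (simp only: renewal_add renewal_const renewal_linear[OF lin(1)] renewal_linear[OF lin(2)]) simp
qed

lemma norm_phase_le:
  assumes "near (Suc l) 0 y"
  shows "\<bar>phase s (Suc l) y\<bar> \<le> norm s * (real l + 1) * (real CARD('n) + \<bar>speed\<bar>)"
proof -
  have "\<bar>s $ k\<bar> \<le> norm s" by (rule component_le_norm_cart)
  then have "\<bar>real (Suc l) * speed * s $ k\<bar> \<le> (real l + 1) * \<bar>speed\<bar> * norm s"
    unfolding abs_mult by (intro mult_mono) auto
  moreover have "\<bar>s \<bullet> real_vec y\<bar> \<le> norm s * (real CARD('n) * real (Suc l))"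
    using assms by (rule inner_near_bound)
  ultimately have "\<bar>phase s (Suc l) y\<bar> \<le> norm s * (real CARD('n) * real (Suc l)) + (real l + 1) * \<bar>speed\<bar> * norm s"
    unfolding phase_def by linarith
  then show ?thesis by (simp add: algebra_simps)
qed

definition rem_const :: real where
  "rem_const = 16 * (real CARD('n) + \<bar>speed\<bar>)^2 * sqrt (real CARD('n) + \<bar>speed\<bar>)"

text \<open>The phase is of size \<open>\<parallel>s\<parallel> (l + 1)\<close> where the kernel sees it, so the remainder has derivative of order
\<open>(\<parallel>s\<parallel> (l + 1))\<^sup>3\<^sup>/\<^sup>2 \<parallel>s\<parallel>\<close>; the cubic decay of the kernel leaves a summable \<open>(l + 1)\<^sup>-\<^sup>3\<^sup>/\<^sup>2\<close>.\<close>

lemma norm_renewal_remainder_le: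
  "norm (renewal l (\<lambda>y. exp_remainder (phase s (Suc l) y))) \<le> rem_const * ((norm s)^2 * sqrt (norm s)) * sesqui l"
proof -
  define E where "E = real CARD('n) + \<bar>speed\<bar>"
  define \<sigma> where "\<sigma> = norm s"
  have E: "E \<ge> 1" unfolding E_def using dim by simp
  have \<sigma>: "\<sigma> \<ge> 0" by (simp add: \<sigma>_def)
  have C: "rem_const = 16 * E^2 * sqrt E" by (simp add: rem_const_def E_def)
  show ?thesis
  proof (cases "l = 0")
    case True
    have "norm (renewal 0 (\<lambda>y. exp_remainder (phase s (Suc 0) y))) \<le> step_avg k \<beta> (\<lambda>_. (\<sigma> * E)^2 * sqrt (\<sigma> * E)) 0"
      unfolding renewal_0
    proof (rule norm_step_avg_le[OF \<beta>])
      fix e :: "int ^ 'n" assume "e \<in> unit_vectors"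
      then have "near (Suc 0) 0 (0 + e)" using near_step[of e 0] by simp
      then have "\<bar>phase s (Suc 0) (0 + e)\<bar> \<le> \<sigma> * E"
        using norm_phase_le[of 0 "0 + e" s] by (simp add: \<sigma>_def E_def)
      then show "norm (exp_remainder (phase s (Suc 0) (0 + e))) \<le> (\<sigma> * E)^2 * sqrt (\<sigma> * E)"
        by (rule norm_exp_remainder)
    qed
    also have "\<dots> = 1 * (E^2 * sqrt E * (\<sigma>^2 * sqrt \<sigma>))"
      by (simp add: step_avg_const power_mult_distrib real_sqrt_mult mult_ac)
    also have "\<dots> \<le> 16 * (E^2 * sqrt E * (\<sigma>^2 * sqrt \<sigma>))"
      using \<sigma> E by (intro mult_right_mono) auto
    finally show ?thesis using True by (simp add: sesqui_def C \<sigma>_def mult_ac)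
  next
    case False
    define B where "B = \<sigma> * (real l + 1) * E"
    have B: "B \<ge> 0" using \<sigma> E by (simp add: B_def)
    have "norm (renewal l (\<lambda>y. exp_remainder (phase s (Suc l) y))) \<le> 8 * (B * sqrt B * (2 * \<sigma>)) / (real l + 1)^3"
    proof (rule norm_renewal_le)
      fix y :: "int ^ 'n" assume y: "near l 0 y"
      have b: "\<bar>phase s (Suc l) (y + e)\<bar> \<le> B" if "e = axis k 1 \<or> e = axis k (-1)" for e
      proof -
        have "e \<in> unit_vectors" using that unfolding unit_steps by auto
        then have "near (Suc l) 0 (y + e)" using near_trans[OF y near_step[of e y]] by auto
        then show ?thesis using norm_phase_le[of l "y + e" s] by (simp add: B_def \<sigma>_def E_def)
      qed
      have "norm (exp_remainder (phase s (Suc l) (y + axis k (-1))) - exp_remainder (phase s (Suc l) (y + axis k 1)))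
         \<le> B * sqrt B * \<bar>phase s (Suc l) (y + axis k (-1)) - phase s (Suc l) (y + axis k 1)\<bar>"
        by (intro exp_remainder_diff b) auto
      also have "\<dots> \<le> B * sqrt B * (2 * \<sigma>)"
        unfolding phase_axis using component_le_norm_cart[of s k] B by (intro mult_left_mono) (auto simp: \<sigma>_def)
      finally show "norm (exp_remainder (phase s (Suc l) (y + axis k (-1))) - exp_remainder (phase s (Suc l) (y + axis k 1))) \<le> B * sqrt B * (2 * \<sigma>)" .
    qed (use False B \<sigma> in auto)
    also have "\<dots> = 16 * (E * sqrt E * (\<sigma>^2 * sqrt \<sigma>)) * (((real l + 1) * sqrt (real l + 1)) / (real l + 1)^3)"
      by (simp add: B_def real_sqrt_mult power2_eq_square mult_ac)
    also have "((real l + 1) * sqrt (real l + 1)) / (real l + 1)^3 = sesqui l"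
    proof -
      have "x * r / x^3 = 1 / (x * r)" if "x > 0" "r * r = x" for x r :: real
      proof -
        have "r \<noteq> 0" using that by auto
        have "x^3 = x * r * (x * r)" using that by (simp add: power_numeral_reduce mult_ac)
        then show ?thesis using that \<open>r \<noteq> 0\<close> by simp
      qed
      from this[of "real l + 1" "sqrt (real l + 1)"] show ?thesis by (simp add: sesqui_def)
    qed
    also have "16 * (E * sqrt E * (\<sigma>^2 * sqrt \<sigma>)) * sesqui l \<le> 16 * (E^2 * sqrt E * (\<sigma>^2 * sqrt \<sigma>)) * sesqui l"
      using E \<sigma> sesqui_nonneg[of l] by (intro mult_right_mono mult_left_mono) (auto simp: power2_eq_square)
    finally show ?thesis by (simp add: C \<sigma>_def mult_ac)
  qed
qed

lemma char_term_suminf: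
  "norm (suminf (char_term s) - 1 + complex_of_real (quad s) / 2)
     \<le> rem_const * suminf sesqui * ((norm s)^2 * sqrt (norm s))"
proof -
  define R where "R l = renewal l (\<lambda>y. exp_remainder (phase s (Suc l) y))" for l
  define c where "c = rem_const * ((norm s)^2 * sqrt (norm s))"
  have Rb: "norm (R l) \<le> c * sesqui l" for l
    unfolding R_def c_def by (rule norm_renewal_remainder_le)
  have sum: "summable (\<lambda>l. c * sesqui l)" by (intro summable_mult summable_sesqui)
  have R: "summable R" by (rule summable_comparison_test'[OF sum]) (use Rb in auto)
  have nR: "norm (suminf R) \<le> c * suminf sesqui"
    unfolding suminf_mult[OF summable_sesqui, symmetric]
    by (rule norm_suminf_le) (use Rb sum in auto)
  have 0: "(\<lambda>l. if l = 0 then 1 else 0) sums (1::complex)" using sums_single[of 0 "\<lambda>_. 1::complex"] by simp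
  have "char_term s sums (1 + \<i> * complex_of_real 0 - complex_of_real (quad s) / 2 + suminf R)"
    unfolding char_term_expansion[abs_def] R_def[symmetric]
    by (intro sums_add sums_diff sums_mult sums_divide sums_of_real 0 renewal_phase_sums renewal_phase_square_sums summable_sums R)
  then have "suminf (char_term s) - 1 + complex_of_real (quad s) / 2 = suminf R"
    by (simp add: sums_iff)
  then show ?thesis using nR by (simp add: c_def mult_ac)
qed

text \<open>At \<open>s = t/\<surd>N\<close> the sum of the kernel is \<open>1 - quad t / (2 N) + O(N\<^sup>-\<^sup>5\<^sup>/\<^sup>4)\<close>.\<close>

theorem char_walk_limit:
  "(\<lambda>N. char_walk (t /\<^sub>R sqrt (real N)) N) \<longlonglongrightarrow> exp (- complex_of_real (quad t) / 2)"
proof -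
  define s where "s N = t /\<^sub>R sqrt (real N)" for N
  define c where "c = norm t"
  define K where "K = rem_const * suminf sesqui"
  define Q where "Q = (\<Sum>i\<in>UNIV. \<bar>cov i\<bar>)"
  define C where "C = 16 + Q + K"
  have K: "K \<ge> 0" unfolding K_def rem_const_def
    by (intro mult_nonneg_nonneg suminf_nonneg summable_sesqui sesqui_nonneg) auto
  have Q: "Q \<ge> 0" by (simp add: Q_def sum_nonneg)
  have ns: "norm (s N) = c / sqrt (real N)" for N by (simp add: s_def c_def divide_inverse mult.commute)
  \<comment> \<open>From here on the frequency has norm at most \<open>1\<close>.\<close>
  define N0 where "N0 = Suc (nat \<lceil>c^2\<rceil>)"
  have small_s: "norm (s N) \<le> 1" if "N \<ge> N0" for N
  proof -
    have "c^2 \<le> real N" using that unfolding N0_def by linarith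
    then have "c \<le> sqrt (real N)" by (rule real_le_rsqrt)
    moreover have "real N > 0" using that by (simp add: N0_def)
    ultimately show ?thesis by (simp add: ns)
  qed
  have quad_bound: "\<bar>quad u\<bar> \<le> Q * (norm u)^2" for u
  proof -
    have "\<bar>quad u\<bar> \<le> (\<Sum>i\<in>UNIV. \<bar>cov i\<bar> * (norm u)^2)"
      unfolding quad_def
      by (rule order_trans[OF sum_abs sum_mono])
        (auto simp: abs_mult intro!: mult_left_mono power2_mono component_le_norm_cart abs_le_square_iff[THEN iffD1])
    then show ?thesis by (simp add: Q_def sum_distrib_right)
  qed
  have "(\<lambda>N. char_walk (s N) N) \<longlonglongrightarrow> exp (- complex_of_real (quad t) / 2)"
  proof (rule renewal_characteristic_limit[where c=c and C=C and m=N0 and \<psi>="\<lambda>N. char_term (s N)" and H="\<lambda>N. char_walk (s N)" and A="\<lambda>N. suminf (char_term (s N)) - 1"])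
    show "norm (char_term (s N) l) \<le> C * (c / sqrt (real N)) / (real l + 1)^3" if "l \<ge> 1" for N l
    proof -
      have "norm (char_term (s N) l) \<le> 16 * norm (s N) / (real l + 1)^3" by (rule norm_char_term_le[OF that])
      also have "\<dots> \<le> C * norm (s N) / (real l + 1)^3"
        using K Q by (intro divide_right_mono mult_right_mono) (auto simp: C_def)
      finally show ?thesis by (simp add: ns)
    qed
    show "norm (suminf (char_term (s N)) - 1) \<le> C * (c / sqrt (real N))^2" if "N \<ge> N0" for N
    proof -
      let ?r = "suminf (char_term (s N)) - 1 + complex_of_real (quad (s N)) / 2"
      have "norm (suminf (char_term (s N)) - 1)
          \<le> norm ?r + norm (complex_of_real (quad (s N)) / 2)"
        using norm_triangle_ineq4[of ?r "complex_of_real (quad (s N)) / 2"] by simp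
      also have "\<dots> \<le> K * ((norm (s N))^2 * sqrt (norm (s N))) + Q * (norm (s N))^2"
        using char_term_suminf[of "s N"] quad_bound[of "s N"] by (intro add_mono) (auto simp: K_def norm_divide)
      also have "\<dots> \<le> K * ((norm (s N))^2 * 1) + Q * (norm (s N))^2"
        using small_s[OF that] K by (intro add_right_mono mult_left_mono) auto
      also have "\<dots> \<le> C * (norm (s N))^2"
        unfolding C_def by (simp add: algebra_simps)
      finally show ?thesis by (simp add: ns)
    qed
    show "(\<lambda>N. of_nat N * (suminf (char_term (s N)) - 1)) \<longlonglongrightarrow> - complex_of_real (quad t) / 2"
    proof -
      have "(\<lambda>N. of_nat N * (suminf (char_term (s N)) - 1) - (- complex_of_real (quad t) / 2)) \<longlonglongrightarrow> 0"
      proof (rule Lim_null_comparison)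
        show "\<forall>\<^sub>F N in sequentially. norm (of_nat N * (suminf (char_term (s N)) - 1) - (- complex_of_real (quad t) / 2))
           \<le> K * (c^2 * sqrt c) * (1 / sqrt (sqrt (real N)))"
          using eventually_gt_at_top[of 0]
        proof eventually_elim
          case (elim N)
          have q: "real N * quad (s N) = quad t"
            using elim by (simp add: quad_def s_def sum_distrib_left power_mult_distrib power_inverse field_simps)
          have "of_nat N * (suminf (char_term (s N)) - 1) - (- complex_of_real (quad t) / 2)
             = of_nat N * (suminf (char_term (s N)) - 1 + complex_of_real (quad (s N)) / 2)"
            unfolding q[symmetric] by (simp add: algebra_simps)
          also have "norm \<dots> \<le> real N * (K * ((norm (s N))^2 * sqrt (norm (s N))))"
            using char_term_suminf[of "s N"] by (simp add: norm_mult K_def mult_left_mono)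
          also have "\<dots> = K * (c^2 * sqrt c) * (1 / sqrt (sqrt (real N)))"
            using elim by (simp add: ns power_divide real_sqrt_divide)
          finally show ?case .
        qed
        have "(\<lambda>N. 1 / sqrt (sqrt (real N))) \<longlonglongrightarrow> 0" by real_asymp
        then show "(\<lambda>N. K * (c^2 * sqrt c) * (1 / sqrt (sqrt (real N)))) \<longlonglongrightarrow> 0"
          by (rule tendsto_mult_right_zero)
      qed
      then show ?thesis by (rule LIM_zero_cancel)
    qed
  qed (use norm_char_walk_le char_walk_renewal K Q in \<open>auto simp: C_def c_def\<close>)
  then show ?thesis by (simp add: s_def)
qed

end

section \<open>Expectations under the law of the walk\<close>

lemma CI_eq_C:
  "erw.CI k \<beta> {0..<n} = erw.C k \<beta> 0 n (\<lambda>_. undefined)"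
proof (rule measure_eqI)
  let ?M = "\<lambda>_::nat. count_space (UNIV :: (int ^ 'a) set)"
  have u: "(\<lambda>_. undefined) \<in> space (Pi\<^sub>M {0..<0} ?M)" by (simp add: space_PiM)
  have s: "sets (erw.CI k \<beta> {0..<n}) = sets (Pi\<^sub>M {0..<n} ?M)"
    by (simp add: erw.CI_def)
  show "sets (erw.CI k \<beta> {0..<n}) = sets (erw.C k \<beta> 0 n (\<lambda>_. undefined))"
    using erw.sets_C[OF u, of k \<beta> n] s by simp
  fix X assume "X \<in> sets (erw.CI k \<beta> {0..<n})"
  then have X: "X \<in> sets (Pi\<^sub>M {0..<n} ?M)" using s by simp
  have "prod_emb {0..<n} ?M {0..<n} X = X"
    by (rule prod_emb_id) (use sets.sets_into_space[OF X] in \<open>simp add: space_PiM\<close>)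
  then show "emeasure (erw.CI k \<beta> {0..<n}) X = emeasure (erw.C k \<beta> 0 n (\<lambda>_. undefined)) X"
    using erw.emeasure_CI[OF order_refl X, of k \<beta>] by simp
qed

lemma measurable_history:
  "H \<in> borel_measurable (Pi\<^sub>M {0..<n::nat} (\<lambda>_. count_space (UNIV :: (int ^ 'n::finite) set)))"
  by (subst count_space_PiM_finite) auto

lemma measurable_restrict_erw:
  "(\<lambda>\<omega>. restrict \<omega> J) \<in> erw_law k \<beta> \<rightarrow>\<^sub>M Pi\<^sub>M J (\<lambda>_. count_space UNIV)"
  by (simp add: measurable_cong_sets[OF sets_erw_law refl] measurable_restrict)

lemma integral_history:
  fixes H :: "(nat \<Rightarrow> int ^ 'n::finite) \<Rightarrow> real"
  shows "(\<integral>\<omega>. H (restrict \<omega> {0..<n}) \<partial>erw_law k \<beta>) = (\<integral>h. H h \<partial>erw.C k \<beta> 0 n (\<lambda>_. undefined))"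
proof -
  let ?P = "Pi\<^sub>M {0..<n} (\<lambda>_. count_space (UNIV :: (int ^ 'n) set))"
  have "(\<integral>\<omega>. H (restrict \<omega> {0..<n}) \<partial>erw_law k \<beta>) = (\<integral>h. H h \<partial>distr (erw_law k \<beta>) ?P (\<lambda>\<omega>. restrict \<omega> {0..<n}))"
    by (rule integral_distr[symmetric]) (rule measurable_restrict_erw, rule measurable_history)
  then show ?thesis
    unfolding erw_law_def by (simp add: erw.distr_lim CI_eq_C)
qed

text \<open>The law of the first \<open>n + 1\<close> positions is the law of the first \<open>n\<close> composed with the kernel.\<close>

lemma integral_erw_kernel:
  fixes H :: "(nat \<Rightarrow> int ^ 'n::finite) \<Rightarrow> real"
  assumes B: "\<And>h. \<bar>H h\<bar> \<le> B"
  shows "(\<integral>\<omega>. H (restrict \<omega> {0..<Suc n}) \<partial>erw_law k \<beta>)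
    = (\<integral>\<omega>. (\<integral>y. H ((restrict \<omega> {0..<n})(n := y)) \<partial>measure_pmf (erw_kernel k \<beta> n (restrict \<omega> {0..<n}))) \<partial>erw_law k \<beta>)"
proof -
  let ?M = "\<lambda>_::nat. count_space (UNIV :: (int ^ 'n) set)"
  let ?C = "erw.C k \<beta> 0 n (\<lambda>_. undefined)"
  have u: "(\<lambda>_. undefined) \<in> space (Pi\<^sub>M {0..<0} ?M)" by (simp add: space_PiM)
  have spC: "space ?C = space (Pi\<^sub>M {0..<n} ?M)" and stC: "sets ?C = sets (Pi\<^sub>M {0..<n} ?M)"
    using erw.space_C[OF u, of k \<beta> n] erw.sets_C[OF u, of k \<beta> n] by auto
  have C: "prob_space ?C" by (rule erw.prob_space_C[OF u])
  have eP: "erw.eP k \<beta> n \<in> ?C \<rightarrow>\<^sub>M subprob_algebra (Pi\<^sub>M {0..<Suc n} ?M)"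
    using erw.measurable_eP[of k \<beta> n] by (simp add: measurable_cong_sets[OF stC refl])
  have "(\<integral>\<omega>. H (restrict \<omega> {0..<Suc n}) \<partial>erw_law k \<beta>) = (\<integral>h. H h \<partial>(?C \<bind> erw.eP k \<beta> n))"
    unfolding integral_history by simp
  also have "\<dots> = (\<integral>h. (\<integral>h'. H h' \<partial>erw.eP k \<beta> n h) \<partial>?C)"
  proof (rule integral_bind[OF measurable_history _ eP, where B=B and B'=1])
    show "finite_measure ?C" by (rule prob_space.finite_measure[OF C])
    show "AE x in ?C. emeasure (erw.eP k \<beta> n x) (space (erw.eP k \<beta> n x)) \<le> ennreal 1"
      by (rule AE_I2) (use spC in \<open>simp add: prob_space.emeasure_space_1[OF erw.prob_space_eP]\<close>)
  qed (use B in auto)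
  also have "\<dots> = (\<integral>h. (\<integral>y. H (h(n := y)) \<partial>measure_pmf (erw_kernel k \<beta> n h)) \<partial>?C)"
  proof (rule Bochner_Integration.integral_cong[OF refl])
    fix h assume "h \<in> space ?C"
    then have h: "h \<in> space (Pi\<^sub>M {0..<n} ?M)" by (simp add: spC)
    have "(\<lambda>y. h(n := y)) \<in> measure_pmf (erw_kernel k \<beta> n h) \<rightarrow>\<^sub>M Pi\<^sub>M {0..<Suc n} ?M"
      using h by (auto simp: space_PiM PiE_iff extensional_def)
    then show "(\<integral>h'. H h' \<partial>erw.eP k \<beta> n h) = (\<integral>y. H (h(n := y)) \<partial>measure_pmf (erw_kernel k \<beta> n h))"
      unfolding erw.eP_def by (rule integral_distr[OF _ measurable_history])
  qed
  also have "\<dots> = (\<integral>\<omega>. (\<integral>y. H ((restrict \<omega> {0..<n})(n := y)) \<partial>measure_pmf (erw_kernel k \<beta> n (restrict \<omega> {0..<n}))) \<partial>erw_law k \<beta>)"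
    by (rule integral_history[symmetric])
  finally show ?thesis .
qed

lemma finite_near: "finite {x :: int ^ 'n::finite. near m 0 x}"
proof (rule finite_subset)
  show "{x :: int ^ 'n. near m 0 x} \<subseteq> (\<lambda>f. \<chi> i. f i) ` (PiE UNIV (\<lambda>_. {- int m..int m}))"
  proof
    fix x :: "int ^ 'n" assume "x \<in> {x. near m 0 x}"
    then have "(\<lambda>i. x $ i) \<in> PiE UNIV (\<lambda>_. {- int m..int m})" by (auto simp: near_def abs_le_iff minus_le_iff)
    moreover have "x = (\<chi> i. x $ i)" by simp
    ultimately show "x \<in> (\<lambda>f. \<chi> i. f i) ` (PiE UNIV (\<lambda>_. {- int m..int m}))" by blast
  qed
qed (intro finite_imageI finite_PiE, auto)

context excited_walk
begin

abbreviation law :: "(nat \<Rightarrow> int ^ 'n) measure" where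
  "law \<equiv> erw_law k \<beta>"

lemma integral_step_pmf:
  fixes g :: "int ^ 'n \<Rightarrow> real"
  assumes "0 \<le> b" "b \<le> 1"
  shows "(\<integral>y. g y \<partial>measure_pmf (map_pmf (\<lambda>e. x + e) (step_pmf k b))) = step_avg k b g x"
proof -
  have "(\<integral>e. g (x + e) \<partial>measure_pmf (step_pmf k b)) = (\<Sum>e\<in>unit_vectors. pmf (step_pmf k b) e *\<^sub>R g (x + e))"
  proof (rule integral_measure_pmf)
    fix e assume "e \<in> set_pmf (step_pmf k b)"
    then have "step_prob k b e \<noteq> 0" by (simp add: set_pmf_iff pmf_step_pmf assms)
    then show "e \<in> unit_vectors" by (auto simp: step_prob_def indicator_def split: if_splits)
  qed simp
  then show ?thesis by (simp add: step_avg_def pmf_step_pmf assms)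
qed

text \<open>The pair of visited set and position is a Markov chain, and the operator \<open>move {}\<close> is its transition.\<close>

lemma integral_erw_state:
  fixes G :: "(int ^ 'n) set \<Rightarrow> int ^ 'n \<Rightarrow> real"
  assumes "\<And>V x. \<bar>G V x\<bar> \<le> B"
  shows "(\<integral>\<omega>. G (\<omega> ` {..<n}) (\<omega> n) \<partial>law) = (move {} ^^ n) G {} 0"
  using assms
proof (induction n arbitrary: G)
  case 0
  interpret prob_space law by (rule prob_space_erw_law)
  have "(\<integral>\<omega>. (\<lambda>h. G {} (h 0)) (restrict \<omega> {0..<Suc 0}) \<partial>law)
      = (\<integral>\<omega>. (\<integral>y. (\<lambda>h. G {} (h 0)) ((restrict \<omega> {0..<0})(0 := y)) \<partial>measure_pmf (erw_kernel k \<beta> 0 (restrict \<omega> {0..<0}))) \<partial>law)"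
    by (rule integral_erw_kernel) (rule 0)
  then show ?case by (simp add: prob_space)
next
  case (Suc n)
  have bounded: "\<bar>move {} G V x\<bar> \<le> B" for V x
  proof -
    have "norm (move {} G V x) \<le> step_avg k (if x \<in> {} \<union> V then 0 else \<beta>) (\<lambda>_. B) x"
      unfolding move_def by (rule norm_step_avg_le[OF excitement]) (use Suc.prems in auto)
    then show ?thesis by (simp add: step_avg_const)
  qed
  define H where "H h = G (h ` {..<Suc n}) (h (Suc n))" for h :: "nat \<Rightarrow> int ^ 'n"
  have restrict: "restrict \<omega> {0..<Suc n} ` {..<Suc n} = \<omega> ` {..<Suc n}" for \<omega> :: "nat \<Rightarrow> int ^ 'n"
    by (intro image_cong) auto
  have "(\<integral>\<omega>. G (\<omega> ` {..<Suc n}) (\<omega> (Suc n)) \<partial>law) = (\<integral>\<omega>. H (restrict \<omega> {0..<Suc (Suc n)}) \<partial>law)"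
  proof (intro Bochner_Integration.integral_cong refl)
    fix \<omega> :: "nat \<Rightarrow> int ^ 'n"
    have "restrict \<omega> {0..<Suc (Suc n)} ` {..<Suc n} = \<omega> ` {..<Suc n}" by (intro image_cong) auto
    then show "G (\<omega> ` {..<Suc n}) (\<omega> (Suc n)) = H (restrict \<omega> {0..<Suc (Suc n)})" by (simp add: H_def)
  qed
  also have "\<dots> = (\<integral>\<omega>. (\<integral>y. H ((restrict \<omega> {0..<Suc n})(Suc n := y)) \<partial>measure_pmf (erw_kernel k \<beta> (Suc n) (restrict \<omega> {0..<Suc n}))) \<partial>law)"
    by (rule integral_erw_kernel[where B=B]) (use Suc.prems in \<open>simp add: H_def\<close>)
  also have "\<dots> = (\<integral>\<omega>. move {} G (\<omega> ` {..<n}) (\<omega> n) \<partial>law)"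
  proof (intro Bochner_Integration.integral_cong refl)
    fix \<omega> :: "nat \<Rightarrow> int ^ 'n"
    let ?I = "\<integral>y. H ((restrict \<omega> {0..<Suc n})(Suc n := y)) \<partial>measure_pmf (erw_kernel k \<beta> (Suc n) (restrict \<omega> {0..<Suc n}))"
    have 1: "((restrict \<omega> {0..<Suc n})(Suc n := y)) ` {..<Suc n} = insert (\<omega> n) (\<omega> ` {..<n})" for y
    proof -
      have "((restrict \<omega> {0..<Suc n})(Suc n := y)) ` {..<Suc n} = \<omega> ` {..<Suc n}"
        by (intro image_cong) auto
      then show ?thesis by (simp add: lessThan_Suc)
    qed
    have 2: "(\<exists>j<n. restrict \<omega> {0..<Suc n} j = restrict \<omega> {0..<Suc n} n) \<longleftrightarrow> \<omega> n \<in> {} \<union> \<omega> ` {..<n}"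
    proof -
      have "restrict \<omega> {0..<Suc n} j = \<omega> j" if "j \<le> n" for j using that by simp
      then have "(\<exists>j<n. restrict \<omega> {0..<Suc n} j = restrict \<omega> {0..<Suc n} n) \<longleftrightarrow> (\<exists>j<n. \<omega> n = \<omega> j)"
        by (metis less_imp_le order_refl)
      then show ?thesis by (simp only: image_iff Un_empty_left Bex_def lessThan_iff)
    qed
    have "?I
      = (\<integral>y. G (insert (\<omega> n) (\<omega> ` {..<n})) y \<partial>measure_pmf (map_pmf (\<lambda>e. \<omega> n + e) (step_pmf k (if \<omega> n \<in> {} \<union> \<omega> ` {..<n} then 0 else \<beta>))))"
      unfolding erw_kernel.simps 2 H_def 1 by simp
    also have "\<dots> = move {} G (\<omega> ` {..<n}) (\<omega> n)"
      unfolding move_def by (rule integral_step_pmf[OF excitement])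
    finally show "?I
      = move {} G (\<omega> ` {..<n}) (\<omega> n)" .
  qed
  also have "\<dots> = (move {} ^^ n) (move {} G) {} 0" by (rule Suc.IH) (rule bounded)
  finally show ?case by (simp only: funpow_Suc_right comp_def)
qed

lemma measurable_site: "(\<lambda>\<omega>. f (\<omega> n)) \<in> borel_measurable law"
  by (rule measurable_compose[of _ _ "count_space UNIV"]) measurable

lemma AE_near: "AE \<omega> in law. near n 0 (\<omega> n)"
proof -
  interpret prob_space law by (rule prob_space_erw_law)
  let ?A = "{\<omega> \<in> space law. near n 0 (\<omega> n)}"
  have m: "(\<lambda>\<omega>. \<omega> n) \<in> law \<rightarrow>\<^sub>M count_space UNIV"
    by (simp add: measurable_cong_sets[OF sets_erw_law refl] measurable_component_singleton)
  have A: "?A \<in> events"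
    using measurable_sets[OF m, of "{x. near n 0 x}"] by (simp add: vimage_def Int_def conj_commute)
  have "prob ?A = (\<integral>\<omega>. indicator {x. near n 0 x} (\<omega> n) \<partial>law)"
  proof -
    have "prob ?A = (\<integral>\<omega>. indicator ?A \<omega> \<partial>law)" using A by simp
    also have "\<dots> = (\<integral>\<omega>. indicator {x. near n 0 x} (\<omega> n) \<partial>law)"
      by (intro Bochner_Integration.integral_cong refl) (auto simp: indicator_def)
    finally show ?thesis .
  qed
  also have "\<dots> = expect n (indicator {x. near n 0 x}) {} 0"
    unfolding expect_def by (rule integral_erw_state[where B=1]) (auto simp: indicator_def)
  also have "\<dots> = 1"
  proof -
    have "norm (expect n (\<lambda>x. indicat_real {x. near n 0 x} x + (-1)) {} 0) \<le> 0"
      by (rule norm_expect_le) (auto simp: indicator_def)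
    then show ?thesis unfolding expect_add expect_const by simp
  qed
  finally show ?thesis using AE_prob_1[of ?A] by auto
qed

lemma integrable_erw:
  fixes f :: "int ^ 'n \<Rightarrow> 'b::euclidean_space"
  shows "integrable law (\<lambda>\<omega>. f (\<omega> n))"
proof -
  interpret prob_space law by (rule prob_space_erw_law)
  have "bounded (f ` {x. near n 0 x})" by (intro finite_imp_bounded finite_imageI finite_near)
  then obtain B where B: "\<And>x. near n 0 x \<Longrightarrow> norm (f x) \<le> B" unfolding bounded_iff by blast
  have "AE \<omega> in law. norm (f (\<omega> n)) \<le> B"
    using AE_near[of n] by (rule eventually_mono) (rule B)
  then show ?thesis by (intro integrable_const_bound[of _ B] measurable_site)
qed

lemma integral_erw_real:
  fixes f :: "int ^ 'n \<Rightarrow> real"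
  shows "(\<integral>\<omega>. f (\<omega> n) \<partial>law) = expect n f {} 0"
proof -
  define g where "g x = (if near n 0 x then f x else 0)" for x
  have "bounded (f ` {x. near n 0 x})" by (intro finite_imp_bounded finite_imageI finite_near)
  then obtain B where "B > 0" and bound: "\<And>x. near n 0 x \<Longrightarrow> norm (f x) \<le> B" unfolding bounded_pos by blast
  have B: "\<bar>g x\<bar> \<le> B" for x
    using bound[of x] \<open>B > 0\<close> by (cases "near n 0 x") (simp_all add: g_def)
  have "AE \<omega> in law. f (\<omega> n) = g (\<omega> n)"
    using AE_near[of n] by (rule eventually_mono) (simp add: g_def)
  then have "(\<integral>\<omega>. f (\<omega> n) \<partial>law) = (\<integral>\<omega>. g (\<omega> n) \<partial>law)"
    by (intro integral_cong_AE measurable_site)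
  also have "\<dots> = expect n g {} 0"
    unfolding expect_def by (rule integral_erw_state) (rule B)
  also have "\<dots> = expect n f {} 0"
  proof -
    have "norm (expect n (\<lambda>x. g x + (- f x)) {} 0) \<le> 0"
      by (rule norm_expect_le) (auto simp: g_def)
    then have "expect n g {} 0 + expect n (\<lambda>x. - f x) {} 0 = 0" unfolding expect_add by simp
    moreover have "expect n (\<lambda>x. - f x) {} 0 = - expect n f {} 0" by (rule expect_linear) (rule linear_uminus)
    ultimately show ?thesis by simp
  qed
  finally show ?thesis .
qed

text \<open>At time \<open>n\<close> the walk is in a finite box, so every function of its position is essentially bounded.\<close>

theorem integral_erw:
  fixes f :: "int ^ 'n \<Rightarrow> 'b::euclidean_space"
  shows "(\<integral>\<omega>. f (\<omega> n) \<partial>law) = expect n f {} 0"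
proof (rule euclidean_eqI)
  fix b :: 'b assume "b \<in> Basis"
  have "(\<integral>\<omega>. f (\<omega> n) \<partial>law) \<bullet> b = (\<integral>\<omega>. f (\<omega> n) \<bullet> b \<partial>law)"
    by (rule integral_inner_left[symmetric]) (rule integrable_erw)
  also have "\<dots> = expect n (\<lambda>x. f x \<bullet> b) {} 0" by (rule integral_erw_real)
  also have "\<dots> = expect n f {} 0 \<bullet> b"
    by (rule expect_linear) (simp add: linear_iff inner_add_left)
  finally show "(\<integral>\<omega>. f (\<omega> n) \<partial>law) \<bullet> b = expect n f {} 0 \<bullet> b" .
qed

end

section \<open>Asymptotics under the law of the walk\<close>

context weakly_excited_walk
begin

definition velocity :: "real ^ 'n" where
  "velocity = axis k speed"

definition covariance :: "real ^ 'n ^ 'n" where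
  "covariance = (\<chi> i j. if i = j then cov i else 0)"

lemma erw_mean_eq: "erw_mean k \<beta> n = axis k (mean_k n)"
proof -
  have "erw_mean k \<beta> n $ i = axis k (mean_k n) $ i" for i
  proof -
    have "erw_mean k \<beta> n $ i = expect n (\<lambda>y. real_vec y $ i) {} 0"
      unfolding erw_mean_def integral_erw
      by (rule expect_linear[symmetric]) (simp add: linear_iff)
    then show ?thesis by (cases "i = k") (simp_all add: mean_k_def expect_coordinate axis_nth)
  qed
  then show ?thesis by (simp add: vec_eq_iff)
qed

lemma erw_var_eq:
  "erw_var k \<beta> n = real n *\<^sub>R covariance + axis k (axis k (square_k n - (mean_k n)^2 - real n * variance_k))"
proof -
  have "erw_var k \<beta> n $ i $ j
      = (if i \<noteq> j then 0 else if i = k then square_k n - (mean_k n)^2 else real n / real CARD('n))" for i j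
  proof -
    define a b where "a = erw_mean k \<beta> n $ i" and "b = erw_mean k \<beta> n $ j"
    have "erw_var k \<beta> n $ i $ j = expect n (\<lambda>y. (coord i y - a) * (coord j y - b)) {} 0"
      unfolding integral_erw_real[symmetric] by (simp add: erw_var_def a_def b_def)
    also have "(\<lambda>y::int^'n. (coord i y - a) * (coord j y - b))
        = (\<lambda>y. ((coord i y * coord j y + (- b) * coord i y) + (- a) * coord j y) + a * b)"
      by (rule ext) (simp add: algebra_simps)
    also have "expect n \<dots> {} 0 = expect n (\<lambda>y. coord i y * coord j y) {} 0
        - b * expect n (\<lambda>y. coord i y) {} 0 - a * expect n (\<lambda>y. coord j y) {} 0 + a * b"
      by (simp only: expect_add expect_const expect_linear[OF linear_times])
    finally have e: "erw_var k \<beta> n $ i $ j = expect n (\<lambda>y. coord i y * coord j y) {} 0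
        - b * expect n (\<lambda>y. coord i y) {} 0 - a * expect n (\<lambda>y. coord j y) {} 0 + a * b" .
    have mean: "expect n (\<lambda>y. coord l y) {} 0 = erw_mean k \<beta> n $ l" for l
      by (cases "l = k") (simp_all add: erw_mean_eq axis_nth mean_k_def expect_coordinate)
    consider "i \<noteq> j" | "i = j" "i = k" | "i = j" "i \<noteq> k" by blast
    then show ?thesis
    proof cases
      case 1
      then have "a * b = 0" by (auto simp: a_def b_def erw_mean_eq axis_nth)
      then show ?thesis using 1 unfolding e mean by (auto simp: expect_product a_def b_def)
    next
      case 2
      have "erw_mean k \<beta> n $ k = mean_k n" by (simp add: erw_mean_eq axis_nth)
      with 2 have "a = mean_k n" "b = mean_k n" unfolding a_def b_def by simp_all
      moreover have "i = k" "j = k" using 2 by auto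
      ultimately show ?thesis
        unfolding e by (simp only:) (simp add: square_k_def power2_eq_square mean_k_def)
    next
      case 3
      then have "a = 0" "b = 0" by (auto simp: a_def b_def erw_mean_eq axis_nth)
      then show ?thesis using 3 expect_square[of i n "{}" 0] unfolding e by (simp add: power2_eq_square)
    qed
  qed
  then show ?thesis
    by (auto simp: vec_eq_iff covariance_def cov_def axis_nth)
qed

text \<open>As a limit of variances divided by \<open>n\<close>.\<close>

lemma variance_k_nonneg: "variance_k \<ge> 0"
proof -
  obtain B where B: "\<And>n. n \<ge> 1 \<Longrightarrow> \<bar>square_k n - (mean_k n)^2 - real n * variance_k\<bar> \<le> B * (1 + ln (real n))"
    using variance_k_asymptotic by blast
  have pos: "0 \<le> square_k n - (mean_k n)^2" for n
  proof -
    have "0 \<le> erw_var k \<beta> n $ k $ k" by (simp add: erw_var_def)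
    then show ?thesis unfolding erw_var_eq by (simp add: covariance_def cov_def axis_nth)
  qed
  have "(\<lambda>n. - B * ((1 + ln (real n)) / real n)) \<longlonglongrightarrow> - B * 0"
    by (intro tendsto_mult tendsto_const) real_asymp
  then have "(\<lambda>n. - B * ((1 + ln (real n)) / real n)) \<longlonglongrightarrow> 0" by simp
  moreover have "\<forall>\<^sub>F n in sequentially. - B * ((1 + ln (real n)) / real n) \<le> variance_k"
    using eventually_ge_at_top[of 1]
  proof eventually_elim
    case (elim n)
    then have "- B * (1 + ln (real n)) \<le> real n * variance_k" using B[of n] pos[of n] by linarith
    then show ?case using elim by (simp add: field_simps)
  qed
  ultimately show ?thesis by (rule tendsto_upperbound) simp
qed

lemma erw_mean_asymp: "asymp_linear (erw_mean k \<beta>) velocity (\<lambda>n. 1 / real n)"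
  unfolding asymp_linear_def
proof (rule bigoI[where c=128])
  show "\<forall>\<^sub>F n in sequentially. norm (norm (erw_mean k \<beta> n - real n *\<^sub>R velocity)) \<le> 128 * norm (real n * (1 / real n))"
    using eventually_ge_at_top[of 1]
  proof eventually_elim
    case (elim n)
    have "erw_mean k \<beta> n - real n *\<^sub>R velocity = axis k (mean_k n - real n * speed)"
      by (simp add: erw_mean_eq velocity_def vec_eq_iff axis_nth)
    then show ?case using elim mean_k_asymptotic[of n] by (simp add: norm_axis)
  qed
qed

lemma erw_var_asymp:
  "asymp_linear (erw_var k \<beta>) covariance (\<lambda>n. ln (real n) / real n powr min 1 ((real CARD('n) - 7) / 2))"
  unfolding asymp_linear_def
proof -
  obtain B where B: "\<And>n. n \<ge> 1 \<Longrightarrow> \<bar>square_k n - (mean_k n)^2 - real n * variance_k\<bar> \<le> B * (1 + ln (real n))"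
    using variance_k_asymptotic by blast
  have B0: "B \<ge> 0" using B[of 1] by simp
  \<comment> \<open>In more than eight dimensions \<open>(d - 7)/2\<close> is at least \<open>1\<close>.\<close>
  have m: "min 1 ((real CARD('n) - 7) / 2) = 1" using dim by simp
  show "(\<lambda>n. norm (erw_var k \<beta> n - real n *\<^sub>R covariance)) \<in> O(\<lambda>n. real n * (ln (real n) / real n powr min 1 ((real CARD('n) - 7) / 2)))"
  proof (rule bigoI[where c="2 * B"])
    show "\<forall>\<^sub>F n in sequentially. norm (norm (erw_var k \<beta> n - real n *\<^sub>R covariance))
        \<le> 2 * B * norm (real n * (ln (real n) / real n powr min 1 ((real CARD('n) - 7) / 2)))"
      \<comment> \<open>From \<open>n = 3\<close> on \<open>ln n\<close> is at least \<open>1\<close> and dominates the constant.\<close>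
      using eventually_ge_at_top[of 3]
    proof eventually_elim
      case (elim n)
      have "exp 1 \<le> real n" using exp_le elim by simp
      then have "1 \<le> ln (real n)" using elim by (subst ln_ge_iff) auto
      moreover have "norm (erw_var k \<beta> n - real n *\<^sub>R covariance) \<le> B * (1 + ln (real n))"
        unfolding erw_var_eq using B[of n] elim by (simp add: norm_axis)
      moreover have "B * (1 + ln (real n)) \<le> B * (2 * ln (real n))"
        using B0 \<open>1 \<le> ln (real n)\<close> by (intro mult_left_mono) auto
      ultimately have "norm (erw_var k \<beta> n - real n *\<^sub>R covariance) \<le> B * (2 * ln (real n))"
        by linarith
      then show ?case unfolding m using elim \<open>1 \<le> ln (real n)\<close> by simp
    qed
  qed
qed

definition rescaled :: "nat \<Rightarrow> (nat \<Rightarrow> int ^ 'n) \<Rightarrow> real ^ 'n" where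
  "rescaled n \<omega> = (real_vec (\<omega> n) - real n *\<^sub>R velocity) /\<^sub>R sqrt (real n)"

lemma measurable_rescaled [measurable]: "rescaled n \<in> borel_measurable law"
  unfolding rescaled_def by measurable

lemma char_rescaled: "(\<integral>\<omega>. iexp (t \<bullet> rescaled n \<omega>) \<partial>law) = char_walk (t /\<^sub>R sqrt (real n)) n"
proof -
  have "t \<bullet> rescaled n \<omega> = phase (t /\<^sub>R sqrt (real n)) n (\<omega> n)" for \<omega>
    by (simp add: rescaled_def phase_def velocity_def inner_diff_right inner_axis algebra_simps)
  then show ?thesis by (simp add: char_walk_def integral_erw[of "\<lambda>y. iexp (phase (t /\<^sub>R sqrt (real n)) n y)"])
qed

lemma quad_eq: "quad t = t \<bullet> (covariance *v t)"
proof -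
  have "(\<Sum>j\<in>UNIV. (if i = j then cov i else 0) * t $ j) = cov i * t $ i" for i
    by (simp add: if_distrib[of "\<lambda>z. z * _"] cong: if_cong)
  then show ?thesis
    by (simp add: quad_def covariance_def inner_vec_def matrix_vector_mult_def power2_eq_square mult_ac)
qed

text \<open>Uniformly bounded second moments make the laws of the rescaled positions tight.\<close>

lemma second_moment_rescaled:
  "\<exists>C. \<forall>n\<ge>1. (\<integral>\<omega>. (norm (rescaled n \<omega>))^2 \<partial>law) \<le> C"
proof -
  obtain B where B: "\<And>n. n \<ge> 1 \<Longrightarrow> \<bar>square_k n - (mean_k n)^2 - real n * variance_k\<bar> \<le> B * (1 + ln (real n))"
    using variance_k_asymptotic by blast
  have B0: "B \<ge> 0" using B[of 1] by simp
  have "(\<integral>\<omega>. (norm (rescaled n \<omega>))^2 \<partial>law) \<le> 1 + variance_k + B + 128^2" if n: "n \<ge> 1" for n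
  proof -
    define c where "c = real n * speed"
    have comp: "rescaled n \<omega> $ i = (coord i (\<omega> n) - (if i = k then c else 0)) / sqrt (real n)" for \<omega> i
      by (simp add: rescaled_def velocity_def c_def axis_nth divide_inverse mult.commute)
    have "(norm (rescaled n \<omega>))^2 = (\<Sum>i\<in>UNIV. (rescaled n \<omega> $ i)^2)" for \<omega>
      unfolding power2_norm_eq_inner inner_vec_def by (simp add: power2_eq_square)
    then have "(norm (rescaled n \<omega>))^2
       = (\<Sum>i\<in>UNIV. (1 / real n) * (coord i (\<omega> n) - (if i = k then c else 0))^2)" for \<omega>
      unfolding comp power_divide by simp
    then have "(\<integral>\<omega>. (norm (rescaled n \<omega>))^2 \<partial>law)
       = expect n (\<lambda>y. \<Sum>i\<in>UNIV. (1 / real n) * (coord i y - (if i = k then c else 0))^2) {} 0"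
      using integral_erw_real[of "\<lambda>y. \<Sum>i\<in>UNIV. (1 / real n) * (coord i y - (if i = k then c else 0))^2" n]
      by presburger
    also have "\<dots> = (\<Sum>i\<in>UNIV. (1 / real n) * expect n (\<lambda>y. (coord i y - (if i = k then c else 0))^2) {} 0)"
      by (simp only: expect_sum expect_linear[OF linear_times])
    also have "\<dots> = (1 / real n) * expect n (\<lambda>y. (coord k y - c)^2) {} 0
       + (\<Sum>i\<in>UNIV - {k}. (1 / real n) * expect n (\<lambda>y. (coord i y)^2) {} 0)"
      by (subst sum.remove[of _ k]) auto
    also have "(\<Sum>i\<in>UNIV - {k}. (1 / real n) * expect n (\<lambda>y. (coord i y)^2) {} 0)
       = (\<Sum>i\<in>UNIV - {k}. 1 / real CARD('n))"
      using n by (intro sum.cong) (auto simp: expect_square)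
    also have "\<dots> \<le> 1" by (simp add: divide_le_eq)
    also have "expect n (\<lambda>y. (coord k y - c)^2) {} 0 = square_k n - 2 * c * mean_k n + c^2"
    proof -
      have "(\<lambda>y::int^'n. (coord k y - c)^2) = (\<lambda>y. ((coord k y)^2 + (- 2 * c) * coord k y) + c^2)"
        by (rule ext) (simp add: power2_eq_square algebra_simps)
      then show ?thesis
        by (simp only: expect_add expect_const expect_linear[OF linear_times]) (simp add: square_k_def mean_k_def)
    qed
    also have "square_k n - 2 * c * mean_k n + c^2 = (square_k n - (mean_k n)^2) + (mean_k n - c)^2"
      by (simp add: power2_eq_square algebra_simps)
    also have "(1 / real n) * \<dots> \<le> (1 / real n) * (real n * (variance_k + B + 128^2))"
    proof (intro mult_left_mono)
      have "ln (real n) \<le> real n - 1" using n by (intro ln_le_minus_one) auto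
      then have "B * (1 + ln (real n)) \<le> B * real n" using B0 by (intro mult_left_mono) auto
      then have "square_k n - (mean_k n)^2 \<le> real n * variance_k + B * real n" using B[OF n] by linarith
      moreover have "(mean_k n - c)^2 \<le> 128^2"
        using power_mono[OF mean_k_asymptotic[of n], of 2] by (simp add: c_def)
      moreover have "(128::real)^2 \<le> real n * 128^2" using n by simp
      ultimately show "(square_k n - (mean_k n)^2) + (mean_k n - c)^2 \<le> real n * (variance_k + B + 128^2)"
        by (simp add: algebra_simps)
    qed simp
    also have "(1 / real n) * (real n * (variance_k + B + 128^2)) = variance_k + B + 128^2" using n by simp
    finally show ?thesis by simp
  qed
  then show ?thesis by blast
qed

lemma tight_rescaled:
  assumes "e > 0"
  shows "\<exists>R. \<forall>\<^sub>F n in sequentially. measure (distr law borel (rescaled n)) {x. norm x > R} \<le> e"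
proof -
  obtain C where C: "\<And>n. n \<ge> 1 \<Longrightarrow> (\<integral>\<omega>. (norm (rescaled n \<omega>))^2 \<partial>law) \<le> C"
    using second_moment_rescaled by blast
  have "0 \<le> (\<integral>\<omega>. (norm (rescaled 1 \<omega>))^2 \<partial>law)" by simp
  then have C0: "C \<ge> 0" using C[of 1] by linarith
  define R where "R = C / e + 1"
  have R: "R \<ge> 1" using C0 assms by (simp add: R_def)
  have "measure (distr law borel (rescaled n)) {x. norm x > R} \<le> e" if n: "n \<ge> 1" for n
  proof -
    interpret prob_space law by (rule prob_space_erw_law)
    have int: "integrable law (\<lambda>\<omega>. (norm (rescaled n \<omega>))^2)"
      unfolding rescaled_def by (rule integrable_erw)
    have "measure (distr law borel (rescaled n)) {x. norm x > R}
        = measure law {\<omega> \<in> space law. norm (rescaled n \<omega>) > R}"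
      by (subst measure_distr) (auto simp: vimage_def Int_def conj_commute)
    also have "\<dots> \<le> measure law {\<omega> \<in> space law. (norm (rescaled n \<omega>))^2 \<ge> R^2}"
      using R by (intro finite_measure_mono) (auto intro!: power_mono)
    also have "\<dots> \<le> (\<integral>\<omega>. (norm (rescaled n \<omega>))^2 \<partial>law) / R^2"
      by (rule integral_Markov_inequality_measure[OF int]) (use R in auto)
    also have "\<dots> \<le> C / R^2" using C[OF n] by (intro divide_right_mono) auto
    also have "\<dots> \<le> e"
    proof -
      have "C / e \<le> R" by (simp add: R_def)
      also have "R \<le> R^2" using R by (simp add: power2_eq_square)
      finally have "C \<le> R^2 * e" using assms by (simp add: pos_divide_le_eq)
      then show ?thesis using R by (simp add: pos_divide_le_eq mult.commute)
    qed
    finally show ?thesis .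
  qed
  then show ?thesis by (intro exI[of _ R] eventually_sequentiallyI[of 1])
qed

theorem central_limit_theorem_erw:
  "\<exists>N. is_centred_normal covariance N \<and> converges_in_distribution law rescaled N"
proof -
  have "0 \<le> cov i" for i using variance_k_nonneg by (simp add: cov_def)
  then have "\<exists>N. is_centred_normal covariance N"
    unfolding covariance_def by (rule diagonal_normal_exists)
  then obtain N where N: "is_centred_normal covariance N" ..
  have "(\<lambda>n. \<integral>x. f x \<partial>distr law borel (rescaled n)) \<longlonglongrightarrow> (\<integral>x. f x \<partial>N)"
    if f: "continuous_on UNIV f" "bounded (range f)" for f :: "real ^ 'n \<Rightarrow> real"
  proof (rule levy_continuity_euclidean[OF _ _ _ _ _ _ f])
    show "prob_space (distr law borel (rescaled n))" for n
      by (intro prob_space.prob_space_distr prob_space_erw_law measurable_rescaled)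
    show "sets (distr law borel (rescaled n)) = sets borel" for n by (rule sets_distr)
    show "prob_space N" "sets N = sets borel" using N unfolding is_centred_normal_def by blast+
    show "\<exists>R. \<forall>\<^sub>F n in sequentially. measure (distr law borel (rescaled n)) {x. R < norm x} \<le> e"
      if "e > 0" for e using that by (rule tight_rescaled)
    fix t :: "real ^ 'n"
    have "(\<lambda>x. iexp (t \<bullet> x)) \<in> borel_measurable borel"
      by (intro borel_measurable_continuous_onI continuous_intros)
    then have "(\<integral>x. iexp (t \<bullet> x) \<partial>distr law borel (rescaled n)) = (\<integral>\<omega>. iexp (t \<bullet> rescaled n \<omega>) \<partial>law)" for n
      by (rule integral_distr[OF measurable_rescaled])
    moreover have "(\<integral>x. iexp (t \<bullet> x) \<partial>N) = exp (- complex_of_real (quad t) / 2)"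
      unfolding quad_eq by (rule centred_normal_char[OF N])
    ultimately show "(\<lambda>n. \<integral>x. iexp (t \<bullet> x) \<partial>distr law borel (rescaled n)) \<longlonglongrightarrow> (\<integral>x. iexp (t \<bullet> x) \<partial>N)"
      using char_walk_limit[of t] by (simp only: char_rescaled)
  qed
  then have "converges_in_distribution law rescaled N"
    by (simp add: converges_in_distribution_def)
  with N show ?thesis by (intro exI[of _ N] conjI)
qed

end

theorem theorem2p2:
  fixes k :: "'n::finite"
  assumes "CARD('n) > 8"
  shows "\<exists>\<beta>\<^sub>0>0. \<forall>\<beta>::real. 0 \<le> \<beta> \<longrightarrow> \<beta> \<le> 1 \<longrightarrow> \<beta> \<le> \<beta>\<^sub>0 \<longrightarrow>
    (\<exists>(\<theta> :: real ^ 'n) (\<Sigma> :: real ^ 'n ^ 'n).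
       (\<forall>i. i \<noteq> k \<longrightarrow> \<theta> $ i = 0) \<and>
       asymp_linear (erw_mean k \<beta>) \<theta> (\<lambda>n. 1 / real n) \<and>
       asymp_linear (erw_var k \<beta>) \<Sigma>
         (\<lambda>n. ln (real n) / real n powr min 1 ((real CARD('n) - 7) / 2)) \<and>
       (\<exists>N. is_centred_normal \<Sigma> N \<and>
          converges_in_distribution (erw_law k \<beta>)
            (\<lambda>n \<omega>. (real_vec (\<omega> n) - real n *\<^sub>R \<theta>) /\<^sub>R sqrt (real n)) N))"
proof (intro exI[of _ "1 / (32 * return_const TYPE('n))"] conjI allI impI)
  have pos: "return_const TYPE('n) > 0" by (simp add: return_const_def add_nonneg_pos)
  then show "0 < 1 / (32 * return_const TYPE('n))" by simp
  fix \<beta> :: real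
  assume \<beta>: "0 \<le> \<beta>" "\<beta> \<le> 1" "\<beta> \<le> 1 / (32 * return_const TYPE('n))"
  interpret weakly_excited_walk k \<beta>
    using \<beta> pos assms by unfold_locales (auto simp: field_simps)
  show "\<exists>(\<theta> :: real ^ 'n) (\<Sigma> :: real ^ 'n ^ 'n).
       (\<forall>i. i \<noteq> k \<longrightarrow> \<theta> $ i = 0) \<and>
       asymp_linear (erw_mean k \<beta>) \<theta> (\<lambda>n. 1 / real n) \<and>
       asymp_linear (erw_var k \<beta>) \<Sigma>
         (\<lambda>n. ln (real n) / real n powr min 1 ((real CARD('n) - 7) / 2)) \<and>
       (\<exists>N. is_centred_normal \<Sigma> N \<and>
          converges_in_distribution (erw_law k \<beta>)
            (\<lambda>n \<omega>. (real_vec (\<omega> n) - real n *\<^sub>R \<theta>) /\<^sub>R sqrt (real n)) N)"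
    using erw_mean_asymp erw_var_asymp central_limit_theorem_erw
    by (intro exI[of _ velocity] exI[of _ covariance]) (auto simp: velocity_def axis_nth rescaled_def[abs_def])
qed

end
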